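(* Assume $\mathrm{E}[X^2]<\infty$ and suppose that constants $\gamma>0$, $\alpha\ge0$, $A,B,C$ with $\gamma>1+2\alpha$ are such that the following hold. (1) $|u|^\gamma\phi_f(u)$ is integrable. (2) $\phi_w$ is bounded, real valued, symmetric, vanishes outside $[-1,1]$, $\phi_w(0)=1$, and $\phi_w(1-t)=At^\alpha+o(t^\alpha)$ as $t\downarrow0$. (3) $\phi_k$ is bounded, real valued, symmetric, vanishes outside $[-1,1]$, $\int_{-1}^1\phi_k(t)\,dt=2$, and, as $t\downarrow0$, $\phi_k(t)=Bt^\gamma+o(t^\gamma)$ and $\phi_k(1-t)=Ct^\alpha+o(t^\alpha)$. (4) $h=h_n=\sigma((1+\eta_n)\log n)^{-1/2}$ and $g=g_n=\sigma((1+\delta_n)\log n)^{-1/2}$, where $\eta_n\downarrow0$, $\delta_n\downarrow0$, $\eta_n-\delta_n>0$, $(\eta_n-\delta_n)\log n\to\infty$, and $$-\eta_n\log n+(1+2\alpha)\log\log n\to\infty,\qquad -\delta_n\log n+(1+2\alpha)\log\log n\to\infty .$$ (5) $0<\epsilon_n<1$, $\epsilon_n\downarrow0$ and $\dfrac{\log\epsilon_n}{(\eta_n-\delta_n)\log n}\to0$. Then, for every fixed $x\in\mathbb{R}$, as $n\to\infty$, $$\frac{\sqrt n}{h^{1+2\alpha}e^{\sigma^2/(2h^2)}}\bigl(f^*_{nhg}(x)-\mathrm{E}[f^*_{nhg}(x)]\bigr)\xrightarrow{\mathcal D}N\!\left(0,\ \frac{A^2}{2\pi^2(1-p)^2}\left(\frac1{\sigma^2}\right)^{2+2\alpha}(\Gamma(\alpha+1))^2\right),$$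 where $\Gamma$ is the gamma function and $\xrightarrow{\mathcal D}$ denotes convergence in distribution.
   Context: Setting: $\sigma>0$ is known and $0\le p<1$. $U,V,Z$ are independent random variables, $U$ is Bernoulli with $P(U=0)=p$ and $P(U=1)=1-p$, $V$ has a density $f$ on $\mathbb{R}$ with characteristic function $\phi_f(t)=\int e^{itx}f(x)\,dx$, and $Z$ is standard normal. Put $Y=UV$ and $X=Y+\sigma Z$. $X_1,X_2,\dots$ are i.i.d. copies of $X$, and $\phi_{emp}(t)=\frac1n\sum_{j=1}^n e^{itX_j}$. $\phi_w,\phi_k$ are the Fourier transforms of kernel functions $w,k$, in the convention $w(x)=\frac1{2\pi}\int_{-\infty}^\infty e^{-itx}\phi_w(t)\,dt$. Estimators: with bandwidths $h,g>0$ and a truncation sequence $\epsilon_n$, $$p_{ng}=\frac g2\int_{-1/g}^{1/g}\frac{\phi_{emp}(t)\phi_k(gt)}{e^{-\sigma^2t^2/2}}\,dt,\qquad \hat p_{ng}=\min(p_{ng},1-\epsilon_n),$$ $$f^*_{nhg}(x)=\frac1{2\pi}\int_{-\infty}^\infty e^{-itx}\,\frac{\phi_{emp}(t)-\hat p_{ng}e^{-\sigma^2t^2/2}}{(1-\hat p_{ng})e^{-\sigma^2t^2/2}}\,\phi_w(ht)\,dt .$$ *)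

theory Defs
  imports "HOL-Probability.Probability"
begin

section \<open>Deconvolution of a density with an atom at zero\<close>

definition cf_of_density :: "(real \<Rightarrow> real) \<Rightarrow> real \<Rightarrow> complex" where
  "cf_of_density f t = (\<integral>x. iexp (t * x) * complex_of_real (f x) \<partial>lborel)"

text \<open>
  A kernel and its Fourier transform are tied by the inversion formula only; the kernel itself
  need not be Lebesgue integrable (the sinc kernel, whose transform is the indicator of
  \<open>[-1,1]\<close>, is a typical example).
\<close>

definition kernel_with_transform :: "(real \<Rightarrow> real) \<Rightarrow> (real \<Rightarrow> real) \<Rightarrow> bool" where
  "kernel_with_transform w \<phi> \<longleftrightarrow>
     \<phi> \<in> borel_measurable borel \<and> integrable lborel \<phi> \<and>
     (\<forall>x. complex_of_real (w x) =
        1 / (2 * pi) * (\<integral>t. iexp (- (t * x)) * complex_of_real (\<phi> t) \<partial>lborel))"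

subsection \<open>The estimators\<close>

text \<open>
  The estimators are functions of a realised sample \<open>\<xi>\<close>, of which only
  \<open>\<xi> 1, \<dots>, \<xi> n\<close> are used.
\<close>

definition phi_emp :: "nat \<Rightarrow> (nat \<Rightarrow> real) \<Rightarrow> real \<Rightarrow> complex" where
  "phi_emp n \<xi> t = 1 / of_nat n * (\<Sum>j=1..n. iexp (t * \<xi> j))"

text \<open>
  The integrals defining the two estimators are complex in form but real in value when the
  transforms are symmetric (lemmas \<open>of_real_p_est\<close> and \<open>of_real_f_est\<close> below),
  so taking the real part only changes the type.
\<close>

definition p_est :: "real \<Rightarrow> (real \<Rightarrow> real) \<Rightarrow> real \<Rightarrow> nat \<Rightarrow> (nat \<Rightarrow> real) \<Rightarrow> real" where
  "p_est \<sigma> \<phi>k g n \<xi> =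
     Re (g / 2 * (\<integral>t\<in>{- (1 / g)..1 / g}.
           phi_emp n \<xi> t * complex_of_real (\<phi>k (g * t))
             / complex_of_real (exp (- (\<sigma>\<^sup>2 * t\<^sup>2) / 2)) \<partial>lborel))"

definition p_hat :: "real \<Rightarrow> (real \<Rightarrow> real) \<Rightarrow> real \<Rightarrow> real \<Rightarrow> nat \<Rightarrow> (nat \<Rightarrow> real) \<Rightarrow> real" where
  "p_hat \<sigma> \<phi>k g \<epsilon> n \<xi> = min (p_est \<sigma> \<phi>k g n \<xi>) (1 - \<epsilon>)"

definition f_est ::
  "real \<Rightarrow> (real \<Rightarrow> real) \<Rightarrow> (real \<Rightarrow> real) \<Rightarrow> real \<Rightarrow> real \<Rightarrow> real \<Rightarrow> nat \<Rightarrow> (nat \<Rightarrow> real) \<Rightarrow> real \<Rightarrow> real"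
where
  "f_est \<sigma> \<phi>w \<phi>k h g \<epsilon> n \<xi> x =
     Re (1 / (2 * pi) * (\<integral>t. iexp (- (t * x)) *
           ((phi_emp n \<xi> t
               - complex_of_real (p_hat \<sigma> \<phi>k g \<epsilon> n \<xi> * exp (- (\<sigma>\<^sup>2 * t\<^sup>2) / 2)))
             / complex_of_real ((1 - p_hat \<sigma> \<phi>k g \<epsilon> n \<xi>) * exp (- (\<sigma>\<^sup>2 * t\<^sup>2) / 2)))
           * complex_of_real (\<phi>w (h * t)) \<partial>lborel))"

lemma cnj_phi_emp: "cnj (phi_emp n \<xi> t) = phi_emp n \<xi> (- t)"
  by (simp add: phi_emp_def exp_cnj)

lemma integral_hermitian_real:
  fixes F :: "real \<Rightarrow> complex"
  assumes "\<And>t. cnj (F t) = F (- t)"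
  shows "complex_of_real (Re (\<integral>t. F t \<partial>lborel)) = (\<integral>t. F t \<partial>lborel)"
proof -
  have "cnj (\<integral>t. F t \<partial>lborel) = (\<integral>t. F (- t) \<partial>lborel)"
    by (simp add: assms flip: Bochner_Integration.integral_cnj)
  also have "\<dots> = (\<integral>t. F t \<partial>lborel)"
    using lborel_integral_real_affine[of "-1" F 0] by simp
  finally have "(\<integral>t. F t \<partial>lborel) \<in> \<real>"
    by (simp add: Reals_cnj_iff)
  then show ?thesis
    by (simp add: complex_is_Real_iff complex_eq_iff)
qed

lemma of_real_p_est:
  assumes "\<And>t. \<phi>k (- t) = \<phi>k t"
  shows "complex_of_real (p_est \<sigma> \<phi>k g n \<xi>) =
    g / 2 * (\<integral>t\<in>{- (1 / g)..1 / g}.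
       phi_emp n \<xi> t * complex_of_real (\<phi>k (g * t))
         / complex_of_real (exp (- (\<sigma>\<^sup>2 * t\<^sup>2) / 2)) \<partial>lborel)"
proof -
  let ?F = "\<lambda>t. indicator {- (1 / g)..1 / g} t *\<^sub>R (phi_emp n \<xi> t * complex_of_real (\<phi>k (g * t))
         / complex_of_real (exp (- (\<sigma>\<^sup>2 * t\<^sup>2) / 2)))"
  have "cnj (?F t) = ?F (- t)" for t
    using assms[of "g * t"] by (auto simp: cnj_phi_emp indicator_def)
  from integral_hermitian_real[of ?F, OF this] show ?thesis
    by (simp add: p_est_def set_lebesgue_integral_def complex_eq_iff)
qed

lemma of_real_f_est:
  assumes "\<And>t. \<phi>w (- t) = \<phi>w t"
  shows "complex_of_real (f_est \<sigma> \<phi>w \<phi>k h g \<epsilon> n \<xi> x) =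
    1 / (2 * pi) * (\<integral>t. iexp (- (t * x)) *
       ((phi_emp n \<xi> t
           - complex_of_real (p_hat \<sigma> \<phi>k g \<epsilon> n \<xi> * exp (- (\<sigma>\<^sup>2 * t\<^sup>2) / 2)))
         / complex_of_real ((1 - p_hat \<sigma> \<phi>k g \<epsilon> n \<xi>) * exp (- (\<sigma>\<^sup>2 * t\<^sup>2) / 2)))
       * complex_of_real (\<phi>w (h * t)) \<partial>lborel)"
proof -
  let ?F = "\<lambda>t. iexp (- (t * x)) *
       ((phi_emp n \<xi> t
           - complex_of_real (p_hat \<sigma> \<phi>k g \<epsilon> n \<xi> * exp (- (\<sigma>\<^sup>2 * t\<^sup>2) / 2)))
         / complex_of_real ((1 - p_hat \<sigma> \<phi>k g \<epsilon> n \<xi>) * exp (- (\<sigma>\<^sup>2 * t\<^sup>2) / 2)))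
       * complex_of_real (\<phi>w (h * t))"
  have "cnj (?F t) = ?F (- t)" for t
    using assms[of "h * t"] by (simp add: cnj_phi_emp exp_cnj)
  from integral_hermitian_real[of ?F, OF this] show ?thesis
    unfolding f_est_def by (simp add: complex_eq_iff)
qed

subsection \<open>Limits\<close>

text \<open>
  \<open>a\<^sub>n \<down> 0\<close>. Only convergence from above is required, for large \<open>n\<close>; a sequence that
  decreases monotonically to 0 has this property.
\<close>

definition tends_down_to_0 :: "(nat \<Rightarrow> real) \<Rightarrow> bool" where
  "tends_down_to_0 a \<longleftrightarrow> (\<forall>\<^sub>F n in sequentially. 0 \<le> a n) \<and> a \<longlonglongrightarrow> 0"

text \<open>
  The normal law with given mean and variance, including the point mass for variance 0,
  where \<^const>\<open>normal_density\<close> is not a probability density.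
\<close>

definition normal_law :: "real \<Rightarrow> real \<Rightarrow> real measure" where
  "normal_law m v = (if v = 0 then return borel m
     else density lborel (\<lambda>x. ennreal (normal_density m (sqrt v) x)))"

end

theory Submission
  imports Defs
begin

text \<open>
  Write \<open>D(\<phi>, h, y) = \<integral> cos (t y) exp (\<sigma>\<^sup>2 t\<^sup>2 / 2) \<phi> (h t) dt\<close> (\<open>deconv_kernel\<close>). Both estimators are
  built from empirical means of such kernels: the raw estimator of \<open>p\<close> is \<open>g / 2\<close> times the mean of
  \<open>D(\<phi>k, g, X\<^sub>j)\<close>, and the density estimator equals \<open>(G - P W) / (1 - P)\<close>, where \<open>G\<close> is the mean of
  \<open>D(\<phi>w, h, X\<^sub>j - x) / (2 \<pi>)\<close>, \<open>P\<close> is the truncated estimator of \<open>p\<close> and \<open>W = w (x / h) / h\<close>.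

  The Gaussian factor is removed by the deconvolution, so \<open>G\<close> has expectation \<open>p W + (1 - p) f\<^sub>0\<close>
  with \<open>f\<^sub>0\<close> the density \<open>f\<close> smoothed by the kernel. With \<open>S = G - E G\<close> the density estimator becomes
  \<open>f\<^sub>0 + (S + (p - P) (W - f\<^sub>0)) / (1 - P)\<close>. Two facts then prove the theorem.

  First, the normalized \<open>S\<close> is asymptotically normal. The weight \<open>exp (\<sigma>\<^sup>2 t\<^sup>2 / 2)\<close> concentrates the
  integral defining \<open>D(\<phi>w, h, y)\<close> at the edges \<open>\<bar>t\<bar> = 1 / h\<close> of the support of \<open>\<phi>w (h t)\<close>, and
  \<open>\<phi>w (1 - u)\<close> behaves like \<open>A u powr \<alpha>\<close> for small \<open>u\<close>. Laplace's method shows that \<open>D(\<phi>w, h, y)\<close> divided by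
  \<open>h powr (1 + 2 \<alpha>) exp (\<sigma>\<^sup>2 / (2 h\<^sup>2))\<close> is bounded and differs from
  \<open>2 A \<Gamma>(\<alpha> + 1) \<sigma> powr (- 2 - 2 \<alpha>) cos (y / h)\<close> by a term that tends to 0
  (\<open>deconv_kernel_bound\<close>, \<open>deconv_kernel_asymp\<close>). The characteristic function of \<open>X\<close> vanishes at
  infinity, so \<open>cos ((X - x) / h)\<close> has mean tending to 0 and second moment tending to 1/2; this is where
  the limiting variance comes from (\<open>variance_deconv_kernel_tendsto\<close>). Since the normalized kernels are
  uniformly bounded, a central limit theorem for bounded triangular arrays applies
  (\<open>char_bounded_array_tendsto\<close>).

  Second, replacing \<open>P\<close> by \<open>p\<close> changes the normalized estimator by an amount that is negligible in
  \<open>L\<^sup>1\<close>. The bandwidth \<open>g\<close> exceeds \<open>h\<close>, hence the standard deviation of the estimator of \<open>p\<close>, compared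
  with \<open>h\<close> times the scale on which \<open>S\<close> is normalized, is smaller by a factor \<open>exp (- (\<eta> - \<delta>) log n / 2)\<close>, up to powers of \<open>g / h\<close>; its
  bias is of order \<open>g powr (1 + \<gamma>)\<close> with \<open>\<gamma> > 1 + 2 \<alpha>\<close>. Both beat the factor \<open>1 / h\<close> from \<open>W\<close> and the factor
  \<open>1 / \<epsilon>\<close> that bounds \<open>1 / (1 - P)\<close> (\<open>p_est_mean_square\<close>, \<open>bandwidth_rates\<close>, \<open>f_est_linearization\<close>).
  Convergence in \<open>L\<^sup>1\<close> controls the expectation of the remainder as well, and it passes to
  characteristic functions directly (\<open>char_tendsto_L1_perturbation\<close>); Levy's continuity theorem
  concludes.
\<close>

section \<open>Laplace asymptotics of the deconvolution kernel\<close>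

text \<open>
  Near 0 the asymptotic relation gives the bound; away from 0 boundedness is enough, because
  \<open>t powr a\<close> stays above \<open>d powr a\<close>.
\<close>

lemma abs_le_powr_of_asymp:
  fixes \<psi> :: "real \<Rightarrow> real"
  assumes bdd: "bounded (range \<psi>)" and a: "a \<ge> 0"
    and o: "(\<lambda>t. \<psi> t - A * t powr a) \<in> o[at_right 0](\<lambda>t. t powr a)"
  shows "\<exists>K\<ge>0. \<forall>t. 0 < t \<longrightarrow> t \<le> 1 \<longrightarrow> \<bar>\<psi> t\<bar> \<le> K * t powr a"
proof -
  obtain B where B: "\<And>t. \<bar>\<psi> t\<bar> \<le> B"
    using bdd by (auto simp: bounded_iff)
  have "\<forall>\<^sub>F t in at_right 0. \<bar>\<psi> t - A * t powr a\<bar> \<le> t powr a"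
    using landau_o.smallD[OF o, of 1] by simp
  then obtain d where d: "d > 0" "\<And>t. 0 < t \<Longrightarrow> t < d \<Longrightarrow> \<bar>\<psi> t - A * t powr a\<bar> \<le> t powr a"
    by (auto simp: eventually_at_right_field)
  have "B \<ge> 0" using B[of 0] by linarith
  have "\<bar>\<psi> t\<bar> \<le> (\<bar>A\<bar> + 1 + B / d powr a) * t powr a" if t: "0 < t" for t
  proof (cases "t < d")
    case True
    have "\<bar>\<psi> t\<bar> \<le> \<bar>\<psi> t - A * t powr a\<bar> + \<bar>A * t powr a\<bar>" by linarith
    also have "\<dots> \<le> t powr a + \<bar>A\<bar> * t powr a"
      using d(2)[OF t True] by (simp add: abs_mult)
    also have "\<dots> \<le> (\<bar>A\<bar> + 1 + B / d powr a) * t powr a"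
      using \<open>B \<ge> 0\<close> by (simp add: algebra_simps)
    finally show ?thesis .
  next
    case False
    have "d powr a \<le> t powr a" using False d a by (intro powr_mono2) auto
    then have "B \<le> B / d powr a * t powr a"
      using \<open>B \<ge> 0\<close> d by (simp add: field_simps mult_left_mono)
    also have "\<dots> \<le> (\<bar>A\<bar> + 1 + B / d powr a) * t powr a"
      by (intro mult_right_mono) auto
    finally show ?thesis using B[of t] by linarith
  qed
  moreover have "\<bar>A\<bar> + 1 + B / d powr a \<ge> 0" using \<open>B \<ge> 0\<close> by simp
  ultimately show ?thesis by blast
qed

lemma has_bochner_integral_Gamma:
  fixes a :: real
  assumes "a > -1"
  shows "has_bochner_integral lborel (\<lambda>s. indicator {0..} s * s powr a * exp (- s)) (Gamma (a + 1))"
proof (rule has_bochner_integral_nn_integral)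
  show "(\<integral>\<^sup>+ s. ennreal (indicator {0..} s * s powr a * exp (- s)) \<partial>lborel) = ennreal (Gamma (a + 1))"
    using Gamma_conv_nn_integral_real[of "a + 1"] assms by (simp add: exp_minus field_simps)
qed (use assms in \<open>auto intro!: Gamma_real_nonneg\<close>)

lemma integrable_powr_exp_half:
  fixes a :: real
  assumes "a > -1"
  shows "integrable lborel (\<lambda>s. indicator {0..} s * s powr a * exp (- s / 2))"
proof -
  have "integrable lborel (\<lambda>s::real. 2 powr a * (indicator {0..} (0 + (1/2) * s) * (0 + (1/2) * s) powr a * exp (- (0 + (1/2) * s))))"
    using has_bochner_integral_Gamma[OF assms]
    by (intro integrable_mult_right lborel_integrable_real_affine) (auto simp: has_bochner_integral_iff)
  also have "(\<lambda>s::real. 2 powr a * (indicator {0..} (0 + (1/2) * s) * (0 + (1/2) * s) powr a * exp (- (0 + (1/2) * s)))) =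
      (\<lambda>s. indicator {0..} s * s powr a * exp (- s / 2))"
    by (auto simp: indicator_def powr_divide)
  finally show ?thesis .
qed

text \<open>
  Up to the factor \<open>1 / (2 \<pi>)\<close> and scaling, this is the deconvoluting kernel: the inverse Fourier
  transform of \<open>\<phi> (h t)\<close> divided by the characteristic function of the normal error. For even \<open>\<phi>\<close>
  that transform is real, which is why only the cosine appears.
\<close>

definition deconv_kernel :: "real \<Rightarrow> (real \<Rightarrow> real) \<Rightarrow> real \<Rightarrow> real \<Rightarrow> real" where
  "deconv_kernel \<sigma> \<phi> h y = (\<integral>t. cos (t * y) * exp (\<sigma>\<^sup>2 * t\<^sup>2 / 2) * \<phi> (h * t) \<partial>lborel)"

text \<open>
  The properties that the transforms of both kernels share. The expansion of \<open>\<phi>\<close> at the edge 1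
  of its support drives all asymptotics.
\<close>

locale kernel_transform =
  fixes \<phi> :: "real \<Rightarrow> real" and \<alpha> A :: real
  assumes phi_measurable [measurable]: "\<phi> \<in> borel_measurable borel"
    and phi_bounded: "bounded (range \<phi>)"
    and phi_even: "\<phi> (- t) = \<phi> t"
    and phi_support: "t \<notin> {-1..1} \<Longrightarrow> \<phi> t = 0"
    and alpha_nonneg: "\<alpha> \<ge> 0"
    and phi_edge: "(\<lambda>t. \<phi> (1 - t) - A * t powr \<alpha>) \<in> o[at_right 0](\<lambda>t. t powr \<alpha>)"
begin

lemma phi_edge_bound: "\<exists>K\<ge>0. \<forall>t. 0 < t \<longrightarrow> t \<le> 1 \<longrightarrow> \<bar>\<phi> (1 - t)\<bar> \<le> K * t powr \<alpha>"
  by (rule abs_le_powr_of_asymp[OF _ alpha_nonneg phi_edge])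
     (use phi_bounded in \<open>auto simp: bounded_iff\<close>)

lemma phi_edge_tendsto: "((\<lambda>t. \<phi> (1 - t) / t powr \<alpha>) \<longlongrightarrow> A) (at_right 0)"
proof -
  have "((\<lambda>t. (\<phi> (1 - t) - A * t powr \<alpha>) / t powr \<alpha> + A) \<longlongrightarrow> 0 + A) (at_right 0)"
    by (intro tendsto_add smalloD_tendsto[OF phi_edge] tendsto_const)
  moreover have "\<forall>\<^sub>F t in at_right 0. (\<phi> (1 - t) - A * t powr \<alpha>) / t powr \<alpha> + A = \<phi> (1 - t) / t powr \<alpha>"
    unfolding eventually_at_right_field by (intro exI[of _ 1]) (auto simp: field_simps)
  ultimately show ?thesis by (simp add: tendsto_cong)
qed

lemma scaled_support: "h > 0 \<Longrightarrow> t \<notin> {- (1 / h)..1 / h} \<Longrightarrow> \<phi> (h * t) = 0"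
  by (rule phi_support) (auto simp: field_simps)

lemma integrable_scaled:
  fixes F :: "real \<Rightarrow> 'b :: {banach, second_countable_topology}"
  assumes h: "h > 0" and F: "continuous_on UNIV F"
  shows "integrable lborel (\<lambda>t. \<phi> (h * t) *\<^sub>R F t)"
proof -
  have [measurable]: "F \<in> borel_measurable borel"
    using F by (rule borel_measurable_continuous_onI)
  obtain B where B: "\<And>t. \<bar>\<phi> t\<bar> \<le> B"
    using phi_bounded by (auto simp: bounded_iff)
  have I: "set_integrable lborel {- (1 / h)..1 / h} F"
    unfolding set_integrable_def by (intro borel_integrable_compact continuous_on_subset[OF F]) auto
  show ?thesis
  proof (rule Bochner_Integration.integrable_bound)
    show "integrable lborel (\<lambda>t. B *\<^sub>R (indicator {- (1 / h)..1 / h} t *\<^sub>R F t))"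
      using I unfolding set_integrable_def by (rule integrable_scaleR_right)
    show "AE t in lborel. norm (\<phi> (h * t) *\<^sub>R F t) \<le> norm (B *\<^sub>R (indicator {- (1 / h)..1 / h} t *\<^sub>R F t))"
    proof (rule AE_I2)
      fix t
      have "\<bar>\<phi> (h * t)\<bar> * norm (F t) \<le> \<bar>B\<bar> * norm (F t)"
        using B[of "h * t"] by (intro mult_right_mono) auto
      then show "norm (\<phi> (h * t) *\<^sub>R F t) \<le> norm (B *\<^sub>R (indicator {- (1 / h)..1 / h} t *\<^sub>R F t))"
        using scaled_support[OF h, of t] by (cases "t \<in> {- (1 / h)..1 / h}") auto
    qed
  qed measurable
qed

text \<open>
  The integrand of the deconvolution kernel in the variable \<open>s\<close> with \<open>t = (1 - s h\<^sup>2 / \<sigma>\<^sup>2) / h\<close>,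
  divided by the order of magnitude of the kernel and a constant. In this variable the Gaussian weight becomes
  \<open>exp (- s)\<close> to leading order, and the edge \<open>t = 1 / h\<close> becomes \<open>s = 0\<close>.
\<close>

definition edge_integrand :: "real \<Rightarrow> real \<Rightarrow> real \<Rightarrow> real \<Rightarrow> real" where
  "edge_integrand \<sigma> h y s =
     indicator {0..<\<sigma>\<^sup>2 / h\<^sup>2} s * ((\<sigma>\<^sup>2 / h\<^sup>2) powr \<alpha> * \<phi> (1 - s * h\<^sup>2 / \<sigma>\<^sup>2))
       * exp (- s + s\<^sup>2 * h\<^sup>2 / (2 * \<sigma>\<^sup>2)) * cos ((1 - s * h\<^sup>2 / \<sigma>\<^sup>2) * y / h)"

lemma edge_integrand_measurable [measurable]: "edge_integrand \<sigma> h y \<in> borel_measurable borel"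
  unfolding edge_integrand_def by measurable

text \<open>
  The integrand is even, so the half line \<open>t > 0\<close> suffices; there the affine substitution
  \<open>t = 1 / h - s h / \<sigma>\<^sup>2\<close> puts the edge of the support at \<open>s = 0\<close>.
\<close>

lemma deconv_kernel_eq:
  assumes h: "h > 0" and \<sigma>: "\<sigma> > 0"
  shows "deconv_kernel \<sigma> \<phi> h y =
    2 * \<sigma> powr (- (2 + 2 * \<alpha>)) * (h powr (1 + 2 * \<alpha>) * exp (\<sigma>\<^sup>2 / (2 * h\<^sup>2))) *
      (\<integral>s. edge_integrand \<sigma> h y s \<partial>lborel)"
proof -
  define F where "F t = cos (t * y) * exp (\<sigma>\<^sup>2 * t\<^sup>2 / 2) * \<phi> (h * t)" for t
  have [measurable]: "F \<in> borel_measurable borel" unfolding F_def by measurable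
  have "integrable lborel (\<lambda>t. \<phi> (h * t) *\<^sub>R (cos (t * y) * exp (\<sigma>\<^sup>2 * t\<^sup>2 / 2)))"
    by (intro integrable_scaled h) (auto intro!: continuous_intros)
  then have intF: "integrable lborel F" by (simp add: F_def[abs_def] mult_ac)
  have even: "F (- t) = F t" for t
    using phi_even[of "h * t"] by (simp add: F_def)
  have I: "integrable lborel (\<lambda>t. indicator S t * F t)" if "S \<in> sets borel" for S
    using integrable_mult_indicator[OF _ intF, of S] that by simp
  have "deconv_kernel \<sigma> \<phi> h y = (\<integral>t. F t \<partial>lborel)"
    by (simp add: deconv_kernel_def F_def)
  also have "\<dots> = (\<integral>t. indicator {0<..} t * F t + indicator {..<0} t * F t \<partial>lborel)"
    by (rule integral_cong_AE; measurable?)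
       (use AE_lborel_singleton[of "0::real"] in \<open>auto elim!: eventually_mono simp: indicator_def\<close>)
  also have "\<dots> = (\<integral>t. indicator {0<..} t * F t \<partial>lborel) + (\<integral>t. indicator {..<0} t * F t \<partial>lborel)"
    by (intro Bochner_Integration.integral_add I) auto
  also have "(\<integral>t. indicator {..<0} t * F t \<partial>lborel) = (\<integral>t. indicator {..<0} (-t) * F (-t) \<partial>lborel)"
    using lborel_integral_real_affine[of "-1" "\<lambda>t. indicator {..<0} t * F t" 0] by simp
  also have "\<dots> = (\<integral>t. indicator {0<..} t * F t \<partial>lborel)"
    by (intro Bochner_Integration.integral_cong) (auto simp: even indicator_def)
  also have "(\<integral>t. indicator {0<..} t * F t \<partial>lborel) =
      h / \<sigma>\<^sup>2 * (\<integral>s. indicator {0<..} (1 / h + - (h / \<sigma>\<^sup>2) * s) * F (1 / h + - (h / \<sigma>\<^sup>2) * s) \<partial>lborel)"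
    using lborel_integral_real_affine[of "- (h / \<sigma>\<^sup>2)" "\<lambda>t. indicator {0<..} t * F t" "1 / h"] h \<sigma> by simp
  also have "\<dots> = (\<integral>s. (h / \<sigma>\<^sup>2) * (indicator {0<..} (1 / h + - (h / \<sigma>\<^sup>2) * s) * F (1 / h + - (h / \<sigma>\<^sup>2) * s)) \<partial>lborel)"
    by simp
  also have "\<dots> = (\<integral>s. \<sigma> powr (- (2 + 2 * \<alpha>)) * (h powr (1 + 2 * \<alpha>) * exp (\<sigma>\<^sup>2 / (2 * h\<^sup>2))) * edge_integrand \<sigma> h y s \<partial>lborel)"
  proof (intro Bochner_Integration.integral_cong refl)
    fix s
    let ?t = "1 / h + - (h / \<sigma>\<^sup>2) * s"
    have t: "?t = (1 - s * h\<^sup>2 / \<sigma>\<^sup>2) / h" using h \<sigma> by (simp add: field_simps power2_eq_square)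
    have ht: "h * ?t = 1 - s * h\<^sup>2 / \<sigma>\<^sup>2" unfolding t using h by simp
    show "(h / \<sigma>\<^sup>2) * (indicator {0<..} ?t * F ?t) =
      \<sigma> powr (- (2 + 2 * \<alpha>)) * (h powr (1 + 2 * \<alpha>) * exp (\<sigma>\<^sup>2 / (2 * h\<^sup>2))) * edge_integrand \<sigma> h y s"
    proof (cases "0 \<le> s \<and> s < \<sigma>\<^sup>2 / h\<^sup>2")
      case False
      have "?t > 0 \<longleftrightarrow> s < \<sigma>\<^sup>2 / h\<^sup>2"
        unfolding t using h \<sigma> by (simp add: field_simps)
      moreover have "\<phi> (1 - s * h\<^sup>2 / \<sigma>\<^sup>2) = 0" if "s < 0"
      proof (rule phi_support)
        have "s * h\<^sup>2 / \<sigma>\<^sup>2 < 0" using that h \<sigma> by (simp add: field_simps mult_neg_pos)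
        then show "1 - s * h\<^sup>2 / \<sigma>\<^sup>2 \<notin> {-1..1}" by auto
      qed
      ultimately have "indicator {0<..} ?t * F ?t = 0"
        using False ht by (auto simp: F_def)
      then show ?thesis using False by (auto simp: edge_integrand_def)
    next
      case True
      have "?t > 0" unfolding t using True h \<sigma> by (simp add: field_simps)
      have sq: "\<sigma>\<^sup>2 * ?t\<^sup>2 / 2 = \<sigma>\<^sup>2 / (2 * h\<^sup>2) + (- s + s\<^sup>2 * h\<^sup>2 / (2 * \<sigma>\<^sup>2))"
        using h \<sigma> by (simp add: field_simps power2_eq_square)
      have pw: "h / \<sigma>\<^sup>2 = \<sigma> powr (- (2 + 2 * \<alpha>)) * h powr (1 + 2 * \<alpha>) * (\<sigma>\<^sup>2 / h\<^sup>2) powr \<alpha>"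
      proof -
        have "(\<sigma>\<^sup>2 / h\<^sup>2) powr \<alpha> = \<sigma> powr (2 * \<alpha>) * h powr (- (2 * \<alpha>))"
          using h \<sigma> by (simp add: powr_divide powr_minus powr_powr field_simps flip: powr_numeral)
        then have "\<sigma> powr (- (2 + 2 * \<alpha>)) * h powr (1 + 2 * \<alpha>) * (\<sigma>\<^sup>2 / h\<^sup>2) powr \<alpha> =
          (\<sigma> powr (- (2 + 2 * \<alpha>)) * \<sigma> powr (2 * \<alpha>)) * (h powr (1 + 2 * \<alpha>) * h powr (- (2 * \<alpha>)))"
          by simp
        also have "\<sigma> powr (- (2 + 2 * \<alpha>)) * \<sigma> powr (2 * \<alpha>) = 1 / \<sigma>\<^sup>2"
          using \<sigma> by (simp add: powr_minus_divide flip: powr_add)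
        also have "h powr (1 + 2 * \<alpha>) * h powr (- (2 * \<alpha>)) = h"
          using h by (simp flip: powr_add)
        also have "1 / \<sigma>\<^sup>2 * h = h / \<sigma>\<^sup>2" by simp
        finally show ?thesis ..
      qed
      have "(h / \<sigma>\<^sup>2) * (indicator {0<..} ?t * F ?t) =
         (h / \<sigma>\<^sup>2) * (cos ((1 - s * h\<^sup>2 / \<sigma>\<^sup>2) * y / h) * (exp (\<sigma>\<^sup>2 / (2 * h\<^sup>2)) * exp (- s + s\<^sup>2 * h\<^sup>2 / (2 * \<sigma>\<^sup>2))) * \<phi> (1 - s * h\<^sup>2 / \<sigma>\<^sup>2))"
        unfolding F_def ht sq exp_add using \<open>?t > 0\<close> t by simp
      also have "\<dots> = \<sigma> powr (- (2 + 2 * \<alpha>)) * (h powr (1 + 2 * \<alpha>) * exp (\<sigma>\<^sup>2 / (2 * h\<^sup>2))) * edge_integrand \<sigma> h y s"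
        unfolding pw edge_integrand_def using True by simp
      finally show ?thesis .
    qed
  qed
  finally show ?thesis by simp
qed

text \<open>
  On the range of integration \<open>s h\<^sup>2 / \<sigma>\<^sup>2 < 1\<close>, so the quadratic term of the exponent eats at most half
  of the linear one; this leaves an integrable bound that does not depend on \<open>h\<close> and \<open>y\<close>. At
  \<open>s = 0\<close> the bound is 0, while the value of \<open>\<phi>\<close> at 1 is arbitrary, so that point is left out.
\<close>

lemma edge_integrand_bound:
  assumes "h > 0" "\<sigma> > 0" and K: "K \<ge> 0" "\<And>t. 0 < t \<Longrightarrow> t \<le> 1 \<Longrightarrow> \<bar>\<phi> (1 - t)\<bar> \<le> K * t powr \<alpha>" and "s \<noteq> 0"
  shows "\<bar>edge_integrand \<sigma> h y s\<bar> \<le> K * (indicator {0..} s * s powr \<alpha> * exp (- s / 2))"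
proof (cases "0 < s \<and> s < \<sigma>\<^sup>2 / h\<^sup>2")
  case False
  then show ?thesis using \<open>s \<noteq> 0\<close> K by (auto simp: edge_integrand_def indicator_def)
next
  case True
  define c where "c = \<sigma>\<^sup>2 / h\<^sup>2"
  have c: "c > 0" "0 < s" "s < c" using assms True by (auto simp: c_def)
  have sc: "s * h\<^sup>2 / \<sigma>\<^sup>2 = s / c" "s\<^sup>2 * h\<^sup>2 / (2 * \<sigma>\<^sup>2) = s * (s / c) / 2" 
    using assms by (auto simp: c_def field_simps power2_eq_square)
  have "\<bar>edge_integrand \<sigma> h y s\<bar> = c powr \<alpha> * \<bar>\<phi> (1 - s / c)\<bar> * exp (- s + s * (s / c) / 2) * \<bar>cos ((1 - s / c) * y / h)\<bar>"
    using c by (simp add: edge_integrand_def sc abs_mult flip: c_def)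
  also have "\<dots> \<le> c powr \<alpha> * (K * (s / c) powr \<alpha>) * exp (- s / 2) * 1"
  proof (intro mult_mono)
    show "\<bar>\<phi> (1 - s / c)\<bar> \<le> K * (s / c) powr \<alpha>" using c by (intro K) auto
    have "s * (s / c) \<le> s * 1" using c by (intro mult_left_mono) auto
    then show "exp (- s + s * (s / c) / 2) \<le> exp (- s / 2)" by simp
  qed (use c K in auto)
  also have "\<dots> = K * (indicator {0..} s * s powr \<alpha> * exp (- s / 2))"
    using c by (simp add: powr_divide)
  finally show ?thesis .
qed

lemma deconv_kernel_bound:
  assumes \<sigma>: "\<sigma> > 0"
  shows "\<exists>K\<ge>0. \<forall>h>0. \<forall>y. \<bar>deconv_kernel \<sigma> \<phi> h y\<bar> \<le> K * (h powr (1 + 2 * \<alpha>) * exp (\<sigma>\<^sup>2 / (2 * h\<^sup>2)))"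
proof -
  obtain K where K: "K \<ge> 0" "\<And>t. 0 < t \<Longrightarrow> t \<le> 1 \<Longrightarrow> \<bar>\<phi> (1 - t)\<bar> \<le> K * t powr \<alpha>"
    using phi_edge_bound by blast
  define I where "I = (\<integral>s. K * (indicator {0..} s * s powr \<alpha> * exp (- s / 2)) \<partial>lborel)"
  have "I \<ge> 0" unfolding I_def using K by (intro Bochner_Integration.integral_nonneg) (auto simp: indicator_def)
  have "\<bar>deconv_kernel \<sigma> \<phi> h y\<bar> \<le> 2 * \<sigma> powr (- (2 + 2 * \<alpha>)) * I * (h powr (1 + 2 * \<alpha>) * exp (\<sigma>\<^sup>2 / (2 * h\<^sup>2)))"
    if h: "h > 0" for h y
  proof -
    have "\<bar>\<integral>s. edge_integrand \<sigma> h y s \<partial>lborel\<bar> \<le> (\<integral>s. \<bar>edge_integrand \<sigma> h y s\<bar> \<partial>lborel)"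
      by (rule integral_abs_bound)
    also have "\<dots> \<le> I" unfolding I_def
      using edge_integrand_bound[OF h \<sigma> K] AE_lborel_singleton[of "0::real"] alpha_nonneg K
      by (intro integral_mono_AE' integrable_mult_right integrable_powr_exp_half)
         (auto elim!: eventually_mono)
    finally have "\<bar>\<integral>s. edge_integrand \<sigma> h y s \<partial>lborel\<bar> \<le> I" .
    then have "2 * \<sigma> powr (- (2 + 2 * \<alpha>)) * (h powr (1 + 2 * \<alpha>) * exp (\<sigma>\<^sup>2 / (2 * h\<^sup>2))) * \<bar>\<integral>s. edge_integrand \<sigma> h y s \<partial>lborel\<bar> \<le>
      2 * \<sigma> powr (- (2 + 2 * \<alpha>)) * (h powr (1 + 2 * \<alpha>) * exp (\<sigma>\<^sup>2 / (2 * h\<^sup>2))) * I"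
      by (intro mult_left_mono) auto
    then show ?thesis
      unfolding deconv_kernel_eq[OF h \<sigma>] by (simp add: abs_mult mult_ac)
  qed
  then show ?thesis using \<open>I \<ge> 0\<close>
    by (intro exI[of _ "2 * \<sigma> powr (- (2 + 2 * \<alpha>)) * I"]) auto
qed

text \<open>
  Laplace's method: in the rescaled variable the integrand converges to
  \<open>A s powr \<alpha> * exp (- s) * cos (y / h)\<close>, since the phase changes only by \<open>s y h / \<sigma>\<^sup>2\<close>. Dominated
  convergence and Euler's integral for the gamma function give the constant.
\<close>

lemma deconv_kernel_asymp:
  fixes h :: "nat \<Rightarrow> real"
  assumes \<sigma>: "\<sigma> > 0" and h: "\<And>n. h n > 0" "h \<longlonglongrightarrow> 0"
  shows "(\<lambda>n. deconv_kernel \<sigma> \<phi> (h n) y / (h n powr (1 + 2 * \<alpha>) * exp (\<sigma>\<^sup>2 / (2 * (h n)\<^sup>2)))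
      - 2 * \<sigma> powr (- (2 + 2 * \<alpha>)) * A * Gamma (\<alpha> + 1) * cos (y / h n)) \<longlonglongrightarrow> 0"
proof -
  obtain K where K: "K \<ge> 0" "\<And>t. 0 < t \<Longrightarrow> t \<le> 1 \<Longrightarrow> \<bar>\<phi> (1 - t)\<bar> \<le> K * t powr \<alpha>"
    using phi_edge_bound by blast
  define lim where "lim n s = A * cos (y / h n) * (indicator {0..} s * s powr \<alpha> * exp (- s))" for n and s :: real
  have lim_int: "has_bochner_integral lborel (lim n) (A * cos (y / h n) * Gamma (\<alpha> + 1))" for n
    unfolding lim_def using alpha_nonneg
    by (intro has_bochner_integral_mult_right has_bochner_integral_Gamma) auto
  have [measurable]: "lim n \<in> borel_measurable borel" for n unfolding lim_def by measurable
  have J: "integrable lborel (edge_integrand \<sigma> (h n) y)" for n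
  proof (rule Bochner_Integration.integrable_bound)
    show "integrable lborel (\<lambda>s. K * (indicator {0..} s * s powr \<alpha> * exp (- s / 2)))"
      using alpha_nonneg by (intro integrable_mult_right integrable_powr_exp_half) auto
    show "AE s in lborel. norm (edge_integrand \<sigma> (h n) y s) \<le> norm (K * (indicator {0..} s * s powr \<alpha> * exp (- s / 2)))"
      using AE_lborel_singleton[of "0::real"] edge_integrand_bound[OF h(1) \<sigma> K]
      by (auto elim!: eventually_mono intro: order.trans[OF _ abs_ge_self])
  qed measurable
  \<comment> \<open>\<open>lim n\<close> still depends on \<open>n\<close>: its phase oscillates, so only the difference converges.\<close>
  have pt: "(\<lambda>n. edge_integrand \<sigma> (h n) y s - lim n s) \<longlonglongrightarrow> 0" if "s \<noteq> 0" for s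
  proof (cases "s > 0")
    case False
    then show ?thesis using that by (simp add: edge_integrand_def lim_def)
  next
    case True
    define r where "r n = s * (h n)\<^sup>2 / \<sigma>\<^sup>2" for n
    have r0: "r \<longlonglongrightarrow> 0" unfolding r_def using \<sigma> h(2) by (auto intro!: tendsto_eq_intros)
    have rpos: "r n > 0" for n using True h(1)[of n] \<sigma> by (simp add: r_def)
    have rr: "filterlim r (at_right 0) sequentially"
      using r0 rpos less_imp_neq[OF rpos] by (auto simp: filterlim_at intro!: always_eventually)
    have e1: "(\<lambda>n. \<phi> (1 - r n) / r n powr \<alpha>) \<longlonglongrightarrow> A"
      by (rule filterlim_compose[OF phi_edge_tendsto rr])
    have e2: "(\<lambda>n. exp (- s + s * r n / 2)) \<longlonglongrightarrow> exp (- s)"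
      using r0 by (auto intro!: tendsto_eq_intros)
    define P where "P n = s powr \<alpha> * (\<phi> (1 - r n) / r n powr \<alpha>) * exp (- s + s * r n / 2)" for n
    have P: "P \<longlonglongrightarrow> s powr \<alpha> * A * exp (- s)"
      unfolding P_def by (intro tendsto_intros e1 e2)
    have ev: "\<forall>\<^sub>F n in sequentially. r n < 1" using r0 by (rule order_tendstoD) auto
    have eq: "edge_integrand \<sigma> (h n) y s = P n * cos ((1 - r n) * y / h n)" if "r n < 1" for n
    proof -
      have "s < \<sigma>\<^sup>2 / (h n)\<^sup>2" using that h(1)[of n] \<sigma> by (simp add: r_def field_simps)
      moreover have "(\<sigma>\<^sup>2 / (h n)\<^sup>2) powr \<alpha> = s powr \<alpha> / r n powr \<alpha>"
      proof -
        have "\<sigma>\<^sup>2 / (h n)\<^sup>2 = s / r n" using True h(1)[of n] \<sigma> by (simp add: r_def field_simps)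
        then show ?thesis using True rpos[of n] by (simp add: powr_divide)
      qed
      moreover have "s\<^sup>2 * (h n)\<^sup>2 / (2 * \<sigma>\<^sup>2) = s * r n / 2"
        by (simp add: r_def power2_eq_square)
      ultimately show ?thesis using True
        by (simp add: edge_integrand_def P_def flip: r_def)
    qed
    have cosd: "(\<lambda>n. cos ((1 - r n) * y / h n) - cos (y / h n)) \<longlonglongrightarrow> 0"
    proof (rule Lim_null_comparison)
      have "\<bar>cos u - cos v\<bar> \<le> \<bar>u - v\<bar>" for u v :: real
      proof -
        have "\<bar>cos u - cos v\<bar> = 2 * \<bar>sin ((u + v) / 2)\<bar> * \<bar>sin ((v - u) / 2)\<bar>"
          by (simp add: cos_diff_cos abs_mult)
        also have "\<dots> \<le> 2 * 1 * \<bar>(v - u) / 2\<bar>"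
          by (intro mult_mono abs_sin_x_le_abs_x) auto
        finally show ?thesis by simp
      qed
      then have "\<bar>cos ((1 - r n) * y / h n) - cos (y / h n)\<bar> \<le> \<bar>(1 - r n) * y / h n - y / h n\<bar>" for n .
      also have "\<bar>(1 - r n) * y / h n - y / h n\<bar> = \<bar>s * y / \<sigma>\<^sup>2\<bar> * h n" for n
      proof -
        have "(1 - r n) * y / h n - y / h n = - (s * y / \<sigma>\<^sup>2 * h n)"
          using h(1)[of n] \<sigma> by (simp add: r_def field_simps power2_eq_square)
        then show ?thesis using h(1)[of n] by (simp add: abs_mult)
      qed
      finally show "\<forall>\<^sub>F n in sequentially. norm (cos ((1 - r n) * y / h n) - cos (y / h n)) \<le> \<bar>s * y / \<sigma>\<^sup>2\<bar> * h n"
        by (intro always_eventually) auto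
      show "(\<lambda>n. \<bar>s * y / \<sigma>\<^sup>2\<bar> * h n) \<longlonglongrightarrow> 0"
        using h(2) \<sigma> by (auto intro!: tendsto_eq_intros)
    qed
    have "(\<lambda>n. P n * (cos ((1 - r n) * y / h n) - cos (y / h n)) + (P n - s powr \<alpha> * A * exp (- s)) * cos (y / h n)) \<longlonglongrightarrow> 0"
    proof (intro tendsto_add_zero)
      show "(\<lambda>n. P n * (cos ((1 - r n) * y / h n) - cos (y / h n))) \<longlonglongrightarrow> 0"
        using tendsto_mult[OF P cosd] by simp
      have *: "(\<lambda>n. P n - s powr \<alpha> * A * exp (- s)) \<longlonglongrightarrow> 0"
        using P by (simp add: LIM_zero_iff)
      show "(\<lambda>n. (P n - s powr \<alpha> * A * exp (- s)) * cos (y / h n)) \<longlonglongrightarrow> 0"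
      proof (rule Lim_null_comparison)
        show "\<forall>\<^sub>F n in sequentially. norm ((P n - s powr \<alpha> * A * exp (- s)) * cos (y / h n)) \<le> \<bar>P n - s powr \<alpha> * A * exp (- s)\<bar>"
          by (intro always_eventually allI) (auto simp: abs_mult intro!: mult_left_le)
        show "(\<lambda>n. \<bar>P n - s powr \<alpha> * A * exp (- s)\<bar>) \<longlonglongrightarrow> 0"
          using * by (rule tendsto_rabs_zero)
      qed
    qed
    moreover have "\<forall>\<^sub>F n in sequentially. P n * (cos ((1 - r n) * y / h n) - cos (y / h n)) + (P n - s powr \<alpha> * A * exp (- s)) * cos (y / h n) = edge_integrand \<sigma> (h n) y s - lim n s"
      using ev by eventually_elim (use True in \<open>simp add: eq lim_def algebra_simps\<close>)
    ultimately show ?thesis by (rule Lim_transform_eventually)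
  qed
  have "(\<lambda>n. \<integral>s. edge_integrand \<sigma> (h n) y s - lim n s \<partial>lborel) \<longlonglongrightarrow> (\<integral>s. 0 \<partial>(lborel :: real measure))"
  proof (rule integral_dominated_convergence)
    show "integrable lborel (\<lambda>s::real. (K + \<bar>A\<bar>) * (indicator {0..} s * s powr \<alpha> * exp (- s / 2)))"
      using alpha_nonneg by (intro integrable_mult_right integrable_powr_exp_half) auto
    show "AE s in lborel. (\<lambda>n. edge_integrand \<sigma> (h n) y s - lim n s) \<longlonglongrightarrow> 0"
      using AE_lborel_singleton[of "0::real"] pt by (auto elim!: eventually_mono)
    show "AE s in lborel. norm (edge_integrand \<sigma> (h n) y s - lim n s) \<le> (K + \<bar>A\<bar>) * (indicator {0..} s * s powr \<alpha> * exp (- s / 2))" for n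
      using AE_lborel_singleton[of "0::real"]
    proof eventually_elim
      case (elim s)
      have "\<bar>lim n s\<bar> \<le> \<bar>A\<bar> * (indicator {0..} s * s powr \<alpha> * exp (- s / 2))"
      proof -
        have "\<bar>lim n s\<bar> = \<bar>A\<bar> * (\<bar>cos (y / h n)\<bar> * (indicator {0..} s * s powr \<alpha> * exp (- s)))"
          by (simp add: lim_def abs_mult)
        also have "\<dots> \<le> \<bar>A\<bar> * (1 * (indicator {0..} s * s powr \<alpha> * exp (- s / 2)))"
        proof (cases "0 \<le> s")
          case True
          have "\<bar>cos (y / h n)\<bar> * (s powr \<alpha> * exp (- s)) \<le> 1 * (s powr \<alpha> * exp (- s / 2))"
            by (intro mult_mono mult_left_mono) (use True in auto)
          then show ?thesis using True by (intro mult_left_mono) auto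
        qed simp
        finally show ?thesis by simp
      qed
      then show ?case using edge_integrand_bound[OF h(1) \<sigma> K elim, of n y]
        by (simp add: algebra_simps)
    qed
  qed measurable
  also have "(\<lambda>n. \<integral>s. edge_integrand \<sigma> (h n) y s - lim n s \<partial>lborel) =
      (\<lambda>n. (\<integral>s. edge_integrand \<sigma> (h n) y s \<partial>lborel) - A * cos (y / h n) * Gamma (\<alpha> + 1))"
    using lim_int J by (auto simp: has_bochner_integral_iff)
  finally have "(\<lambda>n. 2 * \<sigma> powr (- (2 + 2 * \<alpha>)) * ((\<integral>s. edge_integrand \<sigma> (h n) y s \<partial>lborel) - A * cos (y / h n) * Gamma (\<alpha> + 1))) \<longlonglongrightarrow> 0"
    by (intro tendsto_mult_right_zero) simp
  moreover have "2 * \<sigma> powr (- (2 + 2 * \<alpha>)) * ((\<integral>s. edge_integrand \<sigma> (h n) y s \<partial>lborel) - A * cos (y / h n) * Gamma (\<alpha> + 1)) =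
     deconv_kernel \<sigma> \<phi> (h n) y / (h n powr (1 + 2 * \<alpha>) * exp (\<sigma>\<^sup>2 / (2 * (h n)\<^sup>2)))
      - 2 * \<sigma> powr (- (2 + 2 * \<alpha>)) * A * Gamma (\<alpha> + 1) * cos (y / h n)" for n
    unfolding deconv_kernel_eq[OF h(1) \<sigma>] using h(1)[of n] by (simp add: algebra_simps)
  ultimately show ?thesis by simp
qed

end

section \<open>Averages of independent bounded variables\<close>

context prob_space begin

lemma indep_vars_imp_indep_var:
  assumes I: "indep_vars (\<lambda>_. N) Y I" and ij: "i \<in> I" "j \<in> I" "i \<noteq> j"
  shows "indep_var N (Y i) N (Y j)"
proof -
  have "indep_var N ((\<lambda>f. f i) \<circ> (\<lambda>\<omega>. restrict (\<lambda>i. Y i \<omega>) {i})) N ((\<lambda>f. f j) \<circ> (\<lambda>\<omega>. restrict (\<lambda>i. Y i \<omega>) {j}))"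
    using ij by (intro indep_var_compose[OF indep_var_restrict[OF I]] measurable_component_singleton) auto
  then show ?thesis by (simp add: comp_def)
qed

text \<open>
  The cross terms vanish by independence, so only \<open>n\<close> of the \<open>n\<^sup>2\<close> products contribute.
\<close>

lemma second_moment_indep_mean_le:
  fixes Y :: "nat \<Rightarrow> 'a \<Rightarrow> real"
  assumes I: "indep_vars (\<lambda>_. borel) Y {1..}"
    and mean: "\<And>j. j \<ge> 1 \<Longrightarrow> expectation (Y j) = 0"
    and bound: "\<And>j \<omega>. j \<ge> 1 \<Longrightarrow> \<omega> \<in> space M \<Longrightarrow> \<bar>Y j \<omega>\<bar> \<le> K"
  shows "expectation (\<lambda>\<omega>. ((\<Sum>j=1..n. Y j \<omega>) / real n)\<^sup>2) \<le> K\<^sup>2 / real n"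
proof -
  have rv [measurable]: "random_variable borel (Y j)" if "j \<ge> 1" for j
    using I that by (auto simp: indep_vars_def)
  have int: "integrable M (Y j)" if "j \<ge> 1" for j
    using that bound by (intro integrable_const_bound[of _ K] AE_I2) auto
  have int2: "integrable M (\<lambda>\<omega>. Y i \<omega> * Y j \<omega>)" if "i \<ge> 1" "j \<ge> 1" for i j
    using that bound by (intro integrable_const_bound[of _ "K * K"] AE_I2)
      (auto simp: abs_mult intro!: mult_mono order.trans[OF abs_ge_zero bound])
  have cov: "expectation (\<lambda>\<omega>. Y i \<omega> * Y j \<omega>) = 0" if "i \<ge> 1" "j \<ge> 1" "i \<noteq> j" for i j
    using indep_var_lebesgue_integral[OF indep_vars_imp_indep_var[OF I]] that int mean by simp
  have var: "expectation (\<lambda>\<omega>. Y i \<omega> * Y i \<omega>) \<le> K\<^sup>2" if "i \<ge> 1" for i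
  proof -
    have "expectation (\<lambda>\<omega>. Y i \<omega> * Y i \<omega>) \<le> expectation (\<lambda>\<omega>. K\<^sup>2)"
    proof (rule integral_mono)
      show "Y i \<omega> * Y i \<omega> \<le> K\<^sup>2" if "\<omega> \<in> space M" for \<omega>
        using abs_le_square_iff[of "Y i \<omega>" K] bound[OF \<open>i \<ge> 1\<close> that] by (simp add: power2_eq_square)
    qed (use that int2 in auto)
    then show ?thesis by (simp add: prob_space)
  qed
  have "expectation (\<lambda>\<omega>. ((\<Sum>j=1..n. Y j \<omega>) / real n)\<^sup>2) =
      expectation (\<lambda>\<omega>. (\<Sum>i=1..n. \<Sum>j=1..n. Y i \<omega> * Y j \<omega>)) / (real n)\<^sup>2"
    by (simp add: power_divide) (simp add: power2_eq_square sum_product)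
  also have "expectation (\<lambda>\<omega>. (\<Sum>i=1..n. \<Sum>j=1..n. Y i \<omega> * Y j \<omega>)) =
      (\<Sum>i=1..n. expectation (\<lambda>\<omega>. \<Sum>j=1..n. Y i \<omega> * Y j \<omega>))"
    by (intro Bochner_Integration.integral_sum Bochner_Integration.integrable_sum int2) auto
  also have "\<dots> = (\<Sum>i=1..n. \<Sum>j=1..n. expectation (\<lambda>\<omega>. Y i \<omega> * Y j \<omega>))"
    by (intro sum.cong Bochner_Integration.integral_sum int2 refl) auto
  also have "(\<Sum>i=1..n. \<Sum>j=1..n. expectation (\<lambda>\<omega>. Y i \<omega> * Y j \<omega>)) =
      (\<Sum>i=1..n. \<Sum>j=1..n. if j = i then expectation (\<lambda>\<omega>. Y i \<omega> * Y i \<omega>) else 0)"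
    by (intro sum.cong refl) (auto simp: cov)
  also have "\<dots> = (\<Sum>i=1..n. expectation (\<lambda>\<omega>. Y i \<omega> * Y i \<omega>))"
    by simp
  also have "\<dots> / (real n)\<^sup>2 \<le> (real n * K\<^sup>2) / (real n)\<^sup>2"
    using var sum_mono[of "{1..n}" "\<lambda>i. expectation (\<lambda>\<omega>. Y i \<omega> * Y i \<omega>)" "\<lambda>_. K\<^sup>2"]
    by (intro divide_right_mono) auto
  also have "\<dots> = K\<^sup>2 / real n" by (simp add: power2_eq_square)
  finally show ?thesis .
qed

lemma char_bounded_approx:
  assumes [measurable]: "random_variable borel W" and W: "\<And>\<omega>. \<omega> \<in> space M \<Longrightarrow> \<bar>W \<omega>\<bar> \<le> K"
    and mean: "expectation W = 0"
  shows "cmod (char (distr M borel W) s - (1 - s\<^sup>2 * expectation (\<lambda>\<omega>. (W \<omega>)\<^sup>2) / 2)) \<le> \<bar>s\<bar> ^ 3 * K ^ 3 / 6"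
proof -
  have int: "integrable M W" using W by (intro integrable_const_bound[of _ K] AE_I2) auto
  have int2: "integrable M (\<lambda>\<omega>. (W \<omega>)\<^sup>2)"
  proof (rule integrable_const_bound[of _ "K\<^sup>2"])
    show "AE \<omega> in M. norm ((W \<omega>)\<^sup>2) \<le> K\<^sup>2"
    proof (rule AE_I2)
      fix \<omega> assume "\<omega> \<in> space M"
      then have "\<bar>W \<omega>\<bar> ^ 2 \<le> K ^ 2" using W by (intro power_mono) auto
      then show "norm ((W \<omega>)\<^sup>2) \<le> K\<^sup>2" by simp
    qed
  qed measurable
  have "cmod (char (distr M borel W) s - (1 - s\<^sup>2 * expectation (\<lambda>\<omega>. (W \<omega>)\<^sup>2) / 2)) \<le>
     s\<^sup>2 / 6 * expectation (\<lambda>\<omega>. min (6 * (W \<omega>)\<^sup>2) (\<bar>s\<bar> * \<bar>W \<omega>\<bar> ^ 3))"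
    by (rule char_approx3') (auto simp: int int2 mean)
  also have "\<dots> \<le> s\<^sup>2 / 6 * (\<bar>s\<bar> * K ^ 3)"
  proof (intro mult_left_mono)
    have le: "min (6 * (W \<omega>)\<^sup>2) (\<bar>s\<bar> * \<bar>W \<omega>\<bar> ^ 3) \<le> \<bar>s\<bar> * K ^ 3" if "\<omega> \<in> space M" for \<omega>
      using W[OF that] by (intro min.coboundedI2 mult_left_mono power_mono) auto
    have "expectation (\<lambda>\<omega>. min (6 * (W \<omega>)\<^sup>2) (\<bar>s\<bar> * \<bar>W \<omega>\<bar> ^ 3)) \<le> expectation (\<lambda>\<omega>. \<bar>s\<bar> * K ^ 3)"
    proof (rule integral_mono)
      show "integrable M (\<lambda>\<omega>. min (6 * (W \<omega>)\<^sup>2) (\<bar>s\<bar> * \<bar>W \<omega>\<bar> ^ 3))"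
        by (rule integrable_const_bound[of _ "\<bar>s\<bar> * K ^ 3"]) (use le in auto)
    qed (use le in auto)
    then show "expectation (\<lambda>\<omega>. min (6 * (W \<omega>)\<^sup>2) (\<bar>s\<bar> * \<bar>W \<omega>\<bar> ^ 3)) \<le> \<bar>s\<bar> * K ^ 3"
      by (simp add: prob_space)
  qed simp
  also have "s\<^sup>2 / 6 * (\<bar>s\<bar> * K ^ 3) = \<bar>s\<bar> ^ 3 * K ^ 3 / 6"
    by (simp add: power3_eq_cube power2_eq_square)
  finally show ?thesis .
qed

text \<open>
  A central limit theorem for the rows of a triangular array: the function \<open>\<kappa> n\<close> that is
  averaged changes with \<open>n\<close>. A uniform bound makes the third-order error of each factor of the
  characteristic function \<open>O(n powr (- 3 / 2))\<close>, so that the \<open>n\<close> errors add up to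
  \<open>O(n powr (- 1 / 2))\<close>. The limit variance 0 is included.
\<close>

lemma char_bounded_array_tendsto:
  fixes X :: "nat \<Rightarrow> 'a \<Rightarrow> real" and \<kappa> :: "nat \<Rightarrow> real \<Rightarrow> real"
  assumes I: "indep_vars (\<lambda>_. borel) X {1..}"
    and dist: "\<And>j. j \<ge> 1 \<Longrightarrow> distr M borel (X j) = \<mu>"
    and meas [measurable]: "\<And>n. \<kappa> n \<in> borel_measurable borel"
    and bound: "\<forall>\<^sub>F n in sequentially. \<forall>y. \<bar>\<kappa> n y\<bar> \<le> K"
    and var: "(\<lambda>n. (\<integral>y. (\<kappa> n y - (\<integral>z. \<kappa> n z \<partial>\<mu>))\<^sup>2 \<partial>\<mu>)) \<longlonglongrightarrow> v"
  shows "(\<lambda>n. char (distr M borel (\<lambda>\<omega>. (\<Sum>j=1..n. \<kappa> n (X j \<omega>) - (\<integral>z. \<kappa> n z \<partial>\<mu>)) / sqrt (real n))) t)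
      \<longlonglongrightarrow> exp (- (v * t\<^sup>2 / 2))"
proof -
  have rv [measurable]: "random_variable borel (X j)" if "j \<ge> 1" for j
    using I that by (auto simp: indep_vars_def)
  have tr: "(\<integral>y. G y \<partial>\<mu>) = expectation (\<lambda>\<omega>. G (X j \<omega>))"
    if "G \<in> borel_measurable borel" "j \<ge> 1" for G :: "real \<Rightarrow> real" and j
    using that by (simp add: integral_distr flip: dist[of j])
  define m where "m n = (\<integral>z. \<kappa> n z \<partial>\<mu>)" for n
  define V where "V n = (\<integral>y. (\<kappa> n y - m n)\<^sup>2 \<partial>\<mu>)" for n
  define \<Phi> where "\<Phi> n = char (distr M borel (\<lambda>\<omega>. (\<Sum>j=1..n. \<kappa> n (X j \<omega>) - m n) / sqrt (real n))) t" for n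
  have V: "V \<longlonglongrightarrow> v" using var by (simp add: V_def[abs_def] m_def)
  have vpos: "v \<ge> 0" by (rule LIMSEQ_le_const[OF V]) (auto simp: V_def)
  \<comment> \<open>For such \<open>n\<close> the quadratic approximations lie in the unit disc, as \<open>norm_prod_diff\<close> requires.\<close>
  have big: "\<forall>\<^sub>F n in sequentially. v * t\<^sup>2 / 4 < real n"
    using filterlim_real_sequentially unfolding filterlim_at_top_dense by blast
  have main: "\<forall>\<^sub>F n in sequentially. norm (\<Phi> n - complex_of_real ((1 + (- (v * t\<^sup>2 / 2)) / real n) ^ n)) \<le>
     (\<bar>t\<bar> ^ 3 * (2 * K) ^ 3 / 6) * (1 / sqrt (real n)) + t\<^sup>2 / 2 * \<bar>V n - v\<bar>"
    using bound big eventually_gt_at_top[of 0]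
  proof eventually_elim
    case (elim n)
    define W where "W j \<omega> = \<kappa> n (X j \<omega>) - m n" for j \<omega>
    have [measurable]: "random_variable borel (W j)" if "j \<ge> 1" for j
      unfolding W_def using that by measurable
    have K: "\<bar>\<kappa> n y\<bar> \<le> K" for y using elim by blast
    have int: "integrable M (\<lambda>\<omega>. \<kappa> n (X j \<omega>))" if "j \<ge> 1" for j
      using K that by (intro integrable_const_bound[of _ K] AE_I2) auto
    have mK: "\<bar>m n\<bar> \<le> K"
    proof -
      have "\<bar>m n\<bar> \<le> expectation (\<lambda>\<omega>. \<bar>\<kappa> n (X 1 \<omega>)\<bar>)" 
        unfolding m_def by (subst tr[of _ 1]) auto
      also have "\<dots> \<le> expectation (\<lambda>\<omega>. K)"
        using int[of 1] K by (intro integral_mono) auto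
      finally show ?thesis by (simp add: prob_space)
    qed
    have WK: "\<bar>W j \<omega>\<bar> \<le> 2 * K" for j \<omega>
      using K[of "X j \<omega>"] mK unfolding W_def by linarith
    have mean: "expectation (W j) = 0" if "j \<ge> 1" for j
      unfolding W_def using int[OF that] that by (simp add: prob_space m_def tr[of "\<kappa> n" j])
    have var: "expectation (\<lambda>\<omega>. (W j \<omega>)\<^sup>2) = V n" if "j \<ge> 1" for j
      unfolding W_def V_def using that by (simp add: tr[of _ j])
    define z where "z j = char (distr M borel (\<lambda>\<omega>. W j \<omega> / sqrt (real n))) t" for j
    have "\<Phi> n = char (distr M borel (\<lambda>\<omega>. \<Sum>j=1..n. W j \<omega> / sqrt (real n))) t"
      by (simp add: \<Phi>_def W_def sum_divide_distrib)
    also have "\<dots> = (\<Prod>j=1..n. z j)"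
      unfolding z_def
    proof (rule char_distr_sum)
      have "indep_vars (\<lambda>_. borel) (\<lambda>j x. (\<lambda>y. (\<kappa> n y - m n) / sqrt (real n)) (X j x)) {1..n}"
        by (rule indep_vars_compose2[OF indep_vars_subset[OF I]]) auto
      then show "indep_vars (\<lambda>_. borel) (\<lambda>j \<omega>. W j \<omega> / sqrt (real n)) {1..n}"
        by (simp add: W_def)
    qed
    finally have \<Phi>: "\<Phi> n = (\<Prod>j=1..n. z j)" .
    define s where "s = t / sqrt (real n)"
    have s2: "s\<^sup>2 = t\<^sup>2 / real n" using elim by (simp add: s_def power_divide)
    have s3: "real n * \<bar>s\<bar> ^ 3 = \<bar>t\<bar> ^ 3 / sqrt (real n)"
      using elim by (simp add: s_def power_divide abs_mult power3_eq_cube field_simps)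
    define u where "u = 1 + (- (v * t\<^sup>2 / 2)) / real n"
    define a where "a = 1 - s\<^sup>2 * V n / 2"
    have "a - u = (t\<^sup>2 / (2 * real n)) * (v - V n)"
      using elim unfolding a_def u_def s2 by (simp add: field_simps)
    then have "\<bar>a - u\<bar> = \<bar>t\<^sup>2 / (2 * real n)\<bar> * \<bar>v - V n\<bar>"
      by (simp only: abs_mult)
    then have au: "\<bar>a - u\<bar> = t\<^sup>2 / (2 * real n) * \<bar>V n - v\<bar>"
      by (simp add: abs_minus_commute)
    have zj: "norm (z j - complex_of_real u) \<le> \<bar>s\<bar> ^ 3 * (2 * K) ^ 3 / 6 + t\<^sup>2 / (2 * real n) * \<bar>V n - v\<bar>" if "j \<in> {1..n}" for j
    proof -
      have "z j = char (distr M borel (W j)) s"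
        unfolding z_def char_def s_def using that by (simp add: integral_distr)
      then have "norm (z j - complex_of_real a) \<le> \<bar>s\<bar> ^ 3 * (2 * K) ^ 3 / 6"
        using char_bounded_approx[of "W j" "2 * K" s] WK mean[of j] var[of j] that by (simp add: a_def)
      moreover have "norm (complex_of_real a - complex_of_real u) = t\<^sup>2 / (2 * real n) * \<bar>V n - v\<bar>"
        unfolding of_real_diff[symmetric] norm_of_real au ..
      ultimately show ?thesis
        using norm_triangle_ineq[of "z j - complex_of_real a" "complex_of_real a - complex_of_real u"]
        by (simp only: diff_add_cancel add_diff_eq)
    qed
    have "norm (\<Phi> n - complex_of_real (u ^ n)) = norm ((\<Prod>j=1..n. z j) - (\<Prod>j=1..n. complex_of_real u))"
      by (simp add: \<Phi>)
    also have "\<dots> \<le> (\<Sum>j=1..n. norm (z j - complex_of_real u))"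
    proof (rule norm_prod_diff)
      fix j assume j: "j \<in> {1..n}"
      interpret D: real_distribution "distr M borel (\<lambda>\<omega>. W j \<omega> / sqrt (real n))"
        using j by (intro real_distribution_distr) auto
      show "norm (z j) \<le> 1" unfolding z_def by (rule D.cmod_char_le_1)
      have "0 \<le> (v * t\<^sup>2 / 2) / real n" "(v * t\<^sup>2 / 2) / real n \<le> 2"
        using elim vpos by (auto simp: field_simps)
      then show "norm (complex_of_real u) \<le> 1" unfolding u_def norm_of_real by linarith
    qed
    also have "\<dots> \<le> (\<Sum>j=1..n. \<bar>s\<bar> ^ 3 * (2 * K) ^ 3 / 6 + t\<^sup>2 / (2 * real n) * \<bar>V n - v\<bar>)"
      by (intro sum_mono zj)
    also have "\<dots> = (real n * \<bar>s\<bar> ^ 3) * (2 * K) ^ 3 / 6 + t\<^sup>2 / 2 * \<bar>V n - v\<bar>"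
      using elim by (simp add: field_simps)
    also have "\<dots> = (\<bar>t\<bar> ^ 3 * (2 * K) ^ 3 / 6) * (1 / sqrt (real n)) + t\<^sup>2 / 2 * \<bar>V n - v\<bar>"
      unfolding s3 by simp
    finally show ?case unfolding u_def .
  qed
  have "(\<lambda>n. (\<bar>t\<bar> ^ 3 * (2 * K) ^ 3 / 6) * (1 / sqrt (real n)) + t\<^sup>2 / 2 * \<bar>V n - v\<bar>) \<longlonglongrightarrow> 0"
  proof (intro tendsto_add_zero tendsto_mult_right_zero tendsto_rabs_zero)
    show "(\<lambda>n. 1 / sqrt (real n)) \<longlonglongrightarrow> 0"
      by (intro tendsto_divide_0[OF tendsto_const] filterlim_at_top_imp_at_infinity
            filterlim_compose[OF sqrt_at_top] filterlim_real_sequentially)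
    show "(\<lambda>n. V n - v) \<longlonglongrightarrow> 0" using V by (simp add: LIM_zero_iff)
  qed
  with main have diff: "(\<lambda>n. \<Phi> n - complex_of_real ((1 + (- (v * t\<^sup>2 / 2)) / real n) ^ n)) \<longlonglongrightarrow> 0"
    by (rule Lim_null_comparison)
  have "(\<lambda>n. complex_of_real ((1 + (- (v * t\<^sup>2 / 2)) / real n) ^ n)) \<longlonglongrightarrow> complex_of_real (exp (- (v * t\<^sup>2 / 2)))"
    by (intro tendsto_of_real tendsto_exp_limit_sequentially)
  from tendsto_add[OF diff this] show ?thesis by (simp add: \<Phi>_def m_def)
qed

text \<open>
  A form of Slutsky's theorem: \<open>u \<mapsto> iexp (t u)\<close> is Lipschitz with constant \<open>\<bar>t\<bar>\<close>, so an \<open>L\<^sup>1\<close>-small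
  change of the variables is a small change of their characteristic functions.
\<close>

lemma char_tendsto_L1_perturbation:
  fixes S T :: "nat \<Rightarrow> 'a \<Rightarrow> real"
  assumes [measurable]: "\<And>n. random_variable borel (S n)" "\<And>n. random_variable borel (T n)"
    and int: "\<forall>\<^sub>F n in sequentially. integrable M (\<lambda>\<omega>. T n \<omega> - S n \<omega>)"
    and L1: "(\<lambda>n. expectation (\<lambda>\<omega>. \<bar>T n \<omega> - S n \<omega>\<bar>)) \<longlonglongrightarrow> 0"
    and S: "(\<lambda>n. char (distr M borel (S n)) t) \<longlonglongrightarrow> c"
  shows "(\<lambda>n. char (distr M borel (T n)) t) \<longlonglongrightarrow> c"
proof -
  have "(\<lambda>n. char (distr M borel (T n)) t - char (distr M borel (S n)) t) \<longlonglongrightarrow> 0"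
  proof (rule Lim_null_comparison)
    show "(\<lambda>n. \<bar>t\<bar> * expectation (\<lambda>\<omega>. \<bar>T n \<omega> - S n \<omega>\<bar>)) \<longlonglongrightarrow> 0"
      using L1 by (rule tendsto_mult_right_zero)
    show "\<forall>\<^sub>F n in sequentially. norm (char (distr M borel (T n)) t - char (distr M borel (S n)) t) \<le> \<bar>t\<bar> * expectation (\<lambda>\<omega>. \<bar>T n \<omega> - S n \<omega>\<bar>)"
      using int
    proof eventually_elim
      case (elim n)
      have I: "integrable M (\<lambda>\<omega>. iexp (t * T n \<omega>))" "integrable M (\<lambda>\<omega>. iexp (t * S n \<omega>))"
        by (auto intro!: integrable_iexp)
      have "char (distr M borel (T n)) t - char (distr M borel (S n)) t = expectation (\<lambda>\<omega>. iexp (t * T n \<omega>) - iexp (t * S n \<omega>))"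
        unfolding char_def using I by (simp add: integral_distr)
      then have "norm (char (distr M borel (T n)) t - char (distr M borel (S n)) t) \<le> expectation (\<lambda>\<omega>. norm (iexp (t * T n \<omega>) - iexp (t * S n \<omega>)))"
        by (simp only: integral_norm_bound)
      also have "\<dots> \<le> expectation (\<lambda>\<omega>. \<bar>t\<bar> * \<bar>T n \<omega> - S n \<omega>\<bar>)"
      proof (rule integral_mono)
        show "integrable M (\<lambda>\<omega>. norm (iexp (t * T n \<omega>) - iexp (t * S n \<omega>)))"
          by (intro integrable_norm Bochner_Integration.integrable_diff I)
        show "integrable M (\<lambda>\<omega>. \<bar>t\<bar> * \<bar>T n \<omega> - S n \<omega>\<bar>)" using elim by auto
        fix \<omega>
        have "iexp (t * T n \<omega>) - iexp (t * S n \<omega>) = iexp (t * S n \<omega>) * (iexp (t * (T n \<omega> - S n \<omega>)) - 1)"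
          by (simp add: right_diff_distrib exp_diff)
        then have "norm (iexp (t * T n \<omega>) - iexp (t * S n \<omega>)) = norm (iexp (t * (T n \<omega> - S n \<omega>)) - 1)"
          by (simp add: norm_mult)
        also have "\<dots> \<le> \<bar>t * (T n \<omega> - S n \<omega>)\<bar>"
          using iexp_approx1[of "t * (T n \<omega> - S n \<omega>)" 0] by simp
        finally show "norm (iexp (t * T n \<omega>) - iexp (t * S n \<omega>)) \<le> \<bar>t\<bar> * \<bar>T n \<omega> - S n \<omega>\<bar>"
          by (simp add: abs_mult)
      qed
      also have "\<dots> = \<bar>t\<bar> * expectation (\<lambda>\<omega>. \<bar>T n \<omega> - S n \<omega>\<bar>)" by simp
      finally show ?case .
    qed
  qed
  from tendsto_add[OF this S] show ?thesis by simp
qed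

text \<open>
  The Cauchy--Schwarz inequality, in the form where bounds \<open>a\<close> and \<open>b\<close> for the \<open>L\<^sup>2\<close> norms are given.
  Positive bounds allow a proof from \<open>2 a b \<bar>X Y\<bar> \<le> (b X)\<^sup>2 + (a Y)\<^sup>2\<close>.
\<close>

lemma expectation_abs_mult_le:
  assumes [measurable]: "random_variable borel X" "random_variable borel Y"
    and X: "integrable M (\<lambda>\<omega>. (X \<omega>)\<^sup>2)" and Y: "integrable M (\<lambda>\<omega>. (Y \<omega> :: real)\<^sup>2)"
    and a: "expectation (\<lambda>\<omega>. (X \<omega>)\<^sup>2) \<le> a\<^sup>2" and b: "expectation (\<lambda>\<omega>. (Y \<omega>)\<^sup>2) \<le> b\<^sup>2"
    and pos: "0 < a" "0 < b"
  shows "integrable M (\<lambda>\<omega>. X \<omega> * Y \<omega>)" "expectation (\<lambda>\<omega>. \<bar>X \<omega> * Y \<omega>\<bar>) \<le> a * b"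
proof -
  have le: "\<bar>X \<omega> * Y \<omega>\<bar> \<le> b / (2 * a) * (X \<omega>)\<^sup>2 + a / (2 * b) * (Y \<omega>)\<^sup>2" for \<omega>
  proof -
    have "0 \<le> (b * \<bar>X \<omega>\<bar> - a * \<bar>Y \<omega>\<bar>)\<^sup>2" by simp
    then have "2 * (a * b) * \<bar>X \<omega> * Y \<omega>\<bar> \<le> b\<^sup>2 * (X \<omega>)\<^sup>2 + a\<^sup>2 * (Y \<omega>)\<^sup>2"
      by (simp add: power2_diff power_mult_distrib abs_mult mult_ac)
    then show ?thesis using pos by (simp add: field_simps power2_eq_square)
  qed
  have I: "integrable M (\<lambda>\<omega>. b / (2 * a) * (X \<omega>)\<^sup>2 + a / (2 * b) * (Y \<omega>)\<^sup>2)"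
    using X Y by simp
  show int: "integrable M (\<lambda>\<omega>. X \<omega> * Y \<omega>)"
    by (rule Bochner_Integration.integrable_bound[OF I])
       (use le in \<open>auto intro!: AE_I2 order.trans[OF _ abs_ge_self]\<close>)
  have "expectation (\<lambda>\<omega>. \<bar>X \<omega> * Y \<omega>\<bar>) \<le> expectation (\<lambda>\<omega>. b / (2 * a) * (X \<omega>)\<^sup>2 + a / (2 * b) * (Y \<omega>)\<^sup>2)"
    using le by (intro integral_mono integrable_abs int I) auto
  also have "\<dots> = b / (2 * a) * expectation (\<lambda>\<omega>. (X \<omega>)\<^sup>2) + a / (2 * b) * expectation (\<lambda>\<omega>. (Y \<omega>)\<^sup>2)"
    using X Y by simp
  also have "\<dots> \<le> b / (2 * a) * a\<^sup>2 + a / (2 * b) * b\<^sup>2"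
    using a b pos by (intro add_mono mult_left_mono) auto
  also have "\<dots> = a * b" using pos by (simp add: power2_eq_square)
  finally show "expectation (\<lambda>\<omega>. \<bar>X \<omega> * Y \<omega>\<bar>) \<le> a * b" .
qed

end

section \<open>The normal limit law, the law of the observations and the limiting variance\<close>

lemma real_distribution_normal_law:
  assumes "v \<ge> 0" shows "real_distribution (normal_law m v)"
proof (cases "v = 0")
  case True
  then show ?thesis
    by (auto simp: normal_law_def real_distribution_def real_distribution_axioms_def intro!: prob_space_return)
next
  case False
  then show ?thesis using assms prob_space_normal_density[of "sqrt v" m]
    by (auto simp: normal_law_def real_distribution_def real_distribution_axioms_def)
qed

lemma char_normal_law:
  assumes "v \<ge> 0"
  shows "char (normal_law 0 v) t = exp (- (v * t\<^sup>2 / 2))"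
proof (cases "v = 0")
  case True
  then show ?thesis
    by (simp add: normal_law_def char_def integral_return)
next
  case False
  interpret N: prob_space std_normal_distribution
    using prob_space_normal_density by auto
  have "distributed std_normal_distribution lborel (\<lambda>x. x) (normal_density 0 1)"
    unfolding distributed_def by (auto intro!: distr_id2)
  from N.normal_density_affine[OF this, of "sqrt v" 0]
  have D: "distributed std_normal_distribution lborel (\<lambda>x. sqrt v * x) (normal_density 0 (sqrt v))"
    using False assms by simp
  have "normal_law 0 v = distr std_normal_distribution lborel (\<lambda>x. sqrt v * x)"
    using D False by (simp add: normal_law_def distributed_distr_eq_density)
  then have "char (normal_law 0 v) t = char std_normal_distribution (t * sqrt v)"
    by (simp add: char_def integral_distr mult_ac)
  also have "\<dots> = exp (- (v * t\<^sup>2 / 2))"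
    using assms by (simp add: char_std_normal_distribution power_mult_distrib mult_ac)
  finally show ?thesis .
qed

lemma (in prob_space) char_eq_cf_of_density:
  assumes V: "distributed M lborel V (\<lambda>y. ennreal (f y))" and f: "\<And>y. 0 \<le> f y"
  shows "char (distr M borel V) t = cf_of_density f t"
proof -
  have [measurable]: "f \<in> borel_measurable borel" "random_variable borel V"
    using distributed_real_measurable[OF _ V] distributed_measurable[OF V] f by auto
  have "char (distr M borel V) t = (\<integral>y. iexp (t * y) \<partial>distr M lborel V)"
    by (simp add: char_def integral_distr)
  also have "\<dots> = (\<integral>y. f y *\<^sub>R iexp (t * y) \<partial>lborel)"
    unfolding distributed_distr_eq_density[OF V] by (subst integral_density) (auto simp: f)
  finally show ?thesis by (simp add: cf_of_density_def scaleR_conv_of_real mult_ac)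
qed

text \<open>
  Almost surely \<open>U\<close> is 0 or 1, so \<open>iexp (t U V)\<close> is 1 on one event and \<open>iexp (t V)\<close> on the other;
  independence then factors the expectations.
\<close>

lemma (in prob_space) char_atomic_normal_sum:
  fixes U V Z :: "'a \<Rightarrow> real"
  assumes indep: "indep_vars (\<lambda>_. borel) (\<lambda>i. [U, V, Z] ! i) {0, 1, 2}"
    and U0: "measure M {\<omega> \<in> space M. U \<omega> = 0} = p"
    and U1: "measure M {\<omega> \<in> space M. U \<omega> = 1} = 1 - p"
    and V: "distributed M lborel V (\<lambda>y. ennreal (f y))" and f: "\<And>y. 0 \<le> f y"
    and Z: "distributed M lborel Z (\<lambda>z. ennreal (std_normal_density z))"
  shows "char (distr M borel (\<lambda>\<omega>. U \<omega> * V \<omega> + \<sigma> * Z \<omega>)) t =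
    (of_real p + of_real (1 - p) * cf_of_density f t) * of_real (exp (- (\<sigma>\<^sup>2 * t\<^sup>2 / 2)))"
proof -
  have [measurable]: "random_variable borel U" "random_variable borel V" "random_variable borel Z"
    using indep by (auto simp: indep_vars_def dest!: bspec[where x="0::nat"] bspec[where x="1::nat"] bspec[where x="2::nat"])
  have UV: "indep_var borel U borel V"
    using indep_vars_imp_indep_var[OF indep, of 0 1] by simp
  have "indep_var borel ((\<lambda>g. g 0 * g 1) \<circ> (\<lambda>\<omega>. restrict (\<lambda>i. ([U, V, Z] ! i) \<omega>) {0, 1}))
      borel ((\<lambda>g. \<sigma> * g 2) \<circ> (\<lambda>\<omega>. restrict (\<lambda>i. ([U, V, Z] ! i) \<omega>) {2}))"
    by (rule indep_var_compose[OF indep_var_restrict[OF indep, of "{0, 1}" "{2}"]]) auto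
  then have "indep_var borel (\<lambda>\<omega>. U \<omega> * V \<omega>) borel (\<lambda>\<omega>. \<sigma> * Z \<omega>)"
    by (simp add: comp_def numeral_2_eq_2)
  then have "char (distr M borel (\<lambda>\<omega>. U \<omega> * V \<omega> + \<sigma> * Z \<omega>)) t =
      char (distr M borel (\<lambda>\<omega>. U \<omega> * V \<omega>)) t * char (distr M borel (\<lambda>\<omega>. \<sigma> * Z \<omega>)) t"
    by (rule char_distr_add)
  also have "char (distr M borel (\<lambda>\<omega>. \<sigma> * Z \<omega>)) t = char (distr M lborel Z) (\<sigma> * t)"
    by (simp add: char_def integral_distr mult_ac)
  also have "\<dots> = of_real (exp (- (\<sigma>\<^sup>2 * t\<^sup>2 / 2)))"
    unfolding distributed_distr_eq_density[OF Z]
    by (simp add: char_std_normal_distribution power_mult_distrib)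
  also have "char (distr M borel (\<lambda>\<omega>. U \<omega> * V \<omega>)) t = expectation (\<lambda>\<omega>. iexp (t * (U \<omega> * V \<omega>)))"
    by (simp add: char_def integral_distr)
  also have "\<dots> = expectation (\<lambda>\<omega>. of_real (indicator {0} (U \<omega>)) + of_real (indicator {1} (U \<omega>)) * iexp (t * V \<omega>))"
  proof (rule integral_cong_AE)
    have "prob ({\<omega> \<in> space M. U \<omega> = 0} \<union> {\<omega> \<in> space M. U \<omega> = 1}) = 1"
      using U0 U1 by (subst finite_measure_Union) auto
    then have "AE \<omega> in M. \<omega> \<in> {\<omega> \<in> space M. U \<omega> = 0} \<union> {\<omega> \<in> space M. U \<omega> = 1}"
      by (intro AE_prob_1) simp
    then show "AE \<omega> in M. iexp (t * (U \<omega> * V \<omega>)) =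
        of_real (indicator {0} (U \<omega>)) + of_real (indicator {1} (U \<omega>)) * iexp (t * V \<omega>)"
      by eventually_elim auto
  qed measurable
  also have "\<dots> = expectation (\<lambda>\<omega>. of_real (indicator {0} (U \<omega>))) +
      expectation (\<lambda>\<omega>. of_real (indicator {1} (U \<omega>)) * iexp (t * V \<omega>))"
    by (intro Bochner_Integration.integral_add integrable_const_bound[of _ 1])
       (auto simp: norm_mult indicator_def)
  also have "expectation (\<lambda>\<omega>. complex_of_real (indicator {0} (U \<omega>))) = of_real p"
  proof -
    have "expectation (\<lambda>\<omega>. complex_of_real (indicator {0} (U \<omega>))) = of_real (expectation (\<lambda>\<omega>. indicator {0} (U \<omega>)))"
      by (rule integral_complex_of_real)
    also have "expectation (\<lambda>\<omega>. indicator {0} (U \<omega>) :: real) = expectation (indicator {\<omega> \<in> space M. U \<omega> = 0})"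
      by (intro Bochner_Integration.integral_cong) (auto simp: indicator_def)
    finally show ?thesis using U0 by simp
  qed
  also have "expectation (\<lambda>\<omega>. of_real (indicator {1} (U \<omega>)) * iexp (t * V \<omega>)) =
      expectation (\<lambda>\<omega>. of_real (indicator {1} (U \<omega>))) * expectation (\<lambda>\<omega>. iexp (t * V \<omega>))"
  proof (rule indep_var_lebesgue_integral)
    show "integrable M (\<lambda>\<omega>. complex_of_real (indicator {1} (U \<omega>)))"
      by (intro integrable_const_bound[of _ 1]) (auto simp: indicator_def)
    show "integrable M (\<lambda>\<omega>. iexp (t * V \<omega>))" by (intro integrable_iexp) auto
    show "indep_var borel (\<lambda>\<omega>. complex_of_real (indicator {1} (U \<omega>))) borel (\<lambda>\<omega>. iexp (t * V \<omega>))"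
      using indep_var_compose[OF UV, of "\<lambda>u. complex_of_real (indicator {1} u)" borel "\<lambda>y. iexp (t * y)" borel]
      by (simp add: comp_def)
  qed
  also have "expectation (\<lambda>\<omega>. complex_of_real (indicator {1} (U \<omega>))) = of_real (1 - p)"
  proof -
    have "expectation (\<lambda>\<omega>. complex_of_real (indicator {1} (U \<omega>))) = of_real (expectation (\<lambda>\<omega>. indicator {1} (U \<omega>)))"
      by (rule integral_complex_of_real)
    also have "expectation (\<lambda>\<omega>. indicator {1} (U \<omega>) :: real) = expectation (indicator {\<omega> \<in> space M. U \<omega> = 1})"
      by (intro Bochner_Integration.integral_cong) (auto simp: indicator_def)
    finally show ?thesis using U1 by simp
  qed
  also have "expectation (\<lambda>\<omega>. iexp (t * V \<omega>)) = cf_of_density f t"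
    using char_eq_cf_of_density[OF V f, of t] by (simp add: char_def integral_distr)
  finally show ?thesis .
qed

context real_distribution begin

lemma integral_cos_shift:
  "integrable M (\<lambda>y. cos (s * (y - x)))"
  "(\<integral>y. cos (s * (y - x)) \<partial>M) = Re (iexp (- (s * x)) * char M s)"
proof -
  show "integrable M (\<lambda>y. cos (s * (y - x)))"
    by (intro integrable_const_bound[of _ 1]) auto
  have I: "integrable M (\<lambda>y. iexp (s * y))" by (intro integrable_iexp) auto
  have "iexp (- (s * x)) * char M s = (\<integral>y. iexp (- (s * x)) * iexp (s * y) \<partial>M)"
    unfolding char_def by simp
  also have "Re \<dots> = (\<integral>y. Re (iexp (- (s * x)) * iexp (s * y)) \<partial>M)"
    using I by (intro integral_Re[symmetric]) simp
  also have "\<dots> = (\<integral>y. cos (s * (y - x)) \<partial>M)"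
    by (intro Bochner_Integration.integral_cong refl) (simp add: right_diff_distrib flip: exp_add add: Re_exp)
  finally show "(\<integral>y. cos (s * (y - x)) \<partial>M) = Re (iexp (- (s * x)) * char M s)" ..
qed

text \<open>
  A characteristic function that vanishes at infinity means that the phase \<open>(Y - x) / h\<close> becomes
  uniformly distributed modulo \<open>2 \<pi>\<close>. The two moments of its cosine are those of the uniform phase.
\<close>

lemma cos_moments_tendsto:
  assumes char0: "(char M \<longlongrightarrow> 0) at_top" and h: "filterlim h (at_right 0) F"
  shows "((\<lambda>n. \<integral>y. cos ((y - x) / h n) \<partial>M) \<longlongrightarrow> 0) F"
    and "((\<lambda>n. \<integral>y. (cos ((y - x) / h n))\<^sup>2 \<partial>M) \<longlongrightarrow> 1 / 2) F"
proof -
  have lim: "((\<lambda>s. \<integral>y. cos (s * (y - x)) \<partial>M) \<longlongrightarrow> 0) at_top"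
  proof (rule Lim_null_comparison)
    show "\<forall>\<^sub>F s in at_top. norm (\<integral>y. cos (s * (y - x)) \<partial>M) \<le> norm (char M s)"
    proof (intro always_eventually allI)
      fix s
      have "norm (\<integral>y. cos (s * (y - x)) \<partial>M) \<le> norm (iexp (- (s * x)) * char M s)"
        unfolding integral_cos_shift(2) real_norm_def by (rule abs_Re_le_cmod)
      then show "norm (\<integral>y. cos (s * (y - x)) \<partial>M) \<le> norm (char M s)"
        by (simp add: norm_mult)
    qed
    show "((\<lambda>s. norm (char M s)) \<longlongrightarrow> 0) at_top"
      using char0 by (rule tendsto_norm_zero)
  qed
  have inv: "filterlim (\<lambda>n. inverse (h n)) at_top F"
    using filterlim_compose[OF filterlim_inverse_at_top_right h] .
  show "((\<lambda>n. \<integral>y. cos ((y - x) / h n) \<partial>M) \<longlongrightarrow> 0) F"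
    using filterlim_compose[OF lim inv] by (simp add: divide_inverse mult_ac)
  have inv2: "filterlim (\<lambda>n. 2 * inverse (h n)) at_top F"
    by (rule filterlim_tendsto_pos_mult_at_top[OF tendsto_const _ inv]) simp
  have "(\<integral>y. (cos ((y - x) / h n))\<^sup>2 \<partial>M) = 1 / 2 + (\<integral>y. cos (2 * inverse (h n) * (y - x)) \<partial>M) / 2" for n
  proof -
    have "(\<integral>y. (cos ((y - x) / h n))\<^sup>2 \<partial>M) = (\<integral>y. 1 / 2 + cos (2 * inverse (h n) * (y - x)) / 2 \<partial>M)"
    proof (intro Bochner_Integration.integral_cong refl)
      fix y
      show "(cos ((y - x) / h n))\<^sup>2 = 1 / 2 + cos (2 * inverse (h n) * (y - x)) / 2"
      proof -
        have "2 * inverse (h n) * (y - x) = 2 * ((y - x) / h n)" by (simp add: divide_inverse)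
        then show ?thesis using cos_double_cos[of "(y - x) / h n"] by (simp add: field_simps)
      qed
    qed
    also have "\<dots> = 1 / 2 + (\<integral>y. cos (2 * inverse (h n) * (y - x)) \<partial>M) / 2"
      using integral_cos_shift(1)[of "2 * inverse (h n)" x] prob_space by simp
    finally show ?thesis .
  qed
  moreover have "((\<lambda>n. 1 / 2 + (\<integral>y. cos (2 * inverse (h n) * (y - x)) \<partial>M) / 2) \<longlongrightarrow> 1 / 2 + 0 / 2) F"
    by (intro tendsto_intros filterlim_compose[OF lim inv2]) auto
  ultimately show "((\<lambda>n. \<integral>y. (cos ((y - x) / h n))\<^sup>2 \<partial>M) \<longlongrightarrow> 1 / 2) F"
    by simp
qed

text \<open>
  A bounded remainder that tends to 0 pointwise contributes nothing to the first two moments.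
\<close>

lemma variance_tendsto_of_cos_approx:
  fixes h :: "nat \<Rightarrow> real"
  assumes char0: "(char M \<longlongrightarrow> 0) at_top" and h: "filterlim h (at_right 0) sequentially"
    and [measurable]: "\<And>n. \<kappa> n \<in> borel_measurable borel"
    and bound: "\<And>n y. \<bar>\<kappa> n y\<bar> \<le> K"
    and approx: "\<And>y. (\<lambda>n. \<kappa> n y - a * cos ((y - x) / h n)) \<longlonglongrightarrow> 0"
  shows "(\<lambda>n. \<integral>y. (\<kappa> n y - (\<integral>z. \<kappa> n z \<partial>M))\<^sup>2 \<partial>M) \<longlonglongrightarrow> a\<^sup>2 / 2"
proof -
  define c where "c n y = a * cos ((y - x) / h n)" for n y
  have [measurable]: "c n \<in> borel_measurable borel" for n unfolding c_def by measurable
  have cb: "\<bar>c n y\<bar> \<le> \<bar>a\<bar>" for n y by (auto simp: c_def abs_mult intro: mult_left_le)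
  have K: "K \<ge> 0" using bound[of 0 0] by linarith
  have sqb: "(\<kappa> n y)\<^sup>2 \<le> K\<^sup>2" "(c n y)\<^sup>2 \<le> a\<^sup>2" for n y
    using power_mono[OF bound, of n y 2] power_mono[OF cb, of n y 2] by auto
  have I: "integrable M (\<kappa> n)" "integrable M (c n)" for n
    by (intro integrable_const_bound[of _ K] integrable_const_bound[of _ "\<bar>a\<bar>"]; use bound cb in auto)+
  have I2: "integrable M (\<lambda>y. (\<kappa> n y)\<^sup>2)" "integrable M (\<lambda>y. (c n y)\<^sup>2)" for n
    by (intro integrable_const_bound[of _ "K\<^sup>2"] integrable_const_bound[of _ "a\<^sup>2"]; use sqb in auto)+
  have r0: "(\<lambda>n. \<kappa> n y - c n y) \<longlonglongrightarrow> 0" for y using approx by (simp add: c_def)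
  have d1: "(\<lambda>n. \<integral>y. \<kappa> n y - c n y \<partial>M) \<longlonglongrightarrow> (\<integral>y. 0 \<partial>M)"
  proof (rule integral_dominated_convergence[where w="\<lambda>_. K + \<bar>a\<bar>"])
    show "AE y in M. norm (\<kappa> n y - c n y) \<le> K + \<bar>a\<bar>" for n
      using bound cb by (intro AE_I2) (smt (verit) real_norm_def)
  qed (use r0 in auto)
  have d2: "(\<lambda>n. \<integral>y. (\<kappa> n y)\<^sup>2 - (c n y)\<^sup>2 \<partial>M) \<longlonglongrightarrow> (\<integral>y. 0 \<partial>M)"
  proof (rule integral_dominated_convergence[where w="\<lambda>_. K\<^sup>2 + a\<^sup>2"])
    show "AE y in M. norm ((\<kappa> n y)\<^sup>2 - (c n y)\<^sup>2) \<le> K\<^sup>2 + a\<^sup>2" for n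
      using sqb by (intro AE_I2) (smt (verit) real_norm_def zero_le_power2)
    show "AE y in M. (\<lambda>n. (\<kappa> n y)\<^sup>2 - (c n y)\<^sup>2) \<longlonglongrightarrow> 0"
    proof (rule AE_I2)
      fix y
      show "(\<lambda>n. (\<kappa> n y)\<^sup>2 - (c n y)\<^sup>2) \<longlonglongrightarrow> 0"
      proof (rule Lim_null_comparison)
        show "(\<lambda>n. \<bar>\<kappa> n y - c n y\<bar> * (K + \<bar>a\<bar>)) \<longlonglongrightarrow> 0"
          using r0[of y] by (intro tendsto_mult_left_zero tendsto_rabs_zero)
        have "\<bar>\<kappa> n y + c n y\<bar> \<le> K + \<bar>a\<bar>" for n using bound[of n y] cb[of n y] by linarith
        then show "\<forall>\<^sub>F n in sequentially. norm ((\<kappa> n y)\<^sup>2 - (c n y)\<^sup>2) \<le> \<bar>\<kappa> n y - c n y\<bar> * (K + \<bar>a\<bar>)"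
          unfolding power2_eq_square square_diff_square_factored real_norm_def abs_mult
          by (intro always_eventually allI) (metis abs_ge_zero mult.commute mult_left_mono)
      qed
    qed
  qed auto
  have m: "(\<lambda>n. \<integral>y. \<kappa> n y \<partial>M) \<longlonglongrightarrow> 0"
  proof -
    have "(\<lambda>n. (\<integral>y. \<kappa> n y - c n y \<partial>M) + a * (\<integral>y. cos ((y - x) / h n) \<partial>M)) \<longlonglongrightarrow> (\<integral>y. 0 \<partial>M) + a * 0"
      by (intro tendsto_intros d1 cos_moments_tendsto[OF char0 h])
    moreover have "a * (\<integral>y. cos ((y - x) / h n) \<partial>M) = (\<integral>y. c n y \<partial>M)" for n
      by (simp add: c_def)
    then have "(\<integral>y. \<kappa> n y - c n y \<partial>M) + a * (\<integral>y. cos ((y - x) / h n) \<partial>M) = (\<integral>y. \<kappa> n y \<partial>M)" for n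
      using I by simp
    ultimately show ?thesis by simp
  qed
  have s: "(\<lambda>n. \<integral>y. (\<kappa> n y)\<^sup>2 \<partial>M) \<longlonglongrightarrow> a\<^sup>2 / 2"
  proof -
    have "(\<lambda>n. (\<integral>y. (\<kappa> n y)\<^sup>2 - (c n y)\<^sup>2 \<partial>M) + a\<^sup>2 * (\<integral>y. (cos ((y - x) / h n))\<^sup>2 \<partial>M)) \<longlonglongrightarrow> (\<integral>y. 0 \<partial>M) + a\<^sup>2 * (1 / 2)"
      by (intro tendsto_intros d2 cos_moments_tendsto[OF char0 h])
    moreover have "a\<^sup>2 * (\<integral>y. (cos ((y - x) / h n))\<^sup>2 \<partial>M) = (\<integral>y. (c n y)\<^sup>2 \<partial>M)" for n
      by (simp add: c_def power_mult_distrib)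
    then have "(\<integral>y. (\<kappa> n y)\<^sup>2 - (c n y)\<^sup>2 \<partial>M) + a\<^sup>2 * (\<integral>y. (cos ((y - x) / h n))\<^sup>2 \<partial>M) = (\<integral>y. (\<kappa> n y)\<^sup>2 \<partial>M)" for n
      using I2 by simp
    ultimately show ?thesis by simp
  qed
  have "(\<integral>y. (\<kappa> n y - (\<integral>z. \<kappa> n z \<partial>M))\<^sup>2 \<partial>M) = (\<integral>y. (\<kappa> n y)\<^sup>2 \<partial>M) - (\<integral>y. \<kappa> n y \<partial>M)\<^sup>2" for n
    using I I2 by (intro variance_eq) auto
  moreover have "(\<lambda>n. (\<integral>y. (\<kappa> n y)\<^sup>2 \<partial>M) - (\<integral>y. \<kappa> n y \<partial>M)\<^sup>2) \<longlonglongrightarrow> a\<^sup>2 / 2 - 0\<^sup>2"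
    by (intro tendsto_intros s m)
  ultimately show ?thesis by simp
qed

end

lemma (in kernel_transform) deconv_kernel_measurable [measurable]:
  "deconv_kernel \<sigma> \<phi> h \<in> borel_measurable borel"
  unfolding deconv_kernel_def by measurable

text \<open>
  Fubini's theorem moves the expectation onto \<open>cos (t (Y - x))\<close>; the Gaussian factor of the
  characteristic function of the observations then cancels the weight \<open>exp (\<sigma>\<^sup>2 t\<^sup>2 / 2)\<close>.
\<close>

lemma (in kernel_transform) integral_deconv_kernel:
  assumes \<mu>: "real_distribution \<mu>" and h: "h > 0"
    and char: "\<And>t. char \<mu> t = q t * of_real (exp (- (\<sigma>\<^sup>2 * t\<^sup>2 / 2)))"
  shows "(\<integral>y. deconv_kernel \<sigma> \<phi> h (y - x) \<partial>\<mu>) = (\<integral>t. \<phi> (h * t) * Re (iexp (- (t * x)) * q t) \<partial>lborel)"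
proof -
  interpret \<mu>: real_distribution \<mu> by fact
  interpret P: pair_sigma_finite \<mu> lborel ..
  define F where "F y t = cos (t * (y - x)) * exp (\<sigma>\<^sup>2 * t\<^sup>2 / 2) * \<phi> (h * t)" for y t
  have F_eq: "F y t = \<phi> (h * t) *\<^sub>R (cos (t * (y - x)) * exp (\<sigma>\<^sup>2 * t\<^sup>2 / 2))" for y t
    by (simp add: F_def)
  define B where "B = (\<integral>t. \<bar>\<phi> (h * t) *\<^sub>R exp (\<sigma>\<^sup>2 * t\<^sup>2 / 2)\<bar> \<partial>lborel)"
  have IB: "integrable lborel (\<lambda>t. \<phi> (h * t) *\<^sub>R exp (\<sigma>\<^sup>2 * t\<^sup>2 / 2))"
    by (intro integrable_scaled h) (auto intro!: continuous_intros)
  have IF: "integrable lborel (F y)" for y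
    unfolding F_eq by (intro integrable_scaled h) (auto intro!: continuous_intros)
  have int: "integrable (\<mu> \<Otimes>\<^sub>M lborel) (\<lambda>(y, t). F y t)"
  proof (rule P.Fubini_integrable)
    show "case_prod F \<in> borel_measurable (\<mu> \<Otimes>\<^sub>M lborel)"
      unfolding F_def by measurable
    show "AE y in \<mu>. integrable lborel (\<lambda>t. case (y, t) of (y, t) \<Rightarrow> F y t)"
      using IF by simp
    have le: "\<bar>\<integral>t. \<bar>F y t\<bar> \<partial>lborel\<bar> \<le> B" for y
    proof -
      have "\<bar>\<integral>t. \<bar>F y t\<bar> \<partial>lborel\<bar> = (\<integral>t. \<bar>F y t\<bar> \<partial>lborel)" by simp
      also have "\<dots> \<le> B" unfolding B_def
      proof (rule integral_mono)
        fix t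
        have "\<bar>cos (t * (y - x))\<bar> * (\<bar>\<phi> (h * t)\<bar> * exp (\<sigma>\<^sup>2 * t\<^sup>2 / 2)) \<le> 1 * (\<bar>\<phi> (h * t)\<bar> * exp (\<sigma>\<^sup>2 * t\<^sup>2 / 2))"
          by (intro mult_right_mono) auto
        then show "\<bar>F y t\<bar> \<le> \<bar>\<phi> (h * t) *\<^sub>R exp (\<sigma>\<^sup>2 * t\<^sup>2 / 2)\<bar>"
          by (simp add: F_def abs_mult mult_ac)
      qed (use IF IB in \<open>auto intro!: integrable_abs\<close>)
      finally show ?thesis .
    qed
    show "integrable \<mu> (\<lambda>y. \<integral>t. norm (case (y, t) of (y, t) \<Rightarrow> F y t) \<partial>lborel)"
    proof (rule \<mu>.integrable_const_bound[of _ B])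
      show "AE y in \<mu>. norm (\<integral>t. norm (case (y, t) of (y, t) \<Rightarrow> F y t) \<partial>lborel) \<le> B"
        using le by simp
    qed (simp add: F_def)
  qed
  have "(\<integral>y. deconv_kernel \<sigma> \<phi> h (y - x) \<partial>\<mu>) = (\<integral>y. (\<integral>t. F y t \<partial>lborel) \<partial>\<mu>)"
    by (simp add: deconv_kernel_def F_def)
  also have "\<dots> = (\<integral>t. (\<integral>y. F y t \<partial>\<mu>) \<partial>lborel)"
    using P.Fubini_integral[OF int] by simp
  also have "\<dots> = (\<integral>t. \<phi> (h * t) * Re (iexp (- (t * x)) * q t) \<partial>lborel)"
  proof (intro Bochner_Integration.integral_cong refl)
    fix t
    have "(\<integral>y. F y t \<partial>\<mu>) = \<phi> (h * t) * (exp (\<sigma>\<^sup>2 * t\<^sup>2 / 2) * (\<integral>y. cos (t * (y - x)) \<partial>\<mu>))"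
      by (simp add: F_def)
    also have "(\<integral>y. cos (t * (y - x)) \<partial>\<mu>) = Re (iexp (- (t * x)) * q t) * exp (- (\<sigma>\<^sup>2 * t\<^sup>2 / 2))"
      unfolding \<mu>.integral_cos_shift(2) char by (simp add: algebra_simps)
    also have "exp (\<sigma>\<^sup>2 * t\<^sup>2 / 2) * (Re (iexp (- (t * x)) * q t) * exp (- (\<sigma>\<^sup>2 * t\<^sup>2 / 2))) = Re (iexp (- (t * x)) * q t)"
      by (simp add: exp_minus field_simps)
    finally show "(\<integral>y. F y t \<partial>\<mu>) = \<phi> (h * t) * Re (iexp (- (t * x)) * q t)" .
  qed
  finally show ?thesis .
qed

lemma (in kernel_transform) variance_deconv_kernel_tendsto:
  fixes h :: "nat \<Rightarrow> real" and x :: real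
  assumes \<mu>: "real_distribution \<mu>" "(char \<mu> \<longlongrightarrow> 0) at_top"
    and h: "filterlim h (at_right 0) sequentially" and \<sigma>: "\<sigma> > 0"
  defines "\<kappa> \<equiv> \<lambda>n y. deconv_kernel \<sigma> \<phi> (h n) (y - x) / (h n powr (1 + 2 * \<alpha>) * exp (\<sigma>\<^sup>2 / (2 * (h n)\<^sup>2)))"
  shows "(\<lambda>n. \<integral>y. (\<kappa> n y - (\<integral>z. \<kappa> n z \<partial>\<mu>))\<^sup>2 \<partial>\<mu>)
      \<longlonglongrightarrow> (2 * \<sigma> powr (- (2 + 2 * \<alpha>)) * A * Gamma (\<alpha> + 1))\<^sup>2 / 2"
proof -
  obtain n0 where n0: "\<And>n. n \<ge> n0 \<Longrightarrow> h n > 0"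
    using h by (auto simp: filterlim_at eventually_conj_iff eventually_sequentially)
  obtain K where K: "\<And>h y. h > 0 \<Longrightarrow> \<bar>deconv_kernel \<sigma> \<phi> h y\<bar> \<le> K * (h powr (1 + 2 * \<alpha>) * exp (\<sigma>\<^sup>2 / (2 * h\<^sup>2)))"
    using deconv_kernel_bound[OF \<sigma>] by blast
  \<comment> \<open>Shifting the index makes positivity and the bound hold for every \<open>n\<close>, not just eventually.\<close>
  have h': "filterlim (\<lambda>n. h (n + n0)) (at_right 0) sequentially"
    using h by (rule filterlim_compose) (rule filterlim_add_const_nat_at_top)
  have "(\<lambda>n. \<integral>y. (\<kappa> (n + n0) y - (\<integral>z. \<kappa> (n + n0) z \<partial>\<mu>))\<^sup>2 \<partial>\<mu>)
      \<longlonglongrightarrow> (2 * \<sigma> powr (- (2 + 2 * \<alpha>)) * A * Gamma (\<alpha> + 1))\<^sup>2 / 2"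
  proof (rule real_distribution.variance_tendsto_of_cos_approx[OF \<mu> h', where K=K and x=x])
    show "\<kappa> (n + n0) \<in> borel_measurable borel" for n
      unfolding \<kappa>_def by measurable
    show "\<bar>\<kappa> (n + n0) y\<bar> \<le> K" for n y
      using K[of "h (n + n0)" "y - x"] n0[of "n + n0"] by (simp add: \<kappa>_def abs_mult field_simps)
    show "(\<lambda>n. \<kappa> (n + n0) y - 2 * \<sigma> powr (- (2 + 2 * \<alpha>)) * A * Gamma (\<alpha> + 1) * cos ((y - x) / h (n + n0))) \<longlonglongrightarrow> 0" for y
      unfolding \<kappa>_def using n0 h' by (intro deconv_kernel_asymp \<sigma>) (auto simp: filterlim_at)
  qed
  then show ?thesis by (rule LIMSEQ_offset)
qed

section \<open>The estimators as empirical means\<close>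

context kernel_transform begin

text \<open>
  The empirical characteristic function is a finite sum, so its integral against the deconvolution
  weight is the empirical mean of deconvolution kernels.
\<close>

lemma integral_phi_emp:
  fixes \<sigma> x :: real and \<xi> :: "nat \<Rightarrow> real" and n :: nat
  assumes h: "h > 0"
  defines "F \<equiv> \<lambda>t. \<phi> (h * t) *\<^sub>R (iexp (- (t * x)) * phi_emp n \<xi> t * complex_of_real (exp (\<sigma>\<^sup>2 * t\<^sup>2 / 2)))"
  shows "integrable lborel F"
    and "Re (\<integral>t. F t \<partial>lborel) = (\<Sum>j=1..n. deconv_kernel \<sigma> \<phi> h (\<xi> j - x)) / real n"
proof -
  show int: "integrable lborel F"
    unfolding F_def phi_emp_def
    by (intro integrable_scaled h continuous_on_mult continuous_on_const) (auto intro!: continuous_intros)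
  define f where "f j t = cos (t * (\<xi> j - x)) * exp (\<sigma>\<^sup>2 * t\<^sup>2 / 2) * \<phi> (h * t)" for j t
  have f_eq: "f j t = \<phi> (h * t) *\<^sub>R (cos (t * (\<xi> j - x)) * exp (\<sigma>\<^sup>2 * t\<^sup>2 / 2))" for j t
    by (simp add: f_def)
  have intf: "integrable lborel (f j)" for j
    unfolding f_eq by (intro integrable_scaled h) (auto intro!: continuous_intros)
  have "Re (\<integral>t. F t \<partial>lborel) = (\<integral>t. Re (F t) \<partial>lborel)"
    using int by (rule integral_Re[symmetric])
  also have "\<dots> = (\<integral>t. (\<Sum>j=1..n. f j t) / real n \<partial>lborel)"
  proof (intro Bochner_Integration.integral_cong refl)
    fix t
    have "iexp (- (t * x)) * phi_emp n \<xi> t = complex_of_real (1 / real n) * (\<Sum>j=1..n. iexp (- (t * x)) * iexp (t * \<xi> j))"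
      by (simp add: phi_emp_def sum_distrib_left)
    also have "\<dots> = complex_of_real (1 / real n) * (\<Sum>j=1..n. iexp (t * (\<xi> j - x)))"
      by (simp add: right_diff_distrib flip: exp_add)
    finally have "Re (iexp (- (t * x)) * phi_emp n \<xi> t) = (\<Sum>j=1..n. cos (t * (\<xi> j - x))) / real n"
      by (simp only: times_complex.sel Re_complex_of_real Im_complex_of_real Re_sum) (simp add: Re_exp)
    moreover have "Re (F t) = \<phi> (h * t) * (Re (iexp (- (t * x)) * phi_emp n \<xi> t) * exp (\<sigma>\<^sup>2 * t\<^sup>2 / 2))"
      unfolding F_def scaleR_complex.sel times_complex.sel(1)[of _ "complex_of_real _"] Re_complex_of_real Im_complex_of_real by simp
    ultimately show "Re (F t) = (\<Sum>j=1..n. f j t) / real n"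
      by (simp add: f_def sum_distrib_left sum_distrib_right mult_ac)
  qed
  also have "\<dots> = (\<Sum>j=1..n. (\<integral>t. f j t \<partial>lborel)) / real n"
    using intf by (simp add: Bochner_Integration.integral_sum)
  finally show "Re (\<integral>t. F t \<partial>lborel) = (\<Sum>j=1..n. deconv_kernel \<sigma> \<phi> h (\<xi> j - x)) / real n"
    by (simp add: deconv_kernel_def f_def)
qed

lemma p_est_eq:
  assumes g: "g > 0"
  shows "p_est \<sigma> \<phi> g n \<xi> = g / 2 * ((\<Sum>j=1..n. deconv_kernel \<sigma> \<phi> g (\<xi> j)) / real n)"
proof -
  have "(\<integral>t\<in>{- (1 / g)..1 / g}. phi_emp n \<xi> t * complex_of_real (\<phi> (g * t)) / complex_of_real (exp (- (\<sigma>\<^sup>2 * t\<^sup>2) / 2)) \<partial>lborel) =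
    (\<integral>t. \<phi> (g * t) *\<^sub>R (iexp (- (t * 0)) * phi_emp n \<xi> t * complex_of_real (exp (\<sigma>\<^sup>2 * t\<^sup>2 / 2))) \<partial>lborel)"
    unfolding set_lebesgue_integral_def
  proof (intro Bochner_Integration.integral_cong refl)
    fix t
    show "indicator {- (1 / g)..1 / g} t *\<^sub>R (phi_emp n \<xi> t * complex_of_real (\<phi> (g * t)) / complex_of_real (exp (- (\<sigma>\<^sup>2 * t\<^sup>2) / 2))) =
      \<phi> (g * t) *\<^sub>R (iexp (- (t * 0)) * phi_emp n \<xi> t * complex_of_real (exp (\<sigma>\<^sup>2 * t\<^sup>2 / 2)))"
    proof -
      have e: "complex_of_real (exp (- (\<sigma>\<^sup>2 * t\<^sup>2) / 2)) = inverse (complex_of_real (exp (\<sigma>\<^sup>2 * t\<^sup>2 / 2)))"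
        by (simp add: exp_minus)
      show ?thesis
      proof (cases "t \<in> {- (1 / g)..1 / g}")
        case True
        then have i: "indicator {- (1 / g)..1 / g} t = (1 :: real)" by (rule indicator_simps(1))
        have "iexp (- (t * 0)) = 1" by simp
        then show ?thesis unfolding e i by (simp only: scaleR_conv_of_real divide_inverse inverse_inverse_eq of_real_1 mult_1_left mult_ac)
      next
        case False
        then show ?thesis using scaled_support[OF g False] by simp
      qed
    qed
  qed
  then have "p_est \<sigma> \<phi> g n \<xi> = g / 2 * Re (\<integral>t. \<phi> (g * t) *\<^sub>R (iexp (- (t * 0)) * phi_emp n \<xi> t * complex_of_real (exp (\<sigma>\<^sup>2 * t\<^sup>2 / 2))) \<partial>lborel)"
    by (simp add: p_est_def)
  then show ?thesis unfolding integral_phi_emp(2)[OF g] by simp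
qed

lemma f_est_eq:
  assumes h: "h > 0" and q: "p_hat \<sigma> \<phi>k g \<epsilon> n \<xi> \<noteq> 1"
  shows "f_est \<sigma> \<phi> \<phi>k h g \<epsilon> n \<xi> x =
    (1 / (2 * pi) * ((\<Sum>j=1..n. deconv_kernel \<sigma> \<phi> h (\<xi> j - x)) / real n)
      - p_hat \<sigma> \<phi>k g \<epsilon> n \<xi> * (1 / (2 * pi) * (\<integral>t. \<phi> (h * t) * Re (iexp (- (t * x))) \<partial>lborel)))
    / (1 - p_hat \<sigma> \<phi>k g \<epsilon> n \<xi>)"
proof -
  define P where "P = p_hat \<sigma> \<phi>k g \<epsilon> n \<xi>"
  define F where "F = (\<lambda>t. \<phi> (h * t) *\<^sub>R (iexp (- (t * x)) * phi_emp n \<xi> t * complex_of_real (exp (\<sigma>\<^sup>2 * t\<^sup>2 / 2))))"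
  define E where "E = (\<lambda>t. \<phi> (h * t) *\<^sub>R iexp (- (t * x)))"
  have intF: "integrable lborel F" unfolding F_def by (rule integral_phi_emp[OF h])
  have intE: "integrable lborel E"
    unfolding E_def by (intro integrable_scaled h) (auto intro!: continuous_intros)
  have "f_est \<sigma> \<phi> \<phi>k h g \<epsilon> n \<xi> x = Re (1 / (2 * pi) * (\<integral>t. (1 / (1 - P)) *\<^sub>R (F t - P *\<^sub>R E t) \<partial>lborel))"
    unfolding f_est_def P_def[symmetric]
  proof (intro arg_cong[where f=Re] arg_cong2[where f="(*)"] Bochner_Integration.integral_cong refl)
    fix t
    have "complex_of_real (exp (- (\<sigma>\<^sup>2 * t\<^sup>2) / 2)) = inverse (complex_of_real (exp (\<sigma>\<^sup>2 * t\<^sup>2 / 2)))"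
      by (simp add: exp_minus)
    moreover have "complex_of_real (exp (\<sigma>\<^sup>2 * t\<^sup>2 / 2)) \<noteq> 0" "complex_of_real (1 - P) \<noteq> 0"
      using q by (auto simp: P_def complex_eq_iff)
    ultimately show "iexp (- (t * x)) * ((phi_emp n \<xi> t - complex_of_real (P * exp (- (\<sigma>\<^sup>2 * t\<^sup>2) / 2))) /
       complex_of_real ((1 - P) * exp (- (\<sigma>\<^sup>2 * t\<^sup>2) / 2))) * complex_of_real (\<phi> (h * t)) =
      (1 / (1 - P)) *\<^sub>R (F t - P *\<^sub>R E t)"
      unfolding F_def E_def scaleR_conv_of_real of_real_mult of_real_divide of_real_1
      by (simp add: field_simps del: of_real_exp of_real_diff)
  qed
  also have "(\<integral>t. (1 / (1 - P)) *\<^sub>R (F t - P *\<^sub>R E t) \<partial>lborel) = (1 / (1 - P)) *\<^sub>R ((\<integral>t. F t \<partial>lborel) - P *\<^sub>R (\<integral>t. E t \<partial>lborel))"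
    using intF intE by simp
  also have "Re (1 / (2 * pi) * \<dots>) = (1 / (2 * pi) * Re (\<integral>t. F t \<partial>lborel) - P * (1 / (2 * pi) * Re (\<integral>t. E t \<partial>lborel))) / (1 - P)"
    by (simp add: diff_divide_distrib algebra_simps)
  also have "Re (\<integral>t. F t \<partial>lborel) = (\<Sum>j=1..n. deconv_kernel \<sigma> \<phi> h (\<xi> j - x)) / real n"
    unfolding F_def by (rule integral_phi_emp[OF h])
  also have "Re (\<integral>t. E t \<partial>lborel) = (\<integral>t. \<phi> (h * t) * Re (iexp (- (t * x))) \<partial>lborel)"
    using intE by (subst integral_Re[symmetric]) (auto simp: E_def)
  finally show ?thesis by (simp only: P_def)
qed

lemma abs_integral_scaled_le:
  assumes h: "h > 0" and q: "\<And>t. \<bar>q t\<bar> \<le> 1" "continuous_on UNIV q"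
  shows "\<bar>\<integral>t. \<phi> (h * t) * q t \<partial>lborel\<bar> \<le> (\<integral>t. \<bar>\<phi> t\<bar> \<partial>lborel) / h"
proof -
  have I: "integrable lborel (\<lambda>t. \<phi> (h * t))"
    using integrable_scaled[OF h, of "\<lambda>_. 1 :: real"] by simp
  have Iq: "integrable lborel (\<lambda>t. \<phi> (h * t) * q t)"
    using integrable_scaled[OF h q(2)] by simp
  have "\<bar>\<integral>t. \<phi> (h * t) * q t \<partial>lborel\<bar> \<le> (\<integral>t. \<bar>\<phi> (h * t) * q t\<bar> \<partial>lborel)"
    by (rule integral_abs_bound)
  also have "\<dots> \<le> (\<integral>t. \<bar>\<phi> (h * t)\<bar> \<partial>lborel)"
    using I Iq q(1) by (intro integral_mono integrable_abs) (auto simp: abs_mult intro!: mult_left_le)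
  also have "\<dots> = (\<integral>t. \<bar>\<phi> t\<bar> \<partial>lborel) / h"
    using lborel_integral_real_affine[of h "\<lambda>t. \<bar>\<phi> t\<bar>" 0] h by simp
  finally show ?thesis .
qed

end

lemma f_est_measurable:
  assumes [measurable]: "\<And>j. X j \<in> borel_measurable M" "\<phi>w \<in> borel_measurable borel" "\<phi>k \<in> borel_measurable borel"
  shows "(\<lambda>\<omega>. p_est \<sigma> \<phi>k g n (\<lambda>j. X j \<omega>)) \<in> borel_measurable M"
    and "(\<lambda>\<omega>. f_est \<sigma> \<phi>w \<phi>k h g \<epsilon> n (\<lambda>j. X j \<omega>) x) \<in> borel_measurable M"
  unfolding f_est_def p_hat_def p_est_def phi_emp_def set_lebesgue_integral_def by measurable

lemma f_est_cong:
  assumes "\<And>j. j \<ge> 1 \<Longrightarrow> \<xi> j = \<xi>' j"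
  shows "f_est \<sigma> \<phi>w \<phi>k h g \<epsilon> n \<xi> x = f_est \<sigma> \<phi>w \<phi>k h g \<epsilon> n \<xi>' x"
    and "p_est \<sigma> \<phi>k g n \<xi> = p_est \<sigma> \<phi>k g n \<xi>'"
proof -
  have "phi_emp n \<xi> = phi_emp n \<xi>'" using assms by (simp add: phi_emp_def fun_eq_iff)
  then show "f_est \<sigma> \<phi>w \<phi>k h g \<epsilon> n \<xi> x = f_est \<sigma> \<phi>w \<phi>k h g \<epsilon> n \<xi>' x" "p_est \<sigma> \<phi>k g n \<xi> = p_est \<sigma> \<phi>k g n \<xi>'"
    by (simp_all add: f_est_def p_hat_def p_est_def)
qed

text \<open>
  The integral is the source of the bias of the estimator of \<open>p\<close>. The kernel transform vanishes at
  0 to the order \<open>\<gamma>\<close> and hence is dominated by \<open>\<bar>t\<bar> powr \<gamma>\<close> on the whole line; integrability of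
  \<open>\<bar>t\<bar> powr \<gamma> * q t\<close> turns this into the factor \<open>g powr \<gamma>\<close>.
\<close>

lemma mixing_bias_le:
  fixes \<phi> :: "real \<Rightarrow> real"
  assumes K: "K \<ge> 0" "\<And>t. 0 < t \<Longrightarrow> t \<le> 1 \<Longrightarrow> \<bar>\<phi> t\<bar> \<le> K * t powr \<gamma>"
    and even: "\<And>t. \<phi> (- t) = \<phi> t" and supp: "\<And>t. t \<notin> {-1..1} \<Longrightarrow> \<phi> t = 0"
    and [measurable]: "\<phi> \<in> borel_measurable borel" and g: "g > 0"
    and int: "integrable lborel (\<lambda>t. complex_of_real (\<bar>t\<bar> powr \<gamma>) * q t)"
  shows "\<bar>\<integral>t. \<phi> (g * t) * Re (q t) \<partial>lborel\<bar> \<le> K * g powr \<gamma> * (\<integral>t. norm (complex_of_real (\<bar>t\<bar> powr \<gamma>) * q t) \<partial>lborel)"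
proof -
  have all: "\<bar>\<phi> s\<bar> \<le> K * \<bar>s\<bar> powr \<gamma>" if "s \<noteq> 0" for s
  proof (cases "\<bar>s\<bar> \<le> 1")
    case True
    have "\<phi> s = \<phi> \<bar>s\<bar>" using even[of s] by (auto simp: abs_if)
    then show ?thesis using K(2)[of "\<bar>s\<bar>"] that True by simp
  next
    case False
    then have "s \<notin> {-1..1}" by auto
    then show ?thesis using supp[of s] K(1) by simp
  qed
  have "\<bar>\<integral>t. \<phi> (g * t) * Re (q t) \<partial>lborel\<bar> \<le> (\<integral>t. \<bar>\<phi> (g * t) * Re (q t)\<bar> \<partial>lborel)"
    by (rule integral_abs_bound)
  also have "\<dots> \<le> (\<integral>t. K * g powr \<gamma> * norm (complex_of_real (\<bar>t\<bar> powr \<gamma>) * q t) \<partial>lborel)"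
  proof (rule integral_mono_AE')
    show "integrable lborel (\<lambda>t. K * g powr \<gamma> * norm (complex_of_real (\<bar>t\<bar> powr \<gamma>) * q t))"
      using int by (intro integrable_mult_right integrable_norm)
    show "AE t in lborel. \<bar>\<phi> (g * t) * Re (q t)\<bar> \<le> K * g powr \<gamma> * norm (complex_of_real (\<bar>t\<bar> powr \<gamma>) * q t)"
      using AE_lborel_singleton[of "0::real"]
    proof eventually_elim
      case (elim t)
      have "\<bar>\<phi> (g * t)\<bar> * \<bar>Re (q t)\<bar> \<le> (K * \<bar>g * t\<bar> powr \<gamma>) * norm (q t)"
        using elim g K by (intro mult_mono all abs_Re_le_cmod) auto
      then show ?case using g by (simp add: abs_mult norm_mult powr_mult mult_ac)
    qed
  qed (use K in \<open>auto intro!: mult_nonneg_nonneg\<close>)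
  finally show ?thesis by simp
qed

section \<open>Rates for the bandwidths\<close>

lemma bandwidth_exp:
  fixes L e h \<sigma> :: real
  assumes h: "h = \<sigma> * ((1 + e) * L) powr (- 1 / 2)" and "\<sigma> > 0" "L > 0" "e \<ge> 0"
  shows "h > 0" "h\<^sup>2 = \<sigma>\<^sup>2 / ((1 + e) * L)" "exp (\<sigma>\<^sup>2 / (2 * h\<^sup>2)) = exp (L / 2) * exp (e * L / 2)"
    "h powr a = \<sigma> powr a * ((1 + e) * L) powr (- a / 2)"
proof -
  have pos: "(1 + e) * L > 0" using assms by simp
  show "h > 0" using assms pos by simp
  have "(((1 + e) * L) powr (- 1 / 2))\<^sup>2 = ((1 + e) * L) powr (- 1)"
    by (simp add: powr_powr flip: powr_numeral)
  then show h2: "h\<^sup>2 = \<sigma>\<^sup>2 / ((1 + e) * L)"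
    unfolding h power_mult_distrib using pos by (simp add: powr_minus_divide)
  have "\<sigma>\<^sup>2 / (2 * h\<^sup>2) = L / 2 + e * L / 2"
    unfolding h2 using assms pos by (simp add: field_simps)
  then show "exp (\<sigma>\<^sup>2 / (2 * h\<^sup>2)) = exp (L / 2) * exp (e * L / 2)" by (simp flip: exp_add)
  show "h powr a = \<sigma> powr a * ((1 + e) * L) powr (- a / 2)"
    unfolding h using assms pos by (simp add: powr_mult powr_powr)
qed

text \<open>
  Here \<open>b\<close> is the order of the \<open>L\<^sup>2\<close> error of the estimator of \<open>p\<close>: standard deviation plus bias. With
  \<open>L = ln n\<close> one has \<open>N / h = h powr (- (2 + 2 \<alpha>)) * exp (- \<eta> L / 2)\<close> and
  \<open>b = g powr (2 + 2 \<alpha>) * exp (\<delta> L / 2) + g powr (1 + \<gamma>)\<close>. As \<open>g / h\<close> is bounded, the product is of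
  order \<open>exp (- (\<eta> - \<delta>) L / 2) + g powr (\<gamma> - 1 - 2 \<alpha>) * exp (- \<eta> L / 2)\<close>. The assumption on
  \<open>\<epsilon>\<close> says that \<open>1 / \<epsilon>\<close> is eventually at most \<open>exp ((\<eta> - \<delta>) L / 4)\<close>, which both terms absorb. The last
  claim follows because \<open>N / h\<close> stays away from 0; this uses the growth condition on \<open>\<eta>\<close>.
\<close>

lemma bandwidth_rates:
  fixes \<alpha> \<gamma> \<sigma> :: real and h g \<eta> \<delta> \<epsilon> :: "nat \<Rightarrow> real"
  assumes \<sigma>: "\<sigma> > 0" and \<alpha>: "\<alpha> \<ge> 0" and \<gamma>: "\<gamma> > 1 + 2 * \<alpha>"
    and h: "\<And>n. n \<ge> 2 \<Longrightarrow> h n = \<sigma> * ((1 + \<eta> n) * ln (real n)) powr (- 1 / 2)"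
    and g: "\<And>n. n \<ge> 2 \<Longrightarrow> g n = \<sigma> * ((1 + \<delta> n) * ln (real n)) powr (- 1 / 2)"
    and \<eta>: "tends_down_to_0 \<eta>" and \<delta>: "tends_down_to_0 \<delta>"
    and pos: "\<forall>\<^sub>F n in sequentially. \<eta> n - \<delta> n > 0"
    and diff: "filterlim (\<lambda>n. (\<eta> n - \<delta> n) * ln (real n)) at_top sequentially"
    and slow: "filterlim (\<lambda>n. - \<eta> n * ln (real n) + (1 + 2 * \<alpha>) * ln (ln (real n))) at_top sequentially"
    and \<epsilon>: "\<And>n. n \<ge> 1 \<Longrightarrow> 0 < \<epsilon> n \<and> \<epsilon> n < 1"
    and \<epsilon>_rate: "(\<lambda>n. ln (\<epsilon> n) / ((\<eta> n - \<delta> n) * ln (real n))) \<longlonglongrightarrow> 0"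
  defines "N \<equiv> \<lambda>n. sqrt (real n) / (h n powr (1 + 2 * \<alpha>) * exp (\<sigma>\<^sup>2 / (2 * (h n)\<^sup>2)))"
    and "b \<equiv> \<lambda>n. g n * (g n powr (1 + 2 * \<alpha>) * exp (\<sigma>\<^sup>2 / (2 * (g n)\<^sup>2))) / sqrt (real n) + g n powr (1 + \<gamma>)"
  shows "filterlim h (at_right 0) sequentially" "filterlim g (at_right 0) sequentially"
    and "(\<lambda>n. N n / h n * (b n / \<epsilon> n)) \<longlonglongrightarrow> 0" and "(\<lambda>n. b n / \<epsilon> n) \<longlonglongrightarrow> 0"
proof -
  define L where "L n = ln (real n)" for n
  have Linf: "filterlim L at_top sequentially"
    unfolding L_def by (rule filterlim_compose[OF ln_at_top filterlim_real_sequentially])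
  have small: "filterlim k (at_right 0) sequentially"
    if k: "\<And>n. n \<ge> 2 \<Longrightarrow> k n = \<sigma> * ((1 + e n) * ln (real n)) powr (- 1 / 2)" and e: "tends_down_to_0 e" for k e :: "nat \<Rightarrow> real"
  proof -
    have "filterlim (\<lambda>n. (1 + e n) * L n) at_top sequentially"
      using e by (intro filterlim_tendsto_pos_mult_at_top[OF _ _ Linf, where c="1 + 0"] tendsto_intros)
        (auto simp: tends_down_to_0_def)
    then have "(\<lambda>n. ((1 + e n) * L n) powr (- 1 / 2)) \<longlonglongrightarrow> 0"
      by (intro tendsto_neg_powr) auto
    then have "(\<lambda>n. \<sigma> * ((1 + e n) * L n) powr (- 1 / 2)) \<longlonglongrightarrow> 0"
      by (rule tendsto_mult_right_zero)
    moreover have "\<forall>\<^sub>F n in sequentially. \<sigma> * ((1 + e n) * L n) powr (- 1 / 2) = k n"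
      using eventually_ge_at_top[of 2] by eventually_elim (simp add: k L_def)
    ultimately have lim: "k \<longlonglongrightarrow> 0" by (rule Lim_transform_eventually)
    have "\<forall>\<^sub>F n in sequentially. 0 \<le> e n" using e by (simp add: tends_down_to_0_def)
    then have "\<forall>\<^sub>F n in sequentially. k n > 0"
      using eventually_ge_at_top[of 2]
      by eventually_elim (rule bandwidth_exp(1)[OF k \<sigma>], auto)
    then show ?thesis using lim by (auto simp: filterlim_at elim: eventually_mono)
  qed
  show h0: "filterlim h (at_right 0) sequentially" using h \<eta> by (rule small)
  show g0: "filterlim g (at_right 0) sequentially" using g \<delta> by (rule small)
  define d where "d n = (\<eta> n - \<delta> n) * L n" for n
  have dinf: "filterlim d at_top sequentially" using diff by (simp add: d_def[abs_def] L_def)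
  have e1: "\<forall>\<^sub>F n in sequentially. - ln (\<epsilon> n) \<le> d n / 4"
  proof -
    have "\<forall>\<^sub>F n in sequentially. ln (\<epsilon> n) / d n > - (1 / 4)"
      using \<epsilon>_rate unfolding d_def L_def by (rule order_tendstoD) auto
    moreover have "\<forall>\<^sub>F n in sequentially. d n > 0" using dinf unfolding filterlim_at_top_dense by blast
    ultimately show ?thesis by eventually_elim (simp add: field_simps)
  qed
  have e2: "\<forall>\<^sub>F n in sequentially. \<eta> n < 3" using \<eta> by (auto simp: tends_down_to_0_def intro: order_tendstoD)
  have e3: "\<forall>\<^sub>F n in sequentially. 0 \<le> \<eta> n" "\<forall>\<^sub>F n in sequentially. 0 \<le> \<delta> n"
    using \<eta> \<delta> by (simp_all add: tends_down_to_0_def)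
  have e4: "\<forall>\<^sub>F n in sequentially. - \<eta> n * L n + (1 + 2 * \<alpha>) * ln (L n) > 0"
    using slow unfolding filterlim_at_top_dense L_def by blast
  have e5: "\<forall>\<^sub>F n in sequentially. h n \<le> 1"
    using h0 order_tendstoD(2)[of h 0 sequentially 1] by (auto simp: filterlim_at elim: eventually_mono)
  have e6: "\<forall>\<^sub>F n in sequentially. \<epsilon> n > 0"
    using eventually_ge_at_top[of 1] by eventually_elim (use \<epsilon> in auto)
  \<comment> \<open>\<open>2 powr (2 + 2 * \<alpha>)\<close> bounds the power of \<open>g / h\<close>; the rest is what remains once \<open>1 / \<epsilon>\<close> is absorbed.\<close>
  define r where "r n = 2 powr (2 + 2 * \<alpha>) * (exp (- (d n / 4)) + g n powr (\<gamma> - 1 - 2 * \<alpha>))" for n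
  have r0: "r \<longlonglongrightarrow> 0"
  proof -
    have "filterlim (\<lambda>n. d n / 4) at_top sequentially"
      using filterlim_tendsto_pos_mult_at_top[OF tendsto_const[of "1/4::real"] _ dinf] by simp
    then have "(\<lambda>n. exp (- (d n / 4))) \<longlonglongrightarrow> 0"
      by (intro filterlim_compose[OF exp_at_bot]) (simp add: filterlim_uminus_at_bot)
    moreover have "(\<lambda>n. g n powr (\<gamma> - 1 - 2 * \<alpha>)) \<longlonglongrightarrow> 0"
      using g0 \<gamma> by (intro tendsto_zero_powrI[of g _ "\<lambda>_. \<gamma> - 1 - 2 * \<alpha>" "\<gamma> - 1 - 2 * \<alpha>"])
        (auto simp: filterlim_at elim: eventually_mono)
    ultimately show ?thesis unfolding r_def by (auto intro!: tendsto_mult_right_zero tendsto_add_zero)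
  qed
  have main: "\<forall>\<^sub>F n in sequentially. norm (N n / h n * (b n / \<epsilon> n)) \<le> r n \<and> 0 \<le> b n / \<epsilon> n \<and> N n / h n \<ge> \<sigma> powr (- (1 + 2 * \<alpha>))"
    using e1 e2 e3 e4 e5 e6 pos eventually_ge_at_top[of 4]
  proof eventually_elim
    case (elim n)
    have n: "real n > 0" "n \<ge> 2" using elim by auto
    have "exp 1 < real n" using elim exp_le by linarith
    then have L1: "L n > 1" unfolding L_def using n ln_less_cancel_iff[of "exp 1" "real n"] by simp
    have sq: "exp (L n / 2) = sqrt (real n)"
      unfolding L_def using n by (simp add: powr_half_sqrt[symmetric] powr_def)
    have H1: "h n > 0" "exp (\<sigma>\<^sup>2 / (2 * (h n)\<^sup>2)) = sqrt (real n) * exp (\<eta> n * L n / 2)"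
      "\<And>a. h n powr a = \<sigma> powr a * ((1 + \<eta> n) * L n) powr (- a / 2)" "(h n)\<^sup>2 = \<sigma>\<^sup>2 / ((1 + \<eta> n) * L n)"
      using bandwidth_exp[OF h[OF n(2), folded L_def] \<sigma>] L1 elim by (auto simp: sq)
    have G1: "g n > 0" "exp (\<sigma>\<^sup>2 / (2 * (g n)\<^sup>2)) = sqrt (real n) * exp (\<delta> n * L n / 2)" "(g n)\<^sup>2 = \<sigma>\<^sup>2 / ((1 + \<delta> n) * L n)"
      using bandwidth_exp[OF g[OF n(2), folded L_def] \<sigma>] L1 elim by (auto simp: sq)
    have Nh: "N n / h n = h n powr (- (2 + 2 * \<alpha>)) * exp (- (\<eta> n * L n / 2))"
    proof -
      have "h n powr (2 + 2 * \<alpha>) = h n powr (1 + 2 * \<alpha>) * h n"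
        using H1(1) powr_add[of "h n" "1 + 2 * \<alpha>" 1] by simp
      then have "h n powr (- (2 + 2 * \<alpha>)) = 1 / (h n powr (1 + 2 * \<alpha>) * h n)"
        by (simp only: powr_minus_divide)
      then show ?thesis unfolding N_def H1(2) using n H1(1)
        by (simp add: exp_minus divide_simps)
    qed
    have bb: "b n = g n powr (2 + 2 * \<alpha>) * exp (\<delta> n * L n / 2) + g n powr (1 + \<gamma>)"
    proof -
      have "g n powr (2 + 2 * \<alpha>) = g n powr (1 + 2 * \<alpha>) * g n"
        using G1(1) powr_add[of "g n" "1 + 2 * \<alpha>" 1] by simp
      then show ?thesis unfolding b_def G1(2) using n by simp
    qed
    \<comment> \<open>Since \<open>\<eta> < 3\<close> and \<open>\<delta> \<ge> 0\<close>, the squared ratio is below 4.\<close>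
    have ratio: "g n / h n \<le> 2"
    proof (rule power2_le_imp_le)
      have "(g n / h n)\<^sup>2 = (1 + \<eta> n) / (1 + \<delta> n)"
      proof -
        have "1 + \<delta> n \<noteq> 0" "1 + \<eta> n \<noteq> 0" "\<sigma>\<^sup>2 \<noteq> 0" "L n \<noteq> 0" using \<sigma> L1 elim by auto
        then show ?thesis unfolding power_divide G1(3) H1(4) by (simp add: divide_simps del: power_eq_0_iff)
      qed
      also have "\<dots> \<le> 2\<^sup>2" using elim by (simp add: field_simps)
      finally show "(g n / h n)\<^sup>2 \<le> 2\<^sup>2" .
    qed simp
    have gh: "g n powr (2 + 2 * \<alpha>) * h n powr (- (2 + 2 * \<alpha>)) \<le> 2 powr (2 + 2 * \<alpha>)"
    proof -
      have "g n powr (2 + 2 * \<alpha>) * h n powr (- (2 + 2 * \<alpha>)) = (g n / h n) powr (2 + 2 * \<alpha>)"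
        unfolding powr_minus_divide using G1(1) H1(1) by (simp add: powr_divide)
      also have "\<dots> \<le> 2 powr (2 + 2 * \<alpha>)"
        using ratio G1(1) H1(1) \<alpha> by (intro powr_mono2) auto
      finally show ?thesis .
    qed
    have \<epsilon>e: "1 / \<epsilon> n = exp (- ln (\<epsilon> n))" using elim by (simp add: exp_minus inverse_eq_divide)
    have d: "d n = \<eta> n * L n - \<delta> n * L n" by (simp add: d_def algebra_simps)
    have dpos: "d n \<ge> 0" using elim L1 by (simp add: d_def)
    have \<delta>L: "\<delta> n * L n \<ge> 0" using elim L1 by simp
    have g2: "g n powr (1 + \<gamma>) = g n powr (2 + 2 * \<alpha>) * g n powr (\<gamma> - 1 - 2 * \<alpha>)"
      by (simp flip: powr_add)
    have "N n / h n * (b n / \<epsilon> n) = (g n powr (2 + 2 * \<alpha>) * h n powr (- (2 + 2 * \<alpha>))) *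
       (exp (- (\<eta> n * L n / 2)) * exp (\<delta> n * L n / 2) * (1 / \<epsilon> n) + exp (- (\<eta> n * L n / 2)) * (1 / \<epsilon> n) * g n powr (\<gamma> - 1 - 2 * \<alpha>))"
      unfolding Nh bb g2 by (simp add: algebra_simps add_divide_distrib)
    also have "\<dots> = (g n powr (2 + 2 * \<alpha>) * h n powr (- (2 + 2 * \<alpha>))) *
       (exp (- (d n / 2) - ln (\<epsilon> n)) + exp (- (\<eta> n * L n / 2) - ln (\<epsilon> n)) * g n powr (\<gamma> - 1 - 2 * \<alpha>))"
      unfolding \<epsilon>e d by (simp add: diff_divide_distrib algebra_simps flip: exp_add)
    also have "\<dots> \<le> 2 powr (2 + 2 * \<alpha>) * (exp (- (d n / 4)) + 1 * g n powr (\<gamma> - 1 - 2 * \<alpha>))"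
    proof (intro mult_mono add_mono gh mult_right_mono)
      show "exp (- (d n / 2) - ln (\<epsilon> n)) \<le> exp (- (d n / 4))" using elim by simp
      have "- (\<eta> n * L n / 2) - ln (\<epsilon> n) \<le> 0" using elim dpos \<delta>L d by linarith
      then show "exp (- (\<eta> n * L n / 2) - ln (\<epsilon> n)) \<le> 1" by simp
    qed auto
    finally have *: "N n / h n * (b n / \<epsilon> n) \<le> r n" by (simp add: r_def)
    have b0: "0 \<le> b n / \<epsilon> n" unfolding bb using elim by (intro divide_nonneg_pos add_nonneg_nonneg) auto
    have N1: "N n / h n \<ge> \<sigma> powr (- (1 + 2 * \<alpha>))"
    proof -
      have "1 \<le> exp ((- \<eta> n * L n + (1 + 2 * \<alpha>) * ln (L n)) / 2)"
        using elim by simp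
      also have "\<dots> = exp (- (\<eta> n * L n / 2)) * L n powr ((1 + 2 * \<alpha>) / 2)"
        using L1 by (simp add: powr_def add_divide_distrib flip: exp_add)
      also have "\<dots> \<le> exp (- (\<eta> n * L n / 2)) * ((1 + \<eta> n) * L n) powr ((1 + 2 * \<alpha>) / 2)"
        using L1 elim \<alpha> by (intro mult_left_mono powr_mono2) (auto simp: algebra_simps)
      finally have "\<sigma> powr (- (1 + 2 * \<alpha>)) * 1 \<le> \<sigma> powr (- (1 + 2 * \<alpha>)) * (exp (- (\<eta> n * L n / 2)) * ((1 + \<eta> n) * L n) powr ((1 + 2 * \<alpha>) / 2))"
        by (intro mult_left_mono) auto
      also have "\<dots> = h n powr (- (1 + 2 * \<alpha>)) * exp (- (\<eta> n * L n / 2))"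
        unfolding H1(3) by (simp add: add.commute)
      also have "\<dots> \<le> h n powr (- (2 + 2 * \<alpha>)) * exp (- (\<eta> n * L n / 2))"
        using H1(1) elim by (intro mult_right_mono powr_mono') auto
      finally show ?thesis unfolding Nh by simp
    qed
    have "0 \<le> N n / h n" using N1 order.trans[OF powr_ge_zero] by blast
    then have "0 \<le> N n / h n * (b n / \<epsilon> n)" using b0 by (rule mult_nonneg_nonneg)
    then have "norm (N n / h n * (b n / \<epsilon> n)) \<le> r n" using * by (simp only: real_norm_def abs_of_nonneg)
    then show ?case using b0 N1 by blast
  qed
  show lim: "(\<lambda>n. N n / h n * (b n / \<epsilon> n)) \<longlonglongrightarrow> 0"
    by (rule Lim_null_comparison[OF _ r0]) (use main in eventually_elim, auto)
  show "(\<lambda>n. b n / \<epsilon> n) \<longlonglongrightarrow> 0"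
  proof (rule Lim_null_comparison)
    show "(\<lambda>n. \<sigma> powr (1 + 2 * \<alpha>) * (N n / h n * (b n / \<epsilon> n))) \<longlonglongrightarrow> 0"
      using lim by (rule tendsto_mult_right_zero)
    show "\<forall>\<^sub>F n in sequentially. norm (b n / \<epsilon> n) \<le> \<sigma> powr (1 + 2 * \<alpha>) * (N n / h n * (b n / \<epsilon> n))"
      using main
    proof eventually_elim
      case (elim n)
      have "\<sigma> powr (- (1 + 2 * \<alpha>)) * (b n / \<epsilon> n) \<le> N n / h n * (b n / \<epsilon> n)"
        using elim by (intro mult_right_mono) auto
      then have "\<sigma> powr (1 + 2 * \<alpha>) * (\<sigma> powr (- (1 + 2 * \<alpha>)) * (b n / \<epsilon> n)) \<le> \<sigma> powr (1 + 2 * \<alpha>) * (N n / h n * (b n / \<epsilon> n))"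
        by (intro mult_left_mono) auto
      moreover have "\<sigma> powr (1 + 2 * \<alpha>) * \<sigma> powr (- (1 + 2 * \<alpha>)) = 1"
        using \<sigma> by (simp flip: powr_add)
      moreover have "norm (b n / \<epsilon> n) = b n / \<epsilon> n" using elim by (simp only: real_norm_def abs_of_nonneg)
      ultimately show ?case by (simp only: mult.assoc[symmetric] mult_1_left)
    qed
  qed
qed

section \<open>Linearization and asymptotic normality\<close>

context prob_space begin

lemma centred_iid_mean:
  fixes X :: "nat \<Rightarrow> 'a \<Rightarrow> real" and \<kappa> :: "real \<Rightarrow> real" and n :: nat
  assumes I: "indep_vars (\<lambda>_. borel) X {1..}"
    and dist: "\<forall>j\<ge>1. distr M borel (X j) = \<mu>"
    and [measurable]: "\<kappa> \<in> borel_measurable borel" and bound: "\<And>y. \<bar>\<kappa> y\<bar> \<le> K"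
  defines "m \<equiv> \<integral>y. \<kappa> y \<partial>\<mu>"
  defines "T \<equiv> \<lambda>\<omega>. (\<Sum>j=1..n. \<kappa> (X j \<omega>) - m) / real n"
  shows "random_variable borel T" "integrable M T" "integrable M (\<lambda>\<omega>. (T \<omega>)\<^sup>2)"
    "expectation T = 0" "expectation (\<lambda>\<omega>. (T \<omega>)\<^sup>2) \<le> (2 * K)\<^sup>2 / real n"
proof -
  have rv [measurable]: "random_variable borel (X j)" if "j \<ge> 1" for j
    using I that by (auto simp: indep_vars_def)
  have int: "integrable M (\<lambda>\<omega>. \<kappa> (X j \<omega>))" if "j \<ge> 1" for j
    using bound that by (intro integrable_const_bound[of _ K] AE_I2) auto
  have m: "expectation (\<lambda>\<omega>. \<kappa> (X j \<omega>)) = m" if "j \<ge> 1" for j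
    using that dist[rule_format, OF that, symmetric] by (simp add: m_def integral_distr)
  have mK: "\<bar>m\<bar> \<le> K"
  proof -
    have "\<bar>m\<bar> \<le> expectation (\<lambda>\<omega>. \<bar>\<kappa> (X 1 \<omega>)\<bar>)"
      unfolding m[of 1, OF order_refl, symmetric] by (rule integral_abs_bound)
    also have "\<dots> \<le> expectation (\<lambda>\<omega>. K)"
      using int[of 1] bound by (intro integral_mono) auto
    finally show ?thesis by (simp add: prob_space)
  qed
  have cb: "\<bar>\<kappa> y - m\<bar> \<le> 2 * K" for y using bound[of y] mK by linarith
  have c0: "expectation (\<lambda>\<omega>. \<kappa> (X j \<omega>) - m) = 0" if "j \<ge> 1" for j
    using int[OF that] m[OF that] by (simp add: prob_space)
  show rvT [measurable]: "random_variable borel T"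
    unfolding T_def by (intro borel_measurable_divide borel_measurable_sum borel_measurable_diff) auto
  show intT: "integrable M T"
    unfolding T_def using int by (intro integrable_divide Bochner_Integration.integrable_sum Bochner_Integration.integrable_diff) auto
  have "\<bar>T \<omega>\<bar> \<le> 2 * K" for \<omega>
  proof (cases "n = 0")
    case True
    then show ?thesis using mK by (simp add: T_def)
  next
    case False
    have "\<bar>\<Sum>j=1..n. \<kappa> (X j \<omega>) - m\<bar> \<le> (\<Sum>j=1..n. 2 * K)"
      by (rule order.trans[OF sum_abs]) (intro sum_mono cb)
    then show ?thesis using False by (simp add: T_def field_simps)
  qed
  then have "(T \<omega>)\<^sup>2 \<le> (2 * K)\<^sup>2" for \<omega>
    using power_mono[of "\<bar>T \<omega>\<bar>" "2 * K" 2] by simp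
  then show "integrable M (\<lambda>\<omega>. (T \<omega>)\<^sup>2)"
    by (intro integrable_const_bound[of _ "(2 * K)\<^sup>2"] AE_I2) auto
  show "expectation T = 0"
    unfolding T_def using int c0 by (simp add: Bochner_Integration.integral_sum del: sum_subtractf)
  have "indep_vars (\<lambda>_. borel) (\<lambda>j \<omega>. (\<lambda>y. \<kappa> y - m) (X j \<omega>)) {1..}"
    by (rule indep_vars_compose2[OF I]) auto
  then show "expectation (\<lambda>\<omega>. (T \<omega>)\<^sup>2) \<le> (2 * K)\<^sup>2 / real n"
    unfolding T_def using c0 cb by (intro second_moment_indep_mean_le) auto
qed

text \<open>
  The error splits into a centred mean of bounded variables and the bias. The first contributes a
  standard deviation of order \<open>g G / sqrt n\<close>, where \<open>G\<close> is the size of the kernel; total mass 2 of the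
  kernel transform makes \<open>p\<close> itself come out without bias.
\<close>

lemma p_est_mean_square:
  fixes X :: "nat \<Rightarrow> 'a \<Rightarrow> real" and q :: "real \<Rightarrow> complex" and n :: nat
  assumes k: "kernel_transform \<phi>k \<alpha> C"
    and I: "indep_vars (\<lambda>_. borel) X {1..}"
    and dist: "\<forall>j\<ge>1. distr M borel (X j) = \<mu>"
    and \<mu>: "real_distribution \<mu>"
    and char: "\<And>t. char \<mu> t = (of_real p + of_real (1 - p) * q t) * of_real (exp (- (\<sigma>\<^sup>2 * t\<^sup>2 / 2)))"
    and q: "continuous_on UNIV q" and p: "0 \<le> p" "p < 1" and g: "g > 0" and n: "n > 0"
    and mass: "(\<integral>t. \<phi>k t \<partial>lborel) = 2"
    and bias: "\<bar>\<integral>t. \<phi>k (g * t) * Re (q t) \<partial>lborel\<bar> \<le> K' * g powr \<gamma>"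
    and bound: "\<And>y. \<bar>deconv_kernel \<sigma> \<phi>k g y\<bar> \<le> K * G" and pos: "K \<ge> 0" "K' \<ge> 0" "G \<ge> 0"
  defines "Q \<equiv> \<lambda>\<omega>. p_est \<sigma> \<phi>k g n (\<lambda>j. X j \<omega>) - p"
  shows "random_variable borel Q" "integrable M (\<lambda>\<omega>. (Q \<omega>)\<^sup>2)"
    "expectation (\<lambda>\<omega>. (Q \<omega>)\<^sup>2) \<le> ((2 * (K + K')) * (g * G / sqrt (real n) + g powr (1 + \<gamma>)))\<^sup>2"
proof -
  interpret k: kernel_transform \<phi>k \<alpha> C by fact
  define m where "m = (\<integral>y. deconv_kernel \<sigma> \<phi>k g y \<partial>\<mu>)"
  define T where "T \<omega> = (\<Sum>j=1..n. deconv_kernel \<sigma> \<phi>k g (X j \<omega>) - m) / real n" for \<omega>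
  note T = centred_iid_mean[OF I dist k.deconv_kernel_measurable bound, where n=n, folded m_def, folded T_def]
  define v where "v = (1 - p) * (g / 2) * (\<integral>t. \<phi>k (g * t) * Re (q t) \<partial>lborel)"
  have m: "g / 2 * m = p + v"
  proof -
    have I1: "integrable lborel (\<lambda>t. \<phi>k (g * t))"
      using k.integrable_scaled[OF g, of "\<lambda>_. 1 :: real"] by simp
    have I2: "integrable lborel (\<lambda>t. \<phi>k (g * t) * Re (q t))"
      using k.integrable_scaled[OF g, of "\<lambda>t. Re (q t)"] q by (simp add: continuous_on_Re)
    have "m = (\<integral>t. \<phi>k (g * t) * Re (iexp (- (t * 0)) * (of_real p + of_real (1 - p) * q t)) \<partial>lborel)"
      using k.integral_deconv_kernel[OF \<mu> g char, of 0] by (simp add: m_def)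
    also have "\<dots> = (\<integral>t. p * \<phi>k (g * t) + (1 - p) * (\<phi>k (g * t) * Re (q t)) \<partial>lborel)"
      by (intro Bochner_Integration.integral_cong refl) (simp add: algebra_simps)
    also have "\<dots> = p * (\<integral>t. \<phi>k (g * t) \<partial>lborel) + (1 - p) * (\<integral>t. \<phi>k (g * t) * Re (q t) \<partial>lborel)"
      using I1 I2 by simp
    also have "(\<integral>t. \<phi>k (g * t) \<partial>lborel) = 2 / g"
      using lborel_integral_real_affine[of g \<phi>k 0] mass g by (simp add: field_simps)
    finally show ?thesis using g by (simp add: v_def field_simps)
  qed
  have Q: "Q = (\<lambda>\<omega>. g / 2 * T \<omega> + v)"
  proof
    fix \<omega>
    have "(\<Sum>j=1..n. deconv_kernel \<sigma> \<phi>k g (X j \<omega>)) / real n = T \<omega> + m"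
      using n by (simp add: T_def sum_subtractf diff_divide_distrib)
    then show "Q \<omega> = g / 2 * T \<omega> + v"
      unfolding Q_def k.p_est_eq[OF g] by (simp only: distrib_left m)
  qed
  show rvQ: "random_variable borel Q"
    unfolding Q using T(1) by measurable
  have IT: "integrable M (\<lambda>\<omega>. 2 * (g / 2)\<^sup>2 * (T \<omega>)\<^sup>2 + 2 * v\<^sup>2)"
    using T(3) by (intro Bochner_Integration.integrable_add integrable_mult_right) auto
  have le: "(Q \<omega>)\<^sup>2 \<le> 2 * (g / 2)\<^sup>2 * (T \<omega>)\<^sup>2 + 2 * v\<^sup>2" for \<omega>
    unfolding Q using sum_squares_bound[of "g / 2 * T \<omega>" v]
    by (simp add: power2_sum power_mult_distrib power_divide)
  show intQ: "integrable M (\<lambda>\<omega>. (Q \<omega>)\<^sup>2)"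
    by (rule Bochner_Integration.integrable_bound[OF IT]) (use rvQ le in \<open>auto intro!: AE_I2 order.trans[OF _ abs_ge_self]\<close>)
  define a b where "a = g * G / sqrt (real n)" and "b = g powr (1 + \<gamma>)"
  have a0: "a \<ge> 0" "b \<ge> 0" using g pos by (auto simp: a_def b_def)
  have vb: "\<bar>v\<bar> \<le> K' * b"
  proof -
    have "\<bar>v\<bar> = ((1 - p) / 2) * (g * \<bar>\<integral>t. \<phi>k (g * t) * Re (q t) \<partial>lborel\<bar>)"
      using p g by (simp add: v_def abs_mult)
    also have "\<dots> \<le> 1 * (g * (K' * g powr \<gamma>))"
      using p g pos bias by (intro mult_mono) auto
    also have "\<dots> = K' * b" using g by (simp add: b_def powr_add)
    finally show ?thesis .
  qed
  have "expectation (\<lambda>\<omega>. (Q \<omega>)\<^sup>2) \<le> expectation (\<lambda>\<omega>. 2 * (g / 2)\<^sup>2 * (T \<omega>)\<^sup>2 + 2 * v\<^sup>2)"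
    using le by (intro integral_mono intQ IT) auto
  also have "\<dots> = 2 * (g / 2)\<^sup>2 * expectation (\<lambda>\<omega>. (T \<omega>)\<^sup>2) + 2 * v\<^sup>2"
    using T(3) by (simp add: prob_space)
  also have "\<dots> \<le> 2 * (g / 2)\<^sup>2 * ((2 * (K * G))\<^sup>2 / real n) + 2 * (K' * b)\<^sup>2"
    using T(5) power_mono[OF vb, of 2] by (intro add_mono mult_left_mono) auto
  also have "\<dots> = 2 * (K * a)\<^sup>2 + 2 * (K' * b)\<^sup>2"
    using n by (simp add: a_def power_mult_distrib power_divide)
  also have "\<dots> \<le> 2 * (K * a + K' * b)\<^sup>2"
    using a0 pos by (simp add: power2_sum)
  also have "\<dots> \<le> 2 * ((K + K') * (a + b))\<^sup>2"
    using a0 pos by (intro mult_left_mono power_mono) (auto simp: algebra_simps)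
  also have "\<dots> \<le> ((2 * (K + K')) * (a + b))\<^sup>2"
  proof -
    have "((2 * (K + K')) * (a + b))\<^sup>2 = 4 * ((K + K') * (a + b))\<^sup>2"
      by (simp only: power_mult_distrib) simp
    then show ?thesis by simp
  qed
  finally show "expectation (\<lambda>\<omega>. (Q \<omega>)\<^sup>2) \<le> ((2 * (K + K')) * (g * G / sqrt (real n) + g powr (1 + \<gamma>)))\<^sup>2"
    by (simp add: a_def b_def)
qed

text \<open>
  The error of the estimator differs from \<open>S / (1 - p)\<close> by
  \<open>S (P - p) / ((1 - P) (1 - p)) + (W - f0) (p - P) / (1 - P)\<close>. Truncation at \<open>1 - \<epsilon>\<close> serves twice:
  it keeps \<open>1 - P \<ge> \<epsilon>\<close>, and once \<open>p \<le> 1 - \<epsilon>\<close> it only brings the estimator closer to \<open>p\<close>. The product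
  \<open>S (P - p)\<close> is handled by the Cauchy--Schwarz inequality, and \<open>W\<close> and \<open>f0\<close> are of order \<open>1 / h\<close>.
  The remainder is estimated in \<open>L\<^sup>1\<close> so that subtracting its expectation at most doubles the bound.
\<close>

lemma f_est_linearization:
  fixes X :: "nat \<Rightarrow> 'a \<Rightarrow> real" and q :: "real \<Rightarrow> complex" and n :: nat and x :: real
  assumes w: "kernel_transform \<phi>w \<alpha> A" and [measurable]: "\<phi>k \<in> borel_measurable borel"
    and I: "indep_vars (\<lambda>_. borel) X {1..}"
    and dist: "\<forall>j\<ge>1. distr M borel (X j) = \<mu>"
    and \<mu>: "real_distribution \<mu>"
    and char: "\<And>t. char \<mu> t = (of_real p + of_real (1 - p) * q t) * of_real (exp (- (\<sigma>\<^sup>2 * t\<^sup>2 / 2)))"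
    and q: "continuous_on UNIV q" "\<And>t. norm (q t) \<le> 1"
    and p: "p < 1" and h: "h > 0" and n: "n > 0" and \<epsilon>: "0 < \<epsilon>" "p \<le> 1 - \<epsilon>"
    and bound: "\<And>y. \<bar>deconv_kernel \<sigma> \<phi>w h y\<bar> \<le> K * H" and K: "K > 0" and H: "H > 0"
    and Q2: "integrable M (\<lambda>\<omega>. (p_est \<sigma> \<phi>k g n (\<lambda>j. X j \<omega>) - p)\<^sup>2)"
    and Qb: "expectation (\<lambda>\<omega>. (p_est \<sigma> \<phi>k g n (\<lambda>j. X j \<omega>) - p)\<^sup>2) \<le> b\<^sup>2" and b: "b > 0"
  defines "N \<equiv> sqrt (real n) / H"
    and "m \<equiv> \<integral>y. deconv_kernel \<sigma> \<phi>w h (y - x) \<partial>\<mu>"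
  defines "F \<equiv> \<lambda>\<omega>. f_est \<sigma> \<phi>w \<phi>k h g \<epsilon> n (\<lambda>j. X j \<omega>) x"
    and "S \<equiv> \<lambda>\<omega>. 1 / (2 * pi) * ((\<Sum>j=1..n. deconv_kernel \<sigma> \<phi>w h (X j \<omega> - x) - m) / real n)"
  shows "integrable M (\<lambda>\<omega>. N * (F \<omega> - expectation F) - N * (S \<omega> / (1 - p)))"
    and "expectation (\<lambda>\<omega>. \<bar>N * (F \<omega> - expectation F) - N * (S \<omega> / (1 - p))\<bar>)
      \<le> 2 * (K / (pi * (1 - p)) * (b / \<epsilon>) + (\<integral>t. \<bar>\<phi>w t\<bar> \<partial>lborel) / pi * (N / h * (b / \<epsilon>)))"
proof -
  interpret w: kernel_transform \<phi>w \<alpha> A by fact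
  have rv: "random_variable borel (X j)" if "j \<ge> 1" for j
    using I that by (auto simp: indep_vars_def)
  \<comment> \<open>\<open>X 0\<close> may fail to be measurable; the estimators do not see it.\<close>
  define X' where "X' j = (if j \<ge> 1 then X j else (\<lambda>_. 0))" for j
  have X' [measurable]: "random_variable borel (X' j)" for j using rv by (simp add: X'_def)
  define Q where "Q \<omega> = p_est \<sigma> \<phi>k g n (\<lambda>j. X j \<omega>)" for \<omega>
  have "Q = (\<lambda>\<omega>. p_est \<sigma> \<phi>k g n (\<lambda>j. X' j \<omega>))" "F = (\<lambda>\<omega>. f_est \<sigma> \<phi>w \<phi>k h g \<epsilon> n (\<lambda>j. X' j \<omega>) x)"
    unfolding Q_def F_def by (intro ext f_est_cong; simp add: X'_def)+
  then have [measurable]: "random_variable borel Q" "random_variable borel F"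
    using f_est_measurable[of X' M \<phi>w \<phi>k] by auto
  define W where "W = 1 / (2 * pi) * (\<integral>t. \<phi>w (h * t) * Re (iexp (- (t * x))) \<partial>lborel)"
  define f0 where "f0 = 1 / (2 * pi) * (\<integral>t. \<phi>w (h * t) * Re (iexp (- (t * x)) * q t) \<partial>lborel)"
  define J where "J = (\<integral>t. \<bar>\<phi>w t\<bar> \<partial>lborel)"
  have c1: "continuous_on UNIV (\<lambda>t. Re (iexp (- (t * x))))"
    by (auto intro!: continuous_intros)
  have c2: "continuous_on UNIV (\<lambda>t. Re (iexp (- (t * x)) * q t))"
    by (intro continuous_on_Re continuous_on_mult q) (auto intro!: continuous_intros)
  have b1: "\<bar>Re (iexp (- (t * x)))\<bar> \<le> 1" for t
    by (rule order.trans[OF abs_Re_le_cmod]) simp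
  have b2: "\<bar>Re (iexp (- (t * x)) * q t)\<bar> \<le> 1" for t
    by (rule order.trans[OF abs_Re_le_cmod]) (simp add: norm_mult q)
  have Wf: "\<bar>W - f0\<bar> \<le> J / (pi * h)"
  proof -
    have scale: "\<bar>1 / (2 * pi) * u\<bar> \<le> 1 / (2 * pi) * c" if "\<bar>u\<bar> \<le> c" for u c :: real
      using that by (simp add: abs_mult divide_right_mono)
    have "\<bar>W\<bar> \<le> 1 / (2 * pi) * (J / h)" "\<bar>f0\<bar> \<le> 1 / (2 * pi) * (J / h)"
      unfolding W_def f0_def J_def
      by (rule scale, rule w.abs_integral_scaled_le[OF h b1 c1],
          rule scale, rule w.abs_integral_scaled_le[OF h b2 c2])
    then have "\<bar>W - f0\<bar> \<le> 1 / (2 * pi) * (J / h) + 1 / (2 * pi) * (J / h)" by linarith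
    then show ?thesis using h by (simp add: field_simps)
  qed
  have J0: "J \<ge> 0" by (simp add: J_def)
  have m: "1 / (2 * pi) * m = p * W + (1 - p) * f0"
  proof -
    have "m = (\<integral>t. \<phi>w (h * t) * Re (iexp (- (t * x)) * (of_real p + of_real (1 - p) * q t)) \<partial>lborel)"
      using w.integral_deconv_kernel[OF \<mu> h char, of x] by (simp add: m_def)
    also have "\<dots> = (\<integral>t. p * (\<phi>w (h * t) * Re (iexp (- (t * x)))) + (1 - p) * (\<phi>w (h * t) * Re (iexp (- (t * x)) * q t)) \<partial>lborel)"
      by (intro Bochner_Integration.integral_cong refl) (simp add: algebra_simps)
    also have "\<dots> = p * (\<integral>t. \<phi>w (h * t) * Re (iexp (- (t * x))) \<partial>lborel) + (1 - p) * (\<integral>t. \<phi>w (h * t) * Re (iexp (- (t * x)) * q t) \<partial>lborel)"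
      using w.integrable_scaled[OF h c1] w.integrable_scaled[OF h c2] by simp
    finally show ?thesis by (simp add: W_def f0_def distrib_left)
  qed
  have bound': "\<bar>deconv_kernel \<sigma> \<phi>w h (y - x)\<bar> \<le> K * H" for y by (rule bound)
  have km: "(\<lambda>y. deconv_kernel \<sigma> \<phi>w h (y - x)) \<in> borel_measurable borel" by measurable
  note T = centred_iid_mean[OF I dist km bound', where n=n, folded m_def]
  have rvS [measurable]: "random_variable borel S" unfolding S_def using T(1) by (rule borel_measurable_times[OF borel_measurable_const])
  have intS: "integrable M S" unfolding S_def using T(2) by (rule integrable_mult_right)
  have intS2: "integrable M (\<lambda>\<omega>. (S \<omega>)\<^sup>2)"
    unfolding S_def power_mult_distrib using T(3) by (rule integrable_mult_right)
  have ES: "expectation S = 0" unfolding S_def using T(4) by simp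
  define a where "a = K * H / (pi * sqrt (real n))"
  have a: "a > 0" using K H n by (simp add: a_def)
  have ES2: "expectation (\<lambda>\<omega>. (S \<omega>)\<^sup>2) \<le> a\<^sup>2"
  proof -
    have "expectation (\<lambda>\<omega>. (S \<omega>)\<^sup>2) \<le> (1 / (2 * pi))\<^sup>2 * ((2 * (K * H))\<^sup>2 / real n)"
      unfolding S_def power_mult_distrib[of "1 / (2 * pi)"] integral_mult_right_zero
      using T(5) by (rule mult_left_mono) (rule zero_le_power2)
    also have "\<dots> = a\<^sup>2" by (simp add: a_def power_mult_distrib power_divide)
    finally show ?thesis .
  qed
  have N: "N > 0" using n H by (simp add: N_def)
  have Na: "N * a = K / pi" using n H by (simp add: N_def a_def)
  define P where "P \<omega> = min (Q \<omega>) (1 - \<epsilon>)" for \<omega>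
  have P1: "1 - P \<omega> \<ge> \<epsilon>" for \<omega> by (simp add: P_def)
  have Pp: "\<bar>P \<omega> - p\<bar> \<le> \<bar>Q \<omega> - p\<bar>" for \<omega> using \<epsilon> by (auto simp: P_def min_def)
  have F: "F \<omega> = (p * W + (1 - p) * f0 + S \<omega> - P \<omega> * W) / (1 - P \<omega>)" for \<omega>
  proof -
    have Peq: "p_hat \<sigma> \<phi>k g \<epsilon> n (\<lambda>j. X j \<omega>) = P \<omega>" by (simp add: p_hat_def P_def Q_def)
    have "P \<omega> \<noteq> 1" using P1[of \<omega>] \<epsilon> by auto
    then have "F \<omega> = (1 / (2 * pi) * ((\<Sum>j=1..n. deconv_kernel \<sigma> \<phi>w h (X j \<omega> - x)) / real n) - P \<omega> * W) / (1 - P \<omega>)"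
      using w.f_est_eq[OF h, of \<sigma> \<phi>k g \<epsilon> n "\<lambda>j. X j \<omega>" x] unfolding Peq F_def W_def by simp
    also have "1 / (2 * pi) * ((\<Sum>j=1..n. deconv_kernel \<sigma> \<phi>w h (X j \<omega> - x)) / real n) = 1 / (2 * pi) * m + S \<omega>"
      using n by (simp add: S_def sum_subtractf diff_divide_distrib right_diff_distrib)
    finally show ?thesis unfolding m by (simp only: add.assoc)
  qed
  \<comment> \<open>\<open>F\<close> is centred at the constant \<open>f0\<close> first, since its expectation is only accessible through \<open>D\<close>.\<close>
  define D where "D \<omega> = N * (F \<omega> - f0) - N * (S \<omega> / (1 - p))" for \<omega>
  have D: "D \<omega> = N * (S \<omega> * (P \<omega> - p) / ((1 - P \<omega>) * (1 - p)) + (W - f0) * (p - P \<omega>) / (1 - P \<omega>))" for \<omega>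
  proof -
    have ne: "1 - P \<omega> \<noteq> 0" "1 - p \<noteq> 0" using P1[of \<omega>] \<epsilon> p by auto
    have "F \<omega> - f0 - S \<omega> / (1 - p) = S \<omega> * (P \<omega> - p) / ((1 - P \<omega>) * (1 - p)) + (W - f0) * (p - P \<omega>) / (1 - P \<omega>)"
      unfolding F using ne by (simp add: divide_simps) (simp add: algebra_simps)
    then show ?thesis unfolding D_def by (simp only: right_diff_distrib[symmetric])
  qed
  define R where "R \<omega> = N * (\<bar>S \<omega> * (Q \<omega> - p)\<bar> / (\<epsilon> * (1 - p)) + J / (pi * h) * \<bar>1 * (Q \<omega> - p)\<bar> / \<epsilon>)" for \<omega>
  have DR: "\<bar>D \<omega>\<bar> \<le> R \<omega>" for \<omega>
  proof -
    have P0: "1 - P \<omega> > 0" using P1[of \<omega>] \<epsilon> by linarith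
    have "\<bar>D \<omega>\<bar> = N * \<bar>S \<omega> * (P \<omega> - p) / ((1 - P \<omega>) * (1 - p)) + (W - f0) * (p - P \<omega>) / (1 - P \<omega>)\<bar>"
      using N by (simp add: D abs_mult)
    also have "\<dots> \<le> N * (\<bar>S \<omega> * (P \<omega> - p) / ((1 - P \<omega>) * (1 - p))\<bar> + \<bar>(W - f0) * (p - P \<omega>) / (1 - P \<omega>)\<bar>)"
      using N by (intro mult_left_mono abs_triangle_ineq) auto
    also have "\<bar>S \<omega> * (P \<omega> - p) / ((1 - P \<omega>) * (1 - p))\<bar> = \<bar>S \<omega>\<bar> * \<bar>P \<omega> - p\<bar> / ((1 - P \<omega>) * (1 - p))"
      using P0 p by (simp add: abs_mult)
    also have "\<bar>(W - f0) * (p - P \<omega>) / (1 - P \<omega>)\<bar> = \<bar>W - f0\<bar> * \<bar>P \<omega> - p\<bar> / (1 - P \<omega>)"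
      using P0 by (simp add: abs_mult abs_minus_commute)
    also have "N * (\<bar>S \<omega>\<bar> * \<bar>P \<omega> - p\<bar> / ((1 - P \<omega>) * (1 - p)) + \<bar>W - f0\<bar> * \<bar>P \<omega> - p\<bar> / (1 - P \<omega>)) \<le>
        N * (\<bar>S \<omega>\<bar> * \<bar>Q \<omega> - p\<bar> / (\<epsilon> * (1 - p)) + J / (pi * h) * \<bar>Q \<omega> - p\<bar> / \<epsilon>)"
      using N p \<epsilon> P1 Pp Wf J0 h P0
      by (intro mult_left_mono add_mono frac_le mult_mono mult_right_mono mult_nonneg_nonneg) auto
    finally show ?thesis by (simp add: R_def abs_mult)
  qed
  have rvQp: "random_variable borel (\<lambda>\<omega>. Q \<omega> - p)" by measurable
  note SQ = expectation_abs_mult_le[OF rvS rvQp intS2 Q2[folded Q_def] ES2 Qb[folded Q_def] a b]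
  have one: "integrable M (\<lambda>\<omega>. (1::real)\<^sup>2)" "expectation (\<lambda>\<omega>. (1::real)\<^sup>2) \<le> 1\<^sup>2" by (simp_all add: prob_space)
  note Q1 = expectation_abs_mult_le[OF borel_measurable_const rvQp one(1) Q2[folded Q_def] one(2) Qb[folded Q_def] zero_less_one b]
  have intR: "integrable M R"
    unfolding R_def
    by (intro integrable_mult_right Bochner_Integration.integrable_add integrable_divide
        integrable_abs[OF SQ(1)] integrable_abs[OF Q1(1)])
  have ER: "expectation R \<le> K / (pi * (1 - p)) * (b / \<epsilon>) + J / pi * (N / h * (b / \<epsilon>))"
  proof -
    have "expectation R = N * (expectation (\<lambda>\<omega>. \<bar>S \<omega> * (Q \<omega> - p)\<bar>) / (\<epsilon> * (1 - p)) + J / (pi * h) * expectation (\<lambda>\<omega>. \<bar>1 * (Q \<omega> - p)\<bar>) / \<epsilon>)"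
      unfolding R_def using integrable_abs[OF SQ(1)] integrable_abs[OF Q1(1)] by simp
    also have "\<dots> \<le> N * (a * b / (\<epsilon> * (1 - p)) + J / (pi * h) * (1 * b) / \<epsilon>)"
      using N \<epsilon> p h J0 SQ(2) Q1(2) by (intro mult_left_mono add_mono divide_right_mono) auto
    also have "\<dots> = N * a / (1 - p) * (b / \<epsilon>) + J / pi * (N / h * (b / \<epsilon>))"
      by (simp add: distrib_left mult_ac)
    finally show ?thesis unfolding Na by simp
  qed
  have [measurable]: "random_variable borel D" unfolding D_def by measurable
  have intD: "integrable M D"
    by (rule Bochner_Integration.integrable_bound[OF intR]) (use DR in \<open>auto intro!: AE_I2 order.trans[OF _ abs_ge_self]\<close>)
  have FD: "F \<omega> = f0 + (D \<omega> / N + S \<omega> / (1 - p))" for \<omega>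
    using N by (simp add: D_def diff_divide_distrib)
  have EF: "expectation F = f0 + expectation D / N"
    unfolding FD using intD intS ES by (simp add: prob_space)
  have eq: "N * (F \<omega> - expectation F) - N * (S \<omega> / (1 - p)) = D \<omega> - expectation D" for \<omega>
  proof -
    have "N * (expectation D / N) = expectation D" using N by simp
    then show ?thesis unfolding EF D_def[of \<omega>] by (simp only: right_diff_distrib distrib_left)
  qed
  show "integrable M (\<lambda>\<omega>. N * (F \<omega> - expectation F) - N * (S \<omega> / (1 - p)))"
    unfolding eq using intD by simp
  have D1: "expectation (\<lambda>\<omega>. \<bar>D \<omega>\<bar>) \<le> expectation R"
    using DR intR intD by (intro integral_mono integrable_abs) auto
  have "expectation (\<lambda>\<omega>. \<bar>D \<omega> - expectation D\<bar>) \<le> expectation (\<lambda>\<omega>. \<bar>D \<omega>\<bar> + \<bar>expectation D\<bar>)"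
    using intD by (intro integral_mono integrable_abs abs_triangle_ineq4) auto
  also have "\<dots> = expectation (\<lambda>\<omega>. \<bar>D \<omega>\<bar>) + \<bar>expectation D\<bar>"
    using intD by (simp add: prob_space)
  also have "\<dots> \<le> 2 * expectation R"
    using D1 integral_abs_bound[of M D] by linarith
  finally show "expectation (\<lambda>\<omega>. \<bar>N * (F \<omega> - expectation F) - N * (S \<omega> / (1 - p))\<bar>)
      \<le> 2 * (K / (pi * (1 - p)) * (b / \<epsilon>) + (\<integral>t. \<bar>\<phi>w t\<bar> \<partial>lborel) / pi * (N / h * (b / \<epsilon>)))"
    unfolding eq using ER by (simp add: J_def)
qed

end

theorem theorem2p5:
  fixes M :: "'a measure"
    and U V Z :: "'a \<Rightarrow> real"
    and X :: "nat \<Rightarrow> 'a \<Rightarrow> real"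
    and f w k \<phi>w \<phi>k :: "real \<Rightarrow> real"
    and \<sigma> p \<gamma> \<alpha> A B C x :: real
    and h g \<eta> \<delta> \<epsilon> :: "nat \<Rightarrow> real"
  assumes "prob_space M"
    and "\<sigma> > 0" and "0 \<le> p" and "p < 1"
    \<comment> \<open>the model \<open>X = U V + \<sigma> Z\<close>\<close>
    and "prob_space.indep_vars M (\<lambda>_. borel) (\<lambda>i. [U, V, Z] ! i) {0, 1, 2}"
    and "measure M {\<omega> \<in> space M. U \<omega> = 0} = p"
    and "measure M {\<omega> \<in> space M. U \<omega> = 1} = 1 - p"
    and "\<And>y. 0 \<le> f y"
    and "distributed M lborel V (\<lambda>y. ennreal (f y))"
    and "distributed M lborel Z (\<lambda>z. ennreal (std_normal_density z))"
    \<comment> \<open>the i.i.d. copies\<close>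
    and "prob_space.indep_vars M (\<lambda>_. borel) X {1..}"
    and "\<And>j. j \<ge> 1 \<Longrightarrow>
           distr M borel (X j) = distr M borel (\<lambda>\<omega>. U \<omega> * V \<omega> + \<sigma> * Z \<omega>)"
    and "integrable M (\<lambda>\<omega>. (U \<omega> * V \<omega> + \<sigma> * Z \<omega>)\<^sup>2)"
    and "kernel_with_transform w \<phi>w" and "kernel_with_transform k \<phi>k"
    and "\<gamma> > 0" and "\<alpha> \<ge> 0" and "\<gamma> > 1 + 2 * \<alpha>"
    \<comment> \<open>(1)\<close>
    and "integrable lborel (\<lambda>u. complex_of_real (\<bar>u\<bar> powr \<gamma>) * cf_of_density f u)"
    \<comment> \<open>(2)\<close>
    and "bounded (range \<phi>w)"
    and "\<And>t. \<phi>w (- t) = \<phi>w t"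
    and "\<And>t. t \<notin> {-1..1} \<Longrightarrow> \<phi>w t = 0"
    and "\<phi>w 0 = 1"
    and "(\<lambda>t. \<phi>w (1 - t) - A * t powr \<alpha>) \<in> o[at_right 0](\<lambda>t. t powr \<alpha>)"
    \<comment> \<open>(3)\<close>
    and "bounded (range \<phi>k)"
    and "\<And>t. \<phi>k (- t) = \<phi>k t"
    and "\<And>t. t \<notin> {-1..1} \<Longrightarrow> \<phi>k t = 0"
    and "(\<integral>t\<in>{-1..1}. \<phi>k t \<partial>lborel) = 2"
    and "(\<lambda>t. \<phi>k t - B * t powr \<gamma>) \<in> o[at_right 0](\<lambda>t. t powr \<gamma>)"
    and "(\<lambda>t. \<phi>k (1 - t) - C * t powr \<alpha>) \<in> o[at_right 0](\<lambda>t. t powr \<alpha>)"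
    \<comment> \<open>(4)\<close>
    and "\<And>n. n \<ge> 2 \<Longrightarrow> h n = \<sigma> * ((1 + \<eta> n) * ln (real n)) powr (- 1 / 2)"
    and "\<And>n. n \<ge> 2 \<Longrightarrow> g n = \<sigma> * ((1 + \<delta> n) * ln (real n)) powr (- 1 / 2)"
    and "tends_down_to_0 \<eta>" and "tends_down_to_0 \<delta>"
    and "\<forall>\<^sub>F n in sequentially. \<eta> n - \<delta> n > 0"
    and "filterlim (\<lambda>n. (\<eta> n - \<delta> n) * ln (real n)) at_top sequentially"
    and "filterlim (\<lambda>n. - \<eta> n * ln (real n) + (1 + 2 * \<alpha>) * ln (ln (real n))) at_top sequentially"
    and "filterlim (\<lambda>n. - \<delta> n * ln (real n) + (1 + 2 * \<alpha>) * ln (ln (real n))) at_top sequentially"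
    \<comment> \<open>(5)\<close>
    and "\<And>n. n \<ge> 1 \<Longrightarrow> 0 < \<epsilon> n \<and> \<epsilon> n < 1"
    and "tends_down_to_0 \<epsilon>"
    and "(\<lambda>n. ln (\<epsilon> n) / ((\<eta> n - \<delta> n) * ln (real n))) \<longlonglongrightarrow> 0"
  shows "weak_conv_m
    (\<lambda>n. distr M borel (\<lambda>\<omega>.
        sqrt (real n) / (h n powr (1 + 2 * \<alpha>) * exp (\<sigma>\<^sup>2 / (2 * (h n)\<^sup>2))) *
          (f_est \<sigma> \<phi>w \<phi>k (h n) (g n) (\<epsilon> n) n (\<lambda>j. X j \<omega>) x
            - (\<integral>\<omega>'. f_est \<sigma> \<phi>w \<phi>k (h n) (g n) (\<epsilon> n) n (\<lambda>j. X j \<omega>') x \<partial>M))))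
    (normal_law 0
       (A\<^sup>2 / (2 * pi\<^sup>2 * (1 - p)\<^sup>2) * (1 / \<sigma>\<^sup>2) powr (2 + 2 * \<alpha>) * (Gamma (\<alpha> + 1))\<^sup>2))"
proof -
  interpret prob_space M by fact
  note \<sigma> = assms(2) and p = assms(3, 4) and f_nonneg = assms(8) and \<alpha> = assms(17)
  have w: "kernel_transform \<phi>w \<alpha> A"
    using assms by unfold_locales (auto simp: kernel_with_transform_def)
  have k: "kernel_transform \<phi>k \<alpha> C"
    using assms by unfold_locales (auto simp: kernel_with_transform_def)
  interpret w: kernel_transform \<phi>w \<alpha> A by (rule w)
  interpret k: kernel_transform \<phi>k \<alpha> C by (rule k)
  have ind: "indep_vars (\<lambda>_. borel) X {1..}" by fact
  have rv: "random_variable borel (X j)" if "j \<ge> 1" for j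
    using ind that by (auto simp: indep_vars_def)
  have [measurable]: "random_variable borel U" "random_variable borel V" "random_variable borel Z"
    using assms(5) by (auto simp: indep_vars_def dest!: bspec[where x="0::nat"] bspec[where x="1::nat"] bspec[where x="2::nat"])
  define \<mu> where "\<mu> = distr M borel (\<lambda>\<omega>. U \<omega> * V \<omega> + \<sigma> * Z \<omega>)"
  have \<mu>: "real_distribution \<mu>" unfolding \<mu>_def by (rule real_distribution_distr) measurable
  have dist: "\<forall>j\<ge>1. distr M borel (X j) = \<mu>" using assms(12) by (simp add: \<mu>_def)
  have charV: "char (distr M borel V) = cf_of_density f"
    using char_eq_cf_of_density[OF assms(9) f_nonneg] by (rule ext)
  interpret V: real_distribution "distr M borel V" by (rule real_distribution_distr) measurable
  have q_cont: "continuous_on UNIV (cf_of_density f)"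
    unfolding charV[symmetric] using V.isCont_char by (intro continuous_at_imp_continuous_on) auto
  have q_le: "norm (cf_of_density f t) \<le> 1" for t
    unfolding charV[symmetric] by (rule V.cmod_char_le_1)
  have char: "char \<mu> t = (of_real p + of_real (1 - p) * cf_of_density f t) * of_real (exp (- (\<sigma>\<^sup>2 * t\<^sup>2 / 2)))" for t
    unfolding \<mu>_def by (rule char_atomic_normal_sum; fact)
  have char0: "(char \<mu> \<longlongrightarrow> 0) at_top"
  proof (rule Lim_null_comparison)
    have "norm (of_real p + of_real (1 - p) * cf_of_density f t) \<le> p + (1 - p) * 1" for t
    proof (rule norm_triangle_le)
      have "(1 - p) * norm (cf_of_density f t) \<le> (1 - p) * 1"
        using p by (intro mult_left_mono q_le) auto
      moreover have "\<bar>p\<bar> = p" "\<bar>1 - p\<bar> = 1 - p" using p by auto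
      ultimately show "norm (complex_of_real p) + norm (complex_of_real (1 - p) * cf_of_density f t) \<le> p + (1 - p) * 1"
        by (simp only: norm_mult norm_of_real)
    qed
    then have "norm (char \<mu> t) \<le> 1 * exp (- (\<sigma>\<^sup>2 * t\<^sup>2 / 2))" for t
      unfolding char norm_mult by (intro mult_mono) auto
    then show "\<forall>\<^sub>F t in at_top. norm (char \<mu> t) \<le> exp (- (\<sigma>\<^sup>2 * t\<^sup>2 / 2))" by simp
    have "filterlim (\<lambda>t. \<sigma>\<^sup>2 / 2 * t\<^sup>2) at_top (at_top :: real filter)"
      using \<sigma> by (intro filterlim_tendsto_pos_mult_at_top[OF tendsto_const] filterlim_pow_at_top filterlim_ident) auto
    then have "filterlim (\<lambda>t. - (\<sigma>\<^sup>2 * t\<^sup>2 / 2)) at_bot (at_top :: real filter)"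
      by (simp add: filterlim_uminus_at_bot)
    then show "((\<lambda>t. exp (- (\<sigma>\<^sup>2 * t\<^sup>2 / 2))) \<longlongrightarrow> 0) at_top"
      by (rule filterlim_compose[OF exp_at_bot])
  qed
  obtain K1' where K1': "\<And>h y. h > 0 \<Longrightarrow> \<bar>deconv_kernel \<sigma> \<phi>w h y\<bar> \<le> K1' * (h powr (1 + 2 * \<alpha>) * exp (\<sigma>\<^sup>2 / (2 * h\<^sup>2)))" "K1' \<ge> 0"
    using w.deconv_kernel_bound[OF \<sigma>] by blast
  \<comment> \<open>Constants are enlarged to be positive, also when a kernel bound happens to be 0.\<close>
  define K1 where "K1 = K1' + 1"
  obtain K2 where K2: "\<And>h y. h > 0 \<Longrightarrow> \<bar>deconv_kernel \<sigma> \<phi>k h y\<bar> \<le> K2 * (h powr (1 + 2 * \<alpha>) * exp (\<sigma>\<^sup>2 / (2 * h\<^sup>2)))" "K2 \<ge> 0"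
    using k.deconv_kernel_bound[OF \<sigma>] by blast
  obtain Ko where Ko: "Ko \<ge> 0" "\<And>t. 0 < t \<Longrightarrow> t \<le> 1 \<Longrightarrow> \<bar>\<phi>k t\<bar> \<le> Ko * t powr \<gamma>"
    using abs_le_powr_of_asymp[OF assms(25) less_imp_le[OF assms(16)] assms(29)] by blast
  define K3 where "K3 = Ko * (\<integral>t. norm (complex_of_real (\<bar>t\<bar> powr \<gamma>) * cf_of_density f t) \<partial>lborel) + 1"
  have K3: "K3 > 0" using Ko by (simp add: K3_def add_nonneg_pos)
  have bias: "\<bar>\<integral>t. \<phi>k (c * t) * Re (cf_of_density f t) \<partial>lborel\<bar> \<le> K3 * c powr \<gamma>" if "c > 0" for c
  proof -
    have "\<bar>\<integral>t. \<phi>k (c * t) * Re (cf_of_density f t) \<partial>lborel\<bar> \<le>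
      Ko * c powr \<gamma> * (\<integral>t. norm (complex_of_real (\<bar>t\<bar> powr \<gamma>) * cf_of_density f t) \<partial>lborel)"
      by (rule mixing_bias_le[OF Ko k.phi_even k.phi_support k.phi_measurable that assms(19)]) auto
    also have "\<dots> \<le> K3 * c powr \<gamma>" by (simp add: K3_def algebra_simps)
    finally show ?thesis .
  qed
  have mass: "(\<integral>t. \<phi>k t \<partial>lborel) = 2"
  proof -
    have "(\<integral>t. \<phi>k t \<partial>lborel) = (\<integral>t\<in>{-1..1}. \<phi>k t \<partial>lborel)"
      unfolding set_lebesgue_integral_def
      by (intro Bochner_Integration.integral_cong refl) (use k.phi_support in \<open>fastforce simp: indicator_def\<close>)
    then show ?thesis using assms(28) by simp
  qed
  define H where "H n = h n powr (1 + 2 * \<alpha>) * exp (\<sigma>\<^sup>2 / (2 * (h n)\<^sup>2))" for n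
  define G where "G n = g n powr (1 + 2 * \<alpha>) * exp (\<sigma>\<^sup>2 / (2 * (g n)\<^sup>2))" for n
  define N where "N n = sqrt (real n) / H n" for n
  define b where "b n = g n * G n / sqrt (real n) + g n powr (1 + \<gamma>)" for n
  have rates: "filterlim h (at_right 0) sequentially" "filterlim g (at_right 0) sequentially"
    "(\<lambda>n. N n / h n * (b n / \<epsilon> n)) \<longlonglongrightarrow> 0" "(\<lambda>n. b n / \<epsilon> n) \<longlonglongrightarrow> 0"
    unfolding N_def H_def b_def G_def by (rule bandwidth_rates; fact)+
  have h_pos: "\<forall>\<^sub>F n in sequentially. h n > 0" and g_pos: "\<forall>\<^sub>F n in sequentially. g n > 0"
    using rates(1, 2) by (auto simp: filterlim_at elim: eventually_mono)
  define \<kappa> where "\<kappa> n y = deconv_kernel \<sigma> \<phi>w (h n) (y - x) / H n" for n y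
  have [measurable]: "\<kappa> n \<in> borel_measurable borel" for n unfolding \<kappa>_def by measurable
  have \<kappa>_bound: "\<forall>\<^sub>F n in sequentially. \<forall>y. \<bar>\<kappa> n y\<bar> \<le> K1'"
    using h_pos
  proof eventually_elim
    case (elim n)
    then show ?case using K1'(1)[OF elim] by (auto simp: \<kappa>_def H_def abs_mult field_simps)
  qed
  define a where "a = 2 * \<sigma> powr (- (2 + 2 * \<alpha>)) * A * Gamma (\<alpha> + 1)"
  have var: "(\<lambda>n. \<integral>y. (\<kappa> n y - (\<integral>z. \<kappa> n z \<partial>\<mu>))\<^sup>2 \<partial>\<mu>) \<longlonglongrightarrow> a\<^sup>2 / 2"
    unfolding \<kappa>_def H_def a_def by (rule w.variance_deconv_kernel_tendsto[OF \<mu> char0 rates(1) \<sigma>])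
  define T where "T n \<omega> = (\<Sum>j=1..n. \<kappa> n (X j \<omega>) - (\<integral>z. \<kappa> n z \<partial>\<mu>)) / sqrt (real n)" for n \<omega>
  have charT: "(\<lambda>n. char (distr M borel (T n)) t) \<longlonglongrightarrow> exp (- (a\<^sup>2 / 2 * t\<^sup>2 / 2))" for t
    unfolding T_def using dist by (intro char_bounded_array_tendsto[OF ind _ _ \<kappa>_bound var]) auto
  have rvT [measurable]: "random_variable borel (T n)" for n
    unfolding T_def using rv by (intro borel_measurable_divide borel_measurable_sum borel_measurable_diff) auto
  define c where "c = 1 / (2 * pi * (1 - p))"
  define v where "v = A\<^sup>2 / (2 * pi\<^sup>2 * (1 - p)\<^sup>2) * (1 / \<sigma>\<^sup>2) powr (2 + 2 * \<alpha>) * (Gamma (\<alpha> + 1))\<^sup>2"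
  have v0: "v \<ge> 0" by (simp add: v_def)
  have vc: "a\<^sup>2 / 2 * c\<^sup>2 = v"
  proof -
    have "(\<sigma> powr (- (2 + 2 * \<alpha>)))\<^sup>2 = (\<sigma> powr (- 2)) powr (2 + 2 * \<alpha>)"
      using \<sigma> by (simp add: powr_powr mult_ac flip: powr_numeral)
    also have "\<sigma> powr (- 2) = 1 / \<sigma>\<^sup>2" using \<sigma> by (simp add: powr_minus_divide)
    finally have s: "(\<sigma> powr (- (2 + 2 * \<alpha>)))\<^sup>2 = (1 / \<sigma>\<^sup>2) powr (2 + 2 * \<alpha>)" .
    have "a\<^sup>2 = 4 * (\<sigma> powr (- (2 + 2 * \<alpha>)))\<^sup>2 * A\<^sup>2 * (Gamma (\<alpha> + 1))\<^sup>2"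
      unfolding a_def by (simp only: power_mult_distrib) simp
    moreover have "c\<^sup>2 = 1 / (4 * pi\<^sup>2 * (1 - p)\<^sup>2)"
      by (simp add: c_def power_divide power_mult_distrib)
    ultimately show ?thesis unfolding s v_def by (simp add: mult_ac)
  qed
  define F where "F n \<omega> = f_est \<sigma> \<phi>w \<phi>k (h n) (g n) (\<epsilon> n) n (\<lambda>j. X j \<omega>) x" for n \<omega>
  have rvF [measurable]: "random_variable borel (F n)" for n
  proof -
    \<comment> \<open>\<open>X 0\<close> may fail to be measurable; the estimators do not see it.\<close>
    define X' where "X' j = (if j \<ge> 1 then X j else (\<lambda>_. 0))" for j
    have "random_variable borel (X' j)" for j using rv by (simp add: X'_def)
    moreover have "F n = (\<lambda>\<omega>. f_est \<sigma> \<phi>w \<phi>k (h n) (g n) (\<epsilon> n) n (\<lambda>j. X' j \<omega>) x)"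
      unfolding F_def by (intro ext f_est_cong) (simp add: X'_def)
    ultimately show ?thesis by (simp add: f_est_measurable)
  qed
  define R where "R n = (\<lambda>\<omega>. N n * (F n \<omega> - expectation (F n)) - c * T n \<omega>)" for n
  \<comment> \<open>The bound of \<open>f_est_linearization\<close> with \<open>b\<close> replaced by \<open>2 * (K2 + K3) * b n\<close>.\<close>
  define B where "B n = 2 * (K1 / (pi * (1 - p)) * ((2 * (K2 + K3)) * (b n / \<epsilon> n)) +
     (\<integral>t. \<bar>\<phi>w t\<bar> \<partial>lborel) / pi * ((2 * (K2 + K3)) * (N n / h n * (b n / \<epsilon> n))))" for n
  have "B \<longlonglongrightarrow> 2 * (K1 / (pi * (1 - p)) * ((2 * (K2 + K3)) * 0) + (\<integral>t. \<bar>\<phi>w t\<bar> \<partial>lborel) / pi * ((2 * (K2 + K3)) * 0))"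
    unfolding B_def by (intro tendsto_intros rates)
  then have B0: "B \<longlonglongrightarrow> 0" by simp
  have \<epsilon>p: "\<forall>\<^sub>F n in sequentially. \<epsilon> n < 1 - p"
    using assms(40) p by (auto simp: tends_down_to_0_def intro: order_tendstoD)
  have linear: "\<forall>\<^sub>F n in sequentially. integrable M (R n) \<and> expectation (\<lambda>\<omega>. \<bar>R n \<omega>\<bar>) \<le> B n"
    using h_pos g_pos \<epsilon>p eventually_gt_at_top[of 0]
  proof eventually_elim
    case (elim n)
    have \<epsilon>: "0 < \<epsilon> n" "p \<le> 1 - \<epsilon> n" using assms(39)[of n] elim by auto
    have pos: "H n > 0" "G n > 0" "K1 > 0" "K2 + K3 > 0" "b n > 0"
      using elim K1'(2) K2(2) K3 by (auto simp: H_def G_def K1_def b_def intro!: add_nonneg_pos)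
    have Dk: "\<bar>deconv_kernel \<sigma> \<phi>k (g n) y\<bar> \<le> K2 * G n" for y
      unfolding G_def using K2(1)[OF elim(2)] .
    have Dw: "\<bar>deconv_kernel \<sigma> \<phi>w (h n) y\<bar> \<le> K1 * H n" for y
      using K1'(1)[OF elim(1), of y] pos(1) by (simp add: K1_def H_def distrib_right)
    have "K2 \<ge> 0" "K3 \<ge> 0" "G n \<ge> 0" using K2(2) K3 pos by auto
    note Q = p_est_mean_square[OF k ind dist \<mu> char q_cont p elim(2) elim(4) mass bias[OF elim(2)] Dk this, folded b_def]
    have bb: "(2 * (K2 + K3)) * b n > 0" using pos by simp
    note lin = f_est_linearization[OF w k.phi_measurable ind dist \<mu> char q_cont q_le p(2) elim(1) elim(4) \<epsilon> Dw pos(3) pos(1) Q(2) Q(3) bb, of x,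
        folded N_def]
    define m where "m = (\<integral>y. deconv_kernel \<sigma> \<phi>w (h n) (y - x) \<partial>\<mu>)"
    have "N n * (1 / (2 * pi) * ((\<Sum>j=1..n. deconv_kernel \<sigma> \<phi>w (h n) (X j \<omega> - x) - m) / real n) / (1 - p)) = c * T n \<omega>" for \<omega>
    proof -
      have "(\<Sum>j=1..n. \<kappa> n (X j \<omega>) - (\<integral>z. \<kappa> n z \<partial>\<mu>)) = (\<Sum>j=1..n. deconv_kernel \<sigma> \<phi>w (h n) (X j \<omega> - x) - m) / H n"
        by (simp add: \<kappa>_def m_def sum_divide_distrib diff_divide_distrib)
      moreover have "sqrt (real n) / real n = 1 / sqrt (real n)"
        using elim by (simp add: field_simps)
      moreover have "N n * (1 / (2 * pi) * (s / real n) / (1 - p)) = c * (s / H n * (sqrt (real n) / real n))" for s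
        by (simp add: N_def c_def mult_ac)
      ultimately show ?thesis unfolding T_def by simp
    qed
    note eq = this[unfolded m_def]
    have R: "R n = (\<lambda>\<omega>. N n * (f_est \<sigma> \<phi>w \<phi>k (h n) (g n) (\<epsilon> n) n (\<lambda>j. X j \<omega>) x - expectation (\<lambda>\<omega>. f_est \<sigma> \<phi>w \<phi>k (h n) (g n) (\<epsilon> n) n (\<lambda>j. X j \<omega>) x)) - c * T n \<omega>)"
      unfolding R_def F_def[abs_def] ..
    show ?case using lin unfolding eq R B_def by (simp add: mult_ac)
  qed
  have "weak_conv_m (\<lambda>n. distr M borel (\<lambda>\<omega>. N n * (F n \<omega> - expectation (F n)))) (normal_law 0 v)"
  proof (rule levy_continuity)
    show "real_distribution (distr M borel (\<lambda>\<omega>. N n * (F n \<omega> - expectation (F n))))" for n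
      by (rule real_distribution_distr) measurable
    show "real_distribution (normal_law 0 v)" using v0 by (rule real_distribution_normal_law)
    fix t
    show "(\<lambda>n. char (distr M borel (\<lambda>\<omega>. N n * (F n \<omega> - expectation (F n)))) t) \<longlonglongrightarrow> char (normal_law 0 v) t"
    proof (rule char_tendsto_L1_perturbation)
      show "\<forall>\<^sub>F n in sequentially. integrable M (\<lambda>\<omega>. N n * (F n \<omega> - expectation (F n)) - c * T n \<omega>)"
        using linear by eventually_elim (simp add: R_def)
      show "(\<lambda>n. expectation (\<lambda>\<omega>. \<bar>N n * (F n \<omega> - expectation (F n)) - c * T n \<omega>\<bar>)) \<longlonglongrightarrow> 0"
      proof (rule Lim_null_comparison[OF _ B0])
        show "\<forall>\<^sub>F n in sequentially. norm (expectation (\<lambda>\<omega>. \<bar>N n * (F n \<omega> - expectation (F n)) - c * T n \<omega>\<bar>)) \<le> B n"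
          using linear by eventually_elim (simp add: R_def)
      qed
      have "char (distr M borel (\<lambda>\<omega>. c * T n \<omega>)) t = char (distr M borel (T n)) (t * c)" for n
        by (simp add: char_def integral_distr mult_ac)
      moreover have "exp (- (a\<^sup>2 / 2 * (t * c)\<^sup>2 / 2)) = exp (- (v * t\<^sup>2 / 2))"
        by (simp add: power_mult_distrib mult_ac flip: vc)
      ultimately show "(\<lambda>n. char (distr M borel (\<lambda>\<omega>. c * T n \<omega>)) t) \<longlonglongrightarrow> char (normal_law 0 v) t"
        using charT[of "t * c"] char_normal_law[OF v0, of t] by simp
    qed measurable
  qed
  then show ?thesis unfolding N_def H_def F_def v_def by (simp add: F_def[abs_def])
qed

end
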